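(* A compactly generated TDLC-group $G$ is hyperbolic if and only if $G$ is compactly presented and satisfies the weak linear isoperimetric inequality.
   Context: A TDLC-group is a totally disconnected locally compact Hausdorff topological group. A Cayley–Abels graph of a compactly generated TDLC-group $G$ is a connected locally finite graph on which $G$ acts vertex-transitively with compact open vertex stabilizers; $G$ is hyperbolic if it is compactly generated and some (equivalently every) Cayley–Abels graph is Gromov hyperbolic. $G$ is compactly presented if it admits a presentation $\langle K\mid R\rangle$ with $K$ compact and a uniform bound on the lengths of relators in $R$. For a TDLC-group $G$: a discrete $\mathbb{Q}[G]$-module is a left $\mathbb{Q}[G]$-module in which every element has open stabilizer (category ${}_{\mathbb{Q}[G]}\mathrm{dis}$). A $G$-set $\Omega$ is proper if all point stabilizers are compact open; $\mathbb{Q}[\Omega]$ is then a proper permutation module, finitely generated iff $\Omega/G$ is finite, with $\ell_1$-norm $\|\sum a_\omega\omega\|_1=\sum|a_\omega|$. $G$ has type $\mathrm{FP}_n$ if there is an exact sequence $\mathbb{Q}[\Omega_n]\to\cdots\to\mathbb{Q}[\Omega_0]\to\mathbb{Q}\to0$ in ${}_{\mathbb{Q}[G]}\mathrm{dis}$ with each $\Omega_i$ a proper $G$-set with finitely many orbits (a partial proper permutation resolution of finite type); compactly presented groups have type $\mathrm{FP}_2$. $G$ of type $\mathrm{FP}_{n+1}$ satisfies the weak $n$-dimensional linear isoperimetric inequality if for some (equivalently any) such resolution $\mathbb{Q}[\Omega_{n+1}]\xrightarrow{\delta_{n+1}}\mathbb{Q}[\Omega_n]\xrightarrow{\delta_n}\cdots\to\mathbb{Q}[\Omega_0]\to\mathbb{Q}\to0$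 there is $C>0$ with $\inf\{\|y\|_1: y\in\mathbb{Q}[\Omega_{n+1}],\ \delta_{n+1}(y)=x\}\le C\|x\|_1$ for all $x\in\ker\delta_n$. The case $n=1$ is called the weak linear isoperimetric inequality. *)

theory Defs
  imports "HOL-Analysis.Analysis" "HOL-Algebra.Algebra"
begin

definition tdlc_group :: "('g, 'b) monoid_scheme \<Rightarrow> 'g topology \<Rightarrow> bool" where
  "tdlc_group G T \<longleftrightarrow>
     group G \<and> topspace T = carrier G \<and>
     continuous_map (prod_topology T T) T (\<lambda>(x, y). x \<otimes>\<^bsub>G\<^esub> y) \<and>
     continuous_map T T (\<lambda>x. inv\<^bsub>G\<^esub> x) \<and>
     Hausdorff_space T \<and> locally_compact_space T \<and>
     (\<forall>x\<in>topspace T. connected_component_of_set T x = {x})"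

definition compactly_generated :: "('g, 'b) monoid_scheme \<Rightarrow> 'g topology \<Rightarrow> bool" where
  "compactly_generated G T \<longleftrightarrow>
     (\<exists>K. K \<subseteq> carrier G \<and> compactin T K \<and> generate G K = carrier G)"

definition compact_open_subgroup :: "('g, 'b) monoid_scheme \<Rightarrow> 'g topology \<Rightarrow> 'g set \<Rightarrow> bool" where
  "compact_open_subgroup G T U \<longleftrightarrow> subgroup U G \<and> openin T U \<and> compactin T U"

definition lcos :: "('g, 'b) monoid_scheme \<Rightarrow> 'g set \<Rightarrow> 'g set set" where
  "lcos G U = {a <#\<^bsub>G\<^esub> U | a. a \<in> carrier G}"

definition gwalk :: "('v \<Rightarrow> 'v \<Rightarrow> bool) \<Rightarrow> 'v list \<Rightarrow> bool" where
  "gwalk E xs \<longleftrightarrow> xs \<noteq> [] \<and> (\<forall>i. Suc i < length xs \<longrightarrow> E (xs ! i) (xs ! Suc i))"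

definition gdist :: "('v \<Rightarrow> 'v \<Rightarrow> bool) \<Rightarrow> 'v \<Rightarrow> 'v \<Rightarrow> nat" where
  "gdist E x y = (LEAST n. \<exists>xs. gwalk E xs \<and> hd xs = x \<and> last xs = y \<and> length xs = Suc n)"

definition gromov_product :: "('v \<Rightarrow> 'v \<Rightarrow> bool) \<Rightarrow> 'v \<Rightarrow> 'v \<Rightarrow> 'v \<Rightarrow> real" where
  "gromov_product E w x y =
     (real (gdist E w x) + real (gdist E w y) - real (gdist E x y)) / 2"

definition gromov_hyperbolic_graph :: "'v set \<Rightarrow> ('v \<Rightarrow> 'v \<Rightarrow> bool) \<Rightarrow> bool" where
  "gromov_hyperbolic_graph V E \<longleftrightarrow>
     (\<exists>\<delta>::real. \<forall>w\<in>V. \<forall>x\<in>V. \<forall>y\<in>V. \<forall>z\<in>V.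
        gromov_product E w x z \<ge> min (gromov_product E w x y) (gromov_product E w y z) - \<delta>)"

text \<open>A Cayley--Abels graph, with vertex set realised (up to G-isomorphism) as G/U,
  U a compact open subgroup (the stabilizer of a base vertex), G acting by left translation.\<close>
definition cayley_abels_graph ::
  "('g, 'b) monoid_scheme \<Rightarrow> 'g topology \<Rightarrow> 'g set \<Rightarrow> ('g set \<Rightarrow> 'g set \<Rightarrow> bool) \<Rightarrow> bool" where
  "cayley_abels_graph G T U E \<longleftrightarrow>
     compact_open_subgroup G T U \<and>
     (\<forall>x y. E x y \<longrightarrow> x \<in> lcos G U \<and> y \<in> lcos G U) \<and>
     (\<forall>x y. E x y \<longrightarrow> E y x) \<and> (\<forall>x. \<not> E x x) \<and>
     (\<forall>g\<in>carrier G. \<forall>x y. E x y \<longrightarrow> E (g <#\<^bsub>G\<^esub> x) (g <#\<^bsub>G\<^esub> y)) \<and>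
     (\<forall>x\<in>lcos G U. finite {y. E x y}) \<and>
     (\<forall>x\<in>lcos G U. \<forall>y\<in>lcos G U. \<exists>xs. gwalk E xs \<and> hd xs = x \<and> last xs = y)"

definition hyperbolic_tdlc :: "('g, 'b) monoid_scheme \<Rightarrow> 'g topology \<Rightarrow> bool" where
  "hyperbolic_tdlc G T \<longleftrightarrow> compactly_generated G T \<and>
     (\<exists>U E. cayley_abels_graph G T U E \<and> gromov_hyperbolic_graph (lcos G U) E)"

fun weval :: "('g, 'b) monoid_scheme \<Rightarrow> (bool \<times> 'g) list \<Rightarrow> 'g" where
  "weval G [] = \<one>\<^bsub>G\<^esub>"
| "weval G ((b, x) # w) = (if b then x else inv\<^bsub>G\<^esub> x) \<otimes>\<^bsub>G\<^esub> weval G w"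

definition word_over :: "'g set \<Rightarrow> (bool \<times> 'g) list \<Rightarrow> bool" where
  "word_over K w \<longleftrightarrow> (\<forall>l\<in>set w. snd l \<in> K)"

definition short_relators :: "('g, 'b) monoid_scheme \<Rightarrow> 'g set \<Rightarrow> nat \<Rightarrow> (bool \<times> 'g) list set" where
  "short_relators G K n = {r. word_over K r \<and> length r \<le> n \<and> weval G r = \<one>\<^bsub>G\<^esub>}"

definition relator_step ::
  "('g, 'b) monoid_scheme \<Rightarrow> 'g set \<Rightarrow> nat \<Rightarrow> (bool \<times> 'g) list \<Rightarrow> (bool \<times> 'g) list \<Rightarrow> bool" where
  "relator_step G K n u v \<longleftrightarrow> (\<exists>a b r. r \<in> short_relators G K n \<and> u = a @ r @ b \<and> v = a @ b)"

text \<open>G = \<langle>K | R\<rangle> with K compact and R consisting of words of length \<le> n: every word in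
  the kernel of F(K) \<rightarrow> G lies in the normal closure of R, i.e. can be transformed into
  the empty word by inserting/deleting relators of length \<le> n (free reductions are
  relators of length 2).\<close>
definition compactly_presented :: "('g, 'b) monoid_scheme \<Rightarrow> 'g topology \<Rightarrow> bool" where
  "compactly_presented G T \<longleftrightarrow>
     (\<exists>K n. K \<subseteq> carrier G \<and> compactin T K \<and> generate G K = carrier G \<and>
        (\<forall>w. word_over K w \<and> weval G w = \<one>\<^bsub>G\<^esub> \<longrightarrow>
              (symclp (relator_step G K n))\<^sup>*\<^sup>* w []))"

text \<open>A proper G-set with finitely many orbits, realised as the disjoint union of
  G/U j for j < m, each U j a compact open subgroup.\<close>
definition proper_orbits :: "('g, 'b) monoid_scheme \<Rightarrow> 'g topology \<Rightarrow> nat \<Rightarrow> (nat \<Rightarrow> 'g set) \<Rightarrow> bool" where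
  "proper_orbits G T m U \<longleftrightarrow> (\<forall>j<m. compact_open_subgroup G T (U j))"

definition Omega :: "('g, 'b) monoid_scheme \<Rightarrow> nat \<Rightarrow> (nat \<Rightarrow> 'g set) \<Rightarrow> (nat \<times> 'g set) set" where
  "Omega G m U = {(j, c). j < m \<and> c \<in> lcos G (U j)}"

definition act :: "('g, 'b) monoid_scheme \<Rightarrow> 'g \<Rightarrow> nat \<times> 'g set \<Rightarrow> nat \<times> 'g set" where
  "act G g \<omega> = (fst \<omega>, g <#\<^bsub>G\<^esub> snd \<omega>)"

definition supp :: "('a \<Rightarrow> rat) \<Rightarrow> 'a set" where
  "supp x = {\<omega>. x \<omega> \<noteq> 0}"

definition permmod :: "'a set \<Rightarrow> ('a \<Rightarrow> rat) set" where
  "permmod \<Omega> = {x. finite (supp x) \<and> supp x \<subseteq> \<Omega>}"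

definition norm1 :: "('a \<Rightarrow> rat) \<Rightarrow> rat" where
  "norm1 x = (\<Sum>\<omega>\<in>supp x. \<bar>x \<omega>\<bar>)"

definition translate ::
  "('g, 'b) monoid_scheme \<Rightarrow> (nat \<times> 'g set) set \<Rightarrow> 'g \<Rightarrow> (nat \<times> 'g set \<Rightarrow> rat) \<Rightarrow> (nat \<times> 'g set \<Rightarrow> rat)" where
  "translate G \<Omega> g y = (\<lambda>\<omega>. if \<omega> \<in> \<Omega> then y (act G (inv\<^bsub>G\<^esub> g) \<omega>) else 0)"

text \<open>A Q[G]-homomorphism Q[\<Omega>] \<rightarrow> Q[\<Omega>'] is given by G-equivariant images of basis elements.\<close>
definition perm_hom ::
  "('g, 'b) monoid_scheme \<Rightarrow> (nat \<times> 'g set) set \<Rightarrow> (nat \<times> 'g set) set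
     \<Rightarrow> (nat \<times> 'g set \<Rightarrow> nat \<times> 'g set \<Rightarrow> rat) \<Rightarrow> bool" where
  "perm_hom G \<Omega> \<Omega>' f \<longleftrightarrow>
     (\<forall>\<omega>\<in>\<Omega>. f \<omega> \<in> permmod \<Omega>' \<and>
        (\<forall>g\<in>carrier G. f (act G g \<omega>) = translate G \<Omega>' g (f \<omega>)))"

definition lin :: "('a \<Rightarrow> 'c \<Rightarrow> rat) \<Rightarrow> ('a \<Rightarrow> rat) \<Rightarrow> ('c \<Rightarrow> rat)" where
  "lin f x = (\<lambda>\<omega>'. \<Sum>\<omega>\<in>supp x. x \<omega> * f \<omega> \<omega>')"

text \<open>The augmentation Q[\<Omega>0] \<rightarrow> Q (trivial module): values on basis elements,
  constant on G-orbits.\<close>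
definition aug_hom :: "('g, 'b) monoid_scheme \<Rightarrow> (nat \<times> 'g set) set \<Rightarrow> (nat \<times> 'g set \<Rightarrow> rat) \<Rightarrow> bool" where
  "aug_hom G \<Omega> e \<longleftrightarrow> (\<forall>\<omega>\<in>\<Omega>. \<forall>g\<in>carrier G. e (act G g \<omega>) = e \<omega>)"

definition aug :: "('a \<Rightarrow> rat) \<Rightarrow> ('a \<Rightarrow> rat) \<Rightarrow> rat" where
  "aug e x = (\<Sum>\<omega>\<in>supp x. x \<omega> * e \<omega>)"

definition resolution2 ::
  "('g, 'b) monoid_scheme \<Rightarrow> 'g topology
   \<Rightarrow> nat \<Rightarrow> (nat \<Rightarrow> 'g set) \<Rightarrow> nat \<Rightarrow> (nat \<Rightarrow> 'g set) \<Rightarrow> nat \<Rightarrow> (nat \<Rightarrow> 'g set)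
   \<Rightarrow> (nat \<times> 'g set \<Rightarrow> nat \<times> 'g set \<Rightarrow> rat) \<Rightarrow> (nat \<times> 'g set \<Rightarrow> nat \<times> 'g set \<Rightarrow> rat)
   \<Rightarrow> (nat \<times> 'g set \<Rightarrow> rat) \<Rightarrow> bool" where
  "resolution2 G T m0 U0 m1 U1 m2 U2 d2 d1 e \<longleftrightarrow>
     proper_orbits G T m0 U0 \<and> proper_orbits G T m1 U1 \<and> proper_orbits G T m2 U2 \<and>
     perm_hom G (Omega G m2 U2) (Omega G m1 U1) d2 \<and>
     perm_hom G (Omega G m1 U1) (Omega G m0 U0) d1 \<and>
     aug_hom G (Omega G m0 U0) e \<and>
     (\<exists>x\<in>permmod (Omega G m0 U0). aug e x = 1) \<and>
     (\<forall>x\<in>permmod (Omega G m0 U0). aug e x = 0 \<longleftrightarrow> (\<exists>y\<in>permmod (Omega G m1 U1). lin d1 y = x)) \<and>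
     (\<forall>x\<in>permmod (Omega G m1 U1). lin d1 x = (\<lambda>_. 0) \<longleftrightarrow> (\<exists>y\<in>permmod (Omega G m2 U2). lin d2 y = x))"

definition weak_linear_isoperimetric :: "('g, 'b) monoid_scheme \<Rightarrow> 'g topology \<Rightarrow> bool" where
  "weak_linear_isoperimetric G T \<longleftrightarrow>
     (\<exists>m0 U0 m1 U1 m2 U2 d2 d1 e. resolution2 G T m0 U0 m1 U1 m2 U2 d2 d1 e \<and>
        (\<exists>C::real. C > 0 \<and>
          (\<forall>x\<in>permmod (Omega G m1 U1). lin d1 x = (\<lambda>_. 0) \<longrightarrow>
             Inf ((\<lambda>y. real_of_rat (norm1 y)) ` {y\<in>permmod (Omega G m2 U2). lin d2 y = x})
               \<le> C * real_of_rat (norm1 x))))"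

end

theory Submission
  imports Defs
begin

text \<open>
  From hyperbolicity to the two conditions: on a closed walk take the vertex farthest from the starting
  vertex; the four point condition shows that the walk is not geodesic near that vertex, so it can be
  shortened along a loop of bounded length. Applied to words, this gives a compact presentation with
  relators of bounded length. Applied to closed walks, and combined with the decomposition of rational
  cycles into closed walks, it gives the linear inequality for the resolution whose modules are spanned
  by vertices, oriented edges, and closed walks of bounded length.

  Conversely, choose an orbit of \<open>\<Omega>0\<close> on which the augmentation does not vanish as the vertex set of a
  Cayley--Abels graph. For 1-Lipschitz functions \<open>f\<close> and \<open>g\<close> on the vertices, the cochain \<open>f dg\<close> extends to
  a cochain on \<open>\<Omega>1\<close> that is bounded on boundaries, so the linear inequality bounds \<open>\<integral> f dg\<close> over a closed
  walk linearly in its length. Taking for \<open>f\<close> the truncated distance to one side of a geodesic polygon and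
  for \<open>g\<close> the distance to an endpoint of that side, one bounds the sides of polygons whose sides stay far
  from each other; hence geodesic triangles are slim. The transport uses only
  that chains and distances are bounded, so the vertices near a basis element may be chosen arbitrarily.
\<close>

section \<open>Walks and geodesics\<close>


text \<open>The inequality concerns rational chains in an abstract resolution, so there are no disc
  diagrams whose area could be estimated. The converse therefore argues by duality: a filling is
  only ever paired with a cochain. The coboundary of \<open>f dg\<close> behaves like the wedge of
  \<open>df\<close> and \<open>dg\<close>, which is bounded on cells of bounded diameter when both
  functions are Lipschitz; this is why a filling of small l1-norm controls the integral. Each side
  of a polygon is bounded only in terms of the total length, so the truncation height must exceed
  three times the constant before the total can be absorbed.

  In the other direction the obstacle is that \<open>G\<close> has to permute a basis without signs,
  while an element of \<open>G\<close> may reverse an edge. Both orientations of an edge are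
  therefore independent basis elements, and backtracking walks have to be filled in order to cancel
  one against the other. Much of the bookkeeping of constants in the filling estimate comes from
  this.\<close>

fun walk :: "('v \<Rightarrow> 'v \<Rightarrow> bool) \<Rightarrow> 'v \<Rightarrow> 'v list \<Rightarrow> 'v \<Rightarrow> bool" where
  "walk E x [] z \<longleftrightarrow> x = z"
| "walk E x (y # ys) z \<longleftrightarrow> E x y \<and> walk E y ys z"

lemma gwalk_Cons: "gwalk E (x # y # ys) \<longleftrightarrow> E x y \<and> gwalk E (y # ys)"
proof
  assume a: "gwalk E (x # y # ys)"
  then have st: "E ((x # y # ys) ! i) ((x # y # ys) ! Suc i)" if "Suc i < length (x # y # ys)" for i
    using that unfolding gwalk_def by blast
  have "E x y" using st[of 0] by simp
  moreover have "gwalk E (y # ys)"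
    unfolding gwalk_def
  proof (intro conjI allI impI)
    fix i assume "Suc i < length (y # ys)"
    then show "E ((y # ys) ! i) ((y # ys) ! Suc i)" using st[of "Suc i"] by simp
  qed simp
  ultimately show "E x y \<and> gwalk E (y # ys)" ..
next
  assume a: "E x y \<and> gwalk E (y # ys)"
  show "gwalk E (x # y # ys)"
    unfolding gwalk_def
  proof (intro conjI allI impI)
    fix i assume i: "Suc i < length (x # y # ys)"
    show "E ((x # y # ys) ! i) ((x # y # ys) ! Suc i)"
      using a i by (cases i) (auto simp: gwalk_def)
  qed simp
qed

text \<open>The list in \<open>walk\<close> omits the starting vertex, so its length counts edges
  and \<open>@\<close> concatenates walks, whereas \<open>gwalk\<close> lists all vertices.\<close>

lemma walk_iff_gwalk: "walk E x xs z \<longleftrightarrow> gwalk E (x # xs) \<and> last (x # xs) = z"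
proof (induction xs arbitrary: x)
  case Nil
  then show ?case by (auto simp: gwalk_def)
next
  case (Cons y ys)
  show ?case
    unfolding walk.simps gwalk_Cons Cons.IH by (auto split: if_splits)
qed

lemma gdist_eq_Least_walk: "gdist E x y = (LEAST n. \<exists>xs. walk E x xs y \<and> length xs = n)"
proof -
  have "(\<exists>xs. gwalk E xs \<and> hd xs = x \<and> last xs = y \<and> length xs = Suc n) \<longleftrightarrow>
        (\<exists>xs. walk E x xs y \<and> length xs = n)" for n
  proof
    assume "\<exists>xs. gwalk E xs \<and> hd xs = x \<and> last xs = y \<and> length xs = Suc n"
    then obtain xs where "gwalk E xs" "hd xs = x" "last xs = y" "length xs = Suc n" by blast
    moreover from this obtain ys where "xs = x # ys" by (cases xs) auto
    ultimately have "walk E x ys y \<and> length ys = n" by (simp add: walk_iff_gwalk)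
    then show "\<exists>xs. walk E x xs y \<and> length xs = n" ..
  next
    assume "\<exists>xs. walk E x xs y \<and> length xs = n"
    then obtain xs where "walk E x xs y" "length xs = n" by blast
    then show "\<exists>xs. gwalk E xs \<and> hd xs = x \<and> last xs = y \<and> length xs = Suc n"
      by (intro exI[of _ "x # xs"]) (simp add: walk_iff_gwalk)
  qed
  then show ?thesis unfolding gdist_def by simp
qed

lemma walk_append: "walk E x xs y \<Longrightarrow> walk E y ys z \<Longrightarrow> walk E x (xs @ ys) z"
  by (induction xs arbitrary: x) auto

lemma walk_append_iff: "walk E x (xs @ ys) z \<longleftrightarrow> walk E x xs (last (x # xs)) \<and> walk E (last (x # xs)) ys z"
  by (induction xs arbitrary: x) auto

lemma walk_last: "walk E x xs z \<Longrightarrow> last (x # xs) = z"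
  by (simp add: walk_iff_gwalk)

lemma gdist_le_walk: "walk E x xs y \<Longrightarrow> gdist E x y \<le> length xs"
  unfolding gdist_eq_Least_walk by (rule Least_le) blast

lemma gdist_self [simp]: "gdist E x x = 0"
  using gdist_le_walk[of E x "[]" x] by simp

lemma walk_map_upt:
  assumes "i \<le> j" "\<And>t. i \<le> t \<Longrightarrow> t < j \<Longrightarrow> E (p t) (p (Suc t))"
  shows "walk E (p i) (map p [Suc i..<Suc j]) (p j)"
  using assms
proof (induction rule: dec_induct)
  case base
  then show ?case by simp
next
  case (step n)
  have "walk E (p i) (map p [Suc i..<Suc n]) (p n)" using step by simp
  moreover have "walk E (p n) [p (Suc n)] (p (Suc n))" using step by simp
  ultimately have "walk E (p i) (map p [Suc i..<Suc n] @ [p (Suc n)]) (p (Suc n))"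
    by (rule walk_append)
  then show ?case using step by simp
qed

lemma walk_rev:
  assumes "\<And>x y. E x y \<Longrightarrow> E y x"
  shows "walk E x xs y \<Longrightarrow> \<exists>ys. walk E y ys x \<and> length ys = length xs \<and> y # ys = rev (x # xs)"
proof (induction xs arbitrary: x)
  case Nil
  then show ?case by auto
next
  case (Cons a xs)
  then obtain ys where ys: "walk E y ys a" "length ys = length xs" "y # ys = rev (a # xs)" by auto
  have "walk E y (ys @ [x]) x" using ys(1) Cons.prems assms by (intro walk_append[of _ _ _ a]) auto
  moreover have "y # ys @ [x] = rev (x # a # xs)" using ys(3) by simp
  ultimately show ?case using ys(2) by (intro exI[of _ "ys @ [x]"]) auto
qed

locale conn_graph =
  fixes V :: "'v set" and E :: "'v \<Rightarrow> 'v \<Rightarrow> bool"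
  assumes E_in_V: "E x y \<Longrightarrow> x \<in> V \<and> y \<in> V"
    and E_sym: "E x y \<Longrightarrow> E y x"
    and connected: "x \<in> V \<Longrightarrow> y \<in> V \<Longrightarrow> \<exists>xs. walk E x xs y"
begin

abbreviation "dist_E \<equiv> gdist E"

lemma geodesic_walk:
  assumes "x \<in> V" "y \<in> V" obtains xs where "walk E x xs y" "length xs = dist_E x y"
proof -
  have "\<exists>n. \<exists>xs. walk E x xs y \<and> length xs = n" using connected[OF assms] by auto
  from LeastI_ex[OF this] show ?thesis using that unfolding gdist_eq_Least_walk by blast
qed

lemma walk_in_V: "walk E x xs y \<Longrightarrow> x \<in> V \<Longrightarrow> set xs \<subseteq> V \<and> y \<in> V"
  by (induction xs arbitrary: x) (use E_in_V in auto)

lemma gdist_triangle: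
  assumes "x \<in> V" "y \<in> V" "z \<in> V" shows "dist_E x z \<le> dist_E x y + dist_E y z"
proof -
  obtain xs where xs: "walk E x xs y" "length xs = dist_E x y" using geodesic_walk assms by metis
  obtain ys where ys: "walk E y ys z" "length ys = dist_E y z" using geodesic_walk assms by metis
  show ?thesis using gdist_le_walk[OF walk_append[OF xs(1) ys(1)]] xs(2) ys(2) by simp
qed

lemma dist_sym: assumes "x \<in> V" "y \<in> V" shows "dist_E x y = dist_E y x"
proof -
  have "dist_E y x \<le> dist_E x y" if xy: "x \<in> V" "y \<in> V" for x y
  proof -
    obtain xs where xs: "walk E x xs y" "length xs = dist_E x y" using geodesic_walk xy by metis
    obtain ys where "walk E y ys x" "length ys = length xs" using walk_rev[OF E_sym xs(1)] by blast
    then show ?thesis using gdist_le_walk[of E y ys x] xs by simp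
  qed
  then show ?thesis using assms by (simp add: order_antisym)
qed

lemma dist_edge: "E x y \<Longrightarrow> dist_E x y \<le> 1"
  using gdist_le_walk[of E x "[y]" y] by simp

lemma dist_lazy_chain:
  assumes "\<And>i. i \<le> n \<Longrightarrow> p i \<in> V" "\<And>i. i < n \<Longrightarrow> dist_E (p i) (p (Suc i)) \<le> 1" "i \<le> j" "j \<le> n"
  shows "dist_E (p i) (p j) \<le> j - i"
  using assms(3,4)
proof (induction rule: dec_induct)
  case base
  then show ?case by simp
next
  case (step k)
  have "dist_E (p i) (p (Suc k)) \<le> dist_E (p i) (p k) + dist_E (p k) (p (Suc k))"
    using step assms(1) by (intro gdist_triangle) auto
  then show ?case using step assms(2)[of k] by auto
qed

text \<open>A closed walk all of whose subwalks of length \<open>2m\<close> are geodesic contradicts the four point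
  condition at the vertex farthest from the starting point.\<close>
lemma closed_walk_shortcut:
  fixes \<delta> :: real
  assumes hyp: "\<And>w x y z. w \<in> V \<Longrightarrow> x \<in> V \<Longrightarrow> y \<in> V \<Longrightarrow> z \<in> V \<Longrightarrow>
      gromov_product E w x z \<ge> min (gromov_product E w x y) (gromov_product E w y z) - \<delta>"
    and m: "real m > 2 * \<delta>" "1 \<le> m" "2 * m \<le> n"
    and pV: "\<And>i. i \<le> n \<Longrightarrow> p i \<in> V"
    and step: "\<And>i. i < n \<Longrightarrow> dist_E (p i) (p (Suc i)) \<le> 1"
    and closed: "p 0 = p n"
  shows "\<exists>i. i + 2 * m \<le> n \<and> dist_E (p i) (p (i + 2 * m)) < 2 * m"
proof (rule ccontr)
  assume "\<not> ?thesis"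
  then have long: "dist_E (p i) (p (i + 2 * m)) \<ge> 2 * m" if "i + 2 * m \<le> n" for i
    using that by (meson not_le)
  have ub: "dist_E (p i) (p j) \<le> j - i" if "i \<le> j" "j \<le> n" for i j
    using dist_lazy_chain[of n p i j] pV step that by blast
  have loc: "dist_E (p i) (p j) = j - i" if ij: "i \<le> j" "j \<le> n" "j - i \<le> 2 * m" for i j
  proof -
    \<comment> \<open>A window of length \<open>2 * m\<close> that contains \<open>i\<close> and
      \<open>j\<close> and does not run past \<open>n\<close>; being geodesic, it makes every
      subwalk geodesic.\<close>
    define s where "s = min i (n - 2 * m)"
    have s: "s \<le> i" "j \<le> s + 2 * m" "s + 2 * m \<le> n" using ij m unfolding s_def by auto
    have "dist_E (p s) (p (s + 2 * m)) \<le> dist_E (p s) (p i) + dist_E (p i) (p (s + 2 * m))"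
      by (rule gdist_triangle) (use s ij pV in auto)
    moreover have "dist_E (p i) (p (s + 2 * m)) \<le> dist_E (p i) (p j) + dist_E (p j) (p (s + 2 * m))"
      by (rule gdist_triangle) (use s ij pV in auto)
    moreover have "dist_E (p s) (p i) \<le> i - s" "dist_E (p j) (p (s + 2 * m)) \<le> s + 2 * m - j"
      using s ij by (auto intro!: ub)
    ultimately show ?thesis using long[OF s(3)] ub[OF ij(1,2)] s ij by linarith
  qed
  obtain i where i: "i \<le> n" "\<And>j. j \<le> n \<Longrightarrow> dist_E (p 0) (p j) \<le> dist_E (p 0) (p i)"
  proof -
    have fin: "finite ((\<lambda>j. dist_E (p 0) (p j)) ` {..n})" "(\<lambda>j. dist_E (p 0) (p j)) ` {..n} \<noteq> {}" by auto
    from Max_in[OF fin] obtain i where i: "i \<in> {..n}" "Max ((\<lambda>j. dist_E (p 0) (p j)) ` {..n}) = dist_E (p 0) (p i)"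
      by (rule imageE) blast
    show ?thesis
    proof (rule that[of i])
      show "i \<le> n" using i(1) by simp
      show "dist_E (p 0) (p j) \<le> dist_E (p 0) (p i)" if "j \<le> n" for j
        unfolding i(2)[symmetric] using that by (intro Max_ge[OF fin(1)]) simp
    qed
  qed
  \<comment> \<open>The vertex with index \<open>m\<close> is already at distance \<open>m\<close>
    from the start, so the farthest vertex is at least as far. Since the walk is closed, its index
    is then at least \<open>m\<close> away from both ends.\<close>
  have im: "m \<le> dist_E (p 0) (p i)" using i(2)[of m] loc[of 0 m] m by auto
  have a: "m \<le> i" using im ub[of 0 i] i(1) by auto
  have "dist_E (p 0) (p i) = dist_E (p i) (p n)" using dist_sym[OF pV pV] i(1) closed by simp
  then have b: "i + m \<le> n" using im ub[of i n] i(1) m(2) by linarith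
  define q r where "q = p (i - m)" and "r = p (i + m)"
  have qr: "dist_E q r = 2 * m" "dist_E q (p i) = m" "dist_E (p i) r = m" "q \<in> V" "r \<in> V"
    unfolding q_def r_def using a b by (auto simp: loc pV)
  have d0: "dist_E (p 0) q \<le> dist_E (p 0) (p i)" "dist_E (p 0) r \<le> dist_E (p 0) (p i)"
    unfolding q_def r_def using a b i(1) by (auto intro!: i(2))
  have V: "p i \<in> V" "p 0 \<in> V" using pV i(1) by auto
  \<comment> \<open>Seen from \<open>p i\<close>, the product of \<open>q\<close> and
    \<open>r\<close> is 0 because the walk is geodesic between them. The products with
    \<open>p 0\<close> are at least \<open>m / 2\<close>, since neither \<open>q\<close> nor
    \<open>r\<close> is farther from \<open>p 0\<close> than \<open>p i\<close> is. As
    \<open>m / 2 > \<delta>\<close>, this is impossible.\<close>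
  have "gromov_product E (p i) q r \<ge> min (gromov_product E (p i) q (p 0)) (gromov_product E (p i) (p 0) r) - \<delta>"
    by (rule hyp) (use V qr in auto)
  moreover have "dist_E (p i) q = m" "dist_E (p i) (p 0) = dist_E (p 0) (p i)" "dist_E q (p 0) = dist_E (p 0) q"
    using dist_sym V qr by metis+
  ultimately have "0 \<ge> min ((real m + real (dist_E (p 0) (p i)) - real (dist_E (p 0) q)) / 2)
      ((real (dist_E (p 0) (p i)) + real m - real (dist_E (p 0) r)) / 2) - \<delta>"
    using qr unfolding gromov_product_def by simp
  moreover have "min ((real m + real (dist_E (p 0) (p i)) - real (dist_E (p 0) q)) / 2)
      ((real (dist_E (p 0) (p i)) + real m - real (dist_E (p 0) r)) / 2) \<ge> real m / 2"
    using d0 by simp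
  ultimately show False using m(1) by linarith
qed

end

section \<open>Linear bounds on line integrals imply hyperbolicity\<close>


text \<open>The discrete integral of \<open>f dg\<close> along a walk, with \<open>f\<close> sampled
  at the tail of each edge.\<close>

fun line_int :: "('v \<Rightarrow> int) \<Rightarrow> ('v \<Rightarrow> int) \<Rightarrow> 'v \<Rightarrow> 'v list \<Rightarrow> int" where
  "line_int f g x [] = 0"
| "line_int f g x (y # ys) = f x * (g y - g x) + line_int f g y ys"

lemma line_int_append:
  "walk E x xs y \<Longrightarrow> line_int f g x (xs @ ys) = line_int f g x xs + line_int f g y ys"
  by (induction xs arbitrary: x) auto

lemma line_int_const:
  "walk E x xs y \<Longrightarrow> \<forall>v\<in>insert x (set xs). f v = k \<Longrightarrow> line_int f g x xs = k * (g y - g x)"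
  by (induction xs arbitrary: x) (auto simp: algebra_simps)

text \<open>Replacing \<open>f\<close> by the constant \<open>k\<close> costs at most
  \<open>k\<close> per edge. This handles the short arcs that connect the sides of a polygon, where
  only the range of \<open>f\<close> is known.\<close>

lemma line_int_near_const:
  assumes "\<And>v. 0 \<le> f v \<and> f v \<le> k" "\<And>u v. E u v \<Longrightarrow> \<bar>g u - g v\<bar> \<le> 1" "walk E x xs y"
  shows "\<bar>line_int f g x xs - k * (g y - g x)\<bar> \<le> k * int (length xs)"
  using assms(3)
proof (induction xs arbitrary: x)
  case Nil
  then show ?case by simp
next
  case (Cons z xs)
  have IH: "\<bar>line_int f g z xs - k * (g y - g z)\<bar> \<le> k * int (length xs)" using Cons by simp
  have "\<bar>(k - f x) * (g x - g z)\<bar> \<le> k * 1"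
    unfolding abs_mult using assms(1)[of x] assms(2)[of x z] Cons.prems
    by (intro mult_mono) auto
  moreover have "line_int f g x (z # xs) - k * (g y - g x) =
      (line_int f g z xs - k * (g y - g z)) + (k - f x) * (g x - g z)"
    by (simp add: algebra_simps)
  ultimately show ?case using IH by (simp add: algebra_simps)
qed

section \<open>Geodesics, slim triangles and the four point condition\<close>

context conn_graph
begin

text \<open>Only the endpoints and the vertex set of the geodesic are kept, so that a side of a
  polygon may be traversed in either direction (\<open>seg_rev\<close>).\<close>

definition seg :: "'v \<Rightarrow> 'v \<Rightarrow> 'v set \<Rightarrow> bool" where
  "seg a b S \<longleftrightarrow> a \<in> V \<and> (\<exists>xs. walk E a xs b \<and> length xs = dist_E a b \<and> insert a (set xs) = S)"

definition geod :: "(nat \<Rightarrow> 'v) \<Rightarrow> nat \<Rightarrow> bool" where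
  "geod p n \<longleftrightarrow> (\<forall>i\<le>n. p i \<in> V) \<and> (\<forall>i j. i \<le> j \<longrightarrow> j \<le> n \<longrightarrow> dist_E (p i) (p j) = j - i)"

lemma seg_in_V: "seg a b S \<Longrightarrow> a \<in> V \<and> b \<in> V \<and> S \<subseteq> V \<and> finite S \<and> a \<in> S"
  unfolding seg_def using walk_in_V by blast

lemma seg_rev: assumes "seg a b S" shows "seg b a S"
proof -
  obtain xs where xs: "walk E a xs b" "length xs = dist_E a b" "insert a (set xs) = S" and a: "a \<in> V"
    using assms unfolding seg_def by blast
  obtain ys where ys: "walk E b ys a" "length ys = length xs" "b # ys = rev (a # xs)"
    using walk_rev[OF E_sym xs(1)] by blast
  have "insert b (set ys) = set (b # ys)" by simp
  also have "\<dots> = S" using xs(3) unfolding ys(3) by simp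
  finally show ?thesis unfolding seg_def using xs ys a walk_in_V[OF xs(1) a] dist_sym by metis
qed

lemma geod_in_V: "geod p n \<Longrightarrow> i \<le> n \<Longrightarrow> p i \<in> V"
  unfolding geod_def by blast

lemma geod_dist: "geod p n \<Longrightarrow> i \<le> j \<Longrightarrow> j \<le> n \<Longrightarrow> dist_E (p i) (p j) = j - i"
  unfolding geod_def by blast

lemma geod_dist_rev: "geod p n \<Longrightarrow> i \<le> j \<Longrightarrow> j \<le> n \<Longrightarrow> dist_E (p j) (p i) = j - i"
  using geod_dist dist_sym geod_in_V by (metis order_trans)

lemma dist_1_edge: assumes "x \<in> V" "y \<in> V" "dist_E x y = 1" shows "E x y"
proof -
  obtain xs where "walk E x xs y" "length xs = 1" using geodesic_walk assms by metis
  then show ?thesis by (cases xs) auto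
qed

lemma geod_seg: assumes p: "geod p n" and ij: "i \<le> j" "j \<le> n" shows "seg (p i) (p j) (p ` {i..j})"
proof -
  have "E (p t) (p (Suc t))" if "i \<le> t" "t < j" for t
    using that ij p by (intro dist_1_edge) (auto simp: geod_in_V geod_dist)
  then have "walk E (p i) (map p [Suc i..<Suc j]) (p j)" using ij(1) by (rule walk_map_upt[rotated])
  moreover have "insert (p i) (set (map p [Suc i..<Suc j])) = p ` {i..j}"
    unfolding set_map set_upt image_insert[symmetric] using ij(1) by (intro arg_cong[of _ _ "image p"]) auto
  moreover have "length (map p [Suc i..<Suc j]) = dist_E (p i) (p j)" using geod_dist[OF p ij] by (simp del: upt_Suc)
  ultimately show ?thesis unfolding seg_def using geod_in_V[OF p, of i] ij
    by (intro conjI exI[of _ "map p [Suc i..<Suc j]"]) (simp_all only: order_trans)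
qed

lemma geod_exists:
  assumes "x \<in> V" "y \<in> V"
  obtains p where "geod p (dist_E x y)" "p 0 = x" "p (dist_E x y) = y"
proof -
  define n where "n = dist_E x y"
  obtain xs where xs: "walk E x xs y" "length xs = n" unfolding n_def using geodesic_walk assms by metis
  define p where "p = (\<lambda>i. (x # xs) ! i)"
  have gw: "gwalk E (x # xs)" "last (x # xs) = y" using xs(1) unfolding walk_iff_gwalk by auto
  have p0: "p 0 = x" unfolding p_def by simp
  have pn: "p n = y" unfolding p_def using gw(2) xs(2) by (metis diff_Suc_1 last_conv_nth length_Cons list.distinct(1))
  have pV: "p i \<in> V" if "i \<le> n" for i
  proof -
    have "p i \<in> set (x # xs)" unfolding p_def using that xs(2) by (intro nth_mem) simp
    then show ?thesis using walk_in_V[OF xs(1)] assms by auto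
  qed
  have st: "dist_E (p i) (p (Suc i)) \<le> 1" if "i < n" for i
    using gw(1) that xs(2) unfolding gwalk_def p_def by (intro dist_edge) auto
  have ub: "dist_E (p i) (p j) \<le> j - i" if "i \<le> j" "j \<le> n" for i j
    using dist_lazy_chain[of n p] pV st that by blast
  have "dist_E (p i) (p j) = j - i" if ij: "i \<le> j" "j \<le> n" for i j
  proof -
    have "dist_E (p 0) (p n) \<le> dist_E (p 0) (p i) + dist_E (p i) (p n)"
      by (rule gdist_triangle) (use pV ij in auto)
    moreover have "dist_E (p i) (p n) \<le> dist_E (p i) (p j) + dist_E (p j) (p n)"
      by (rule gdist_triangle) (use pV ij in auto)
    moreover have "dist_E (p 0) (p i) \<le> i" "dist_E (p j) (p n) \<le> n - j" using ub[of 0 i] ub[of j n] ij by auto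
    moreover have "dist_E (p 0) (p n) = n" using p0 pn n_def by simp
    ultimately show ?thesis using ub[OF ij] ij by linarith
  qed
  then have "geod p n" unfolding geod_def using pV by blast
  then show ?thesis using that p0 pn unfolding n_def by blast
qed

lemma gromov_product_le_dist_geod:
  assumes p: "geod p n" and w: "w \<in> V" and i: "i \<le> n"
  shows "gromov_product E w (p 0) (p n) \<le> real (dist_E w (p i))"
proof -
  have "dist_E w (p 0) \<le> dist_E w (p i) + dist_E (p i) (p 0)"
    by (rule gdist_triangle) (use geod_in_V[OF p] w i in auto)
  moreover have "dist_E w (p n) \<le> dist_E w (p i) + dist_E (p i) (p n)"
    by (rule gdist_triangle) (use geod_in_V[OF p] w i in auto)
  moreover have "dist_E (p i) (p 0) = i" "dist_E (p i) (p n) = n - i" "dist_E (p 0) (p n) = n"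
    using geod_dist[OF p] geod_dist_rev[OF p, of 0 i] i by auto
  ultimately have "dist_E w (p 0) + dist_E w (p n) \<le> 2 * dist_E w (p i) + dist_E (p 0) (p n)"
    using i by linarith
  then have "real (dist_E w (p 0) + dist_E w (p n)) \<le> real (2 * dist_E w (p i) + dist_E (p 0) (p n))"
    by (simp only: of_nat_le_iff)
  then show ?thesis unfolding gromov_product_def by simp
qed

text \<open>The geodesics \<open>q\<close> and \<open>r\<close> issue from the two ends of
  \<open>p\<close> and both run towards the third vertex of the triangle; this makes their roles
  interchangeable.\<close>

definition slim :: "nat \<Rightarrow> bool" where
  "slim \<delta> \<longleftrightarrow> (\<forall>p n q n2 r n3 t. geod p n \<longrightarrow> geod q n2 \<longrightarrow> geod r n3 \<longrightarrow>
     p 0 = q 0 \<longrightarrow> p n = r 0 \<longrightarrow> q n2 = r n3 \<longrightarrow> t \<le> n \<longrightarrow>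
     (\<exists>i\<le>n2. dist_E (p t) (q i) \<le> \<delta>) \<or> (\<exists>i\<le>n3. dist_E (p t) (r i) \<le> \<delta>))"

lemma slimD:
  assumes "slim \<delta>" "geod p n" "geod q n2" "geod r n3" "p 0 = q 0" "p n = r 0" "q n2 = r n3" "t \<le> n"
  shows "(\<exists>i\<le>n2. dist_E (p t) (q i) \<le> \<delta>) \<or> (\<exists>i\<le>n3. dist_E (p t) (r i) \<le> \<delta>)"
  using assms unfolding slim_def by blast

text \<open>The last vertex of \<open>p\<close> that is \<open>\<delta>\<close>-close to
  \<open>q\<close> is also \<open>(\<delta> + 1)\<close>-close to \<open>r\<close>, because its
  successor is \<open>\<delta>\<close>-close to \<open>r\<close>. The triangle inequality then gives
  the bound. Together with \<open>gromov_product_le_dist_geod\<close>, the Gromov product is the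
  distance to a geodesic up to an additive constant.\<close>

lemma slim_dist_geod_le:
  assumes sl: "slim \<delta>" and p: "geod p n" and w: "w \<in> V"
  shows "\<exists>i\<le>n. real (dist_E w (p i)) \<le> gromov_product E w (p 0) (p n) + real (2 * \<delta> + 1)"
proof -
  have pV: "p i \<in> V" if "i \<le> n" for i using geod_in_V[OF p that] .
  obtain q where q: "geod q (dist_E (p 0) w)" "q 0 = p 0" "q (dist_E (p 0) w) = w"
    using geod_exists[OF pV w] by blast
  obtain r where r: "geod r (dist_E (p n) w)" "r 0 = p n" "r (dist_E (p n) w) = w"
    using geod_exists[OF pV w] by blast
  define n2 n3 where "n2 = dist_E (p 0) w" and "n3 = dist_E (p n) w"
  have qr: "geod q n2" "geod r n3" "q n2 = w" "r n3 = w" using q r unfolding n2_def n3_def by auto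
  define A where "A = {t. t \<le> n \<and> (\<exists>i\<le>n2. dist_E (p t) (q i) \<le> \<delta>)}"
  have A: "finite A" "0 \<in> A" unfolding A_def using q(2) by (auto intro!: exI[of _ 0])
  define i where "i = Max A"
  have iA: "i \<in> A" unfolding i_def using A by (intro Max_in) auto
  then obtain a where a: "i \<le> n" "a \<le> n2" "dist_E (p i) (q a) \<le> \<delta>" unfolding A_def by blast
  have "\<exists>b\<le>n3. dist_E (p i) (r b) \<le> \<delta> + 1"
  proof (cases "i = n")
    case True
    then show ?thesis using r(2) by (auto intro!: exI[of _ 0])
  next
    case False
    then have "Suc i \<le> n" using a by simp
    moreover have "Suc i \<notin> A" using Max_ge[OF A(1), of "Suc i"] unfolding i_def by auto
    ultimately obtain b where b: "b \<le> n3" "dist_E (p (Suc i)) (r b) \<le> \<delta>"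
      using slimD[OF sl p qr(1,2), of "Suc i"] q r qr unfolding A_def by auto
    have "dist_E (p i) (r b) \<le> dist_E (p i) (p (Suc i)) + dist_E (p (Suc i)) (r b)"
      by (rule gdist_triangle) (use pV \<open>Suc i \<le> n\<close> geod_in_V[OF qr(2) b(1)] in auto)
    then show ?thesis using b geod_dist[OF p, of i "Suc i"] \<open>Suc i \<le> n\<close> by auto
  qed
  then obtain b where b: "b \<le> n3" "dist_E (p i) (r b) \<le> \<delta> + 1" by blast
  have V: "q a \<in> V" "r b \<in> V" "p i \<in> V" "p 0 \<in> V" "p n \<in> V" using geod_in_V qr a b pV by auto
  have e: "dist_E (p 0) w = dist_E (p 0) (q a) + dist_E (q a) w" "dist_E (p n) w = dist_E (p n) (r b) + dist_E (r b) w"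
    using geod_dist[OF qr(1), of 0 a] geod_dist[OF qr(1), of a n2] geod_dist[OF qr(2), of 0 b] geod_dist[OF qr(2), of b n3]
      qr q(2) r(2) a b n2_def n3_def by auto
  have "dist_E w (p i) \<le> dist_E w (q a) + dist_E (q a) (p i)" "dist_E w (p i) \<le> dist_E w (r b) + dist_E (r b) (p i)"
    "dist_E (p 0) (p i) \<le> dist_E (p 0) (q a) + dist_E (q a) (p i)" "dist_E (p n) (p i) \<le> dist_E (p n) (r b) + dist_E (r b) (p i)"
    by (rule gdist_triangle; use V w in simp)+
  moreover have "dist_E (p 0) (p i) = i" "dist_E (p n) (p i) = n - i" "dist_E (p 0) (p n) = n"
    using geod_dist[OF p] geod_dist_rev[OF p, of i n] a by auto
  moreover have "dist_E (q a) (p i) \<le> \<delta>" "dist_E (r b) (p i) \<le> \<delta> + 1" using a b dist_sym V by metis+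
  moreover have "dist_E w (q a) = dist_E (q a) w" "dist_E w (r b) = dist_E (r b) w"
    "dist_E w (p 0) = dist_E (p 0) w" "dist_E w (p n) = dist_E (p n) w" using dist_sym V w by metis+
  ultimately have "2 * dist_E w (p i) + dist_E (p 0) (p n) \<le> dist_E w (p 0) + dist_E w (p n) + 4 * \<delta> + 2"
    using e a(1) by linarith
  then have "real (2 * dist_E w (p i) + dist_E (p 0) (p n)) \<le> real (dist_E w (p 0) + dist_E w (p n) + 4 * \<delta> + 2)"
    by (simp only: of_nat_le_iff)
  then show ?thesis using a(1) unfolding gromov_product_def by (intro exI[of _ i]) (simp add: field_simps)
qed

text \<open>A vertex of the geodesic from \<open>x\<close> to \<open>z\<close> whose distance to
  \<open>w\<close> is the product of \<open>x\<close> and \<open>z\<close> up to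
  \<open>2 * \<delta> + 1\<close> is \<open>\<delta>\<close>-close to one of the other two sides,
  and this bounds one of the other products.\<close>

lemma slim_hyperbolic:
  assumes sl: "slim \<delta>" shows "gromov_hyperbolic_graph V E"
  unfolding gromov_hyperbolic_graph_def
proof (intro exI[of _ "real (3 * \<delta> + 1)"] ballI)
  fix w x y z assume V: "w \<in> V" "x \<in> V" "y \<in> V" "z \<in> V"
  obtain p where p: "geod p (dist_E x z)" "p 0 = x" "p (dist_E x z) = z" using geod_exists V by metis
  obtain q where q: "geod q (dist_E x y)" "q 0 = x" "q (dist_E x y) = y" using geod_exists V by metis
  obtain r where r: "geod r (dist_E z y)" "r 0 = z" "r (dist_E z y) = y" using geod_exists V by metis
  obtain t where t: "t \<le> dist_E x z" "real (dist_E w (p t)) \<le> gromov_product E w x z + real (2 * \<delta> + 1)"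
    using slim_dist_geod_le[OF sl p(1) V(1)] p by auto
  have near: "min (gromov_product E w x y) (gromov_product E w y z) \<le> real (dist_E w (p t)) + real \<delta>"
  proof -
    consider i where "i \<le> dist_E x y" "dist_E (p t) (q i) \<le> \<delta>" | i where "i \<le> dist_E z y" "dist_E (p t) (r i) \<le> \<delta>"
      using slimD[OF sl p(1) q(1) r(1) _ _ _ t(1)] p q r by auto
    then show ?thesis
    proof cases
      case 1
      have "dist_E w (q i) \<le> dist_E w (p t) + dist_E (p t) (q i)"
        by (rule gdist_triangle) (use V 1 t geod_in_V p(1) q(1) in auto)
      moreover have "gromov_product E w x y \<le> real (dist_E w (q i))"
        using gromov_product_le_dist_geod[OF q(1) V(1) 1(1)] q by simp
      ultimately show ?thesis using 1(2) by linarith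
    next
      case 2
      have "dist_E w (r i) \<le> dist_E w (p t) + dist_E (p t) (r i)"
        by (rule gdist_triangle) (use V 2 t geod_in_V p(1) r(1) in auto)
      moreover have "gromov_product E w z y \<le> real (dist_E w (r i))"
        using gromov_product_le_dist_geod[OF r(1) V(1) 2(1)] r by simp
      moreover have "gromov_product E w z y = gromov_product E w y z"
        unfolding gromov_product_def using dist_sym[of z y] V by simp
      ultimately show ?thesis using 2(2) by linarith
    qed
  qed
  show "gromov_product E w x z \<ge> min (gromov_product E w x y) (gromov_product E w y z) - real (3 * \<delta> + 1)"
    using near t(2) by simp
qed

end

text \<open>All that the geometric argument retains of the isoperimetric inequality. The added 1 in
  the bound covers the slack that arises because an infimum of norms need not be attained.\<close>

locale isoperimetric_graph = conn_graph +
  fixes C :: nat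
  assumes line_int_bound: "x \<in> V \<Longrightarrow> walk E x xs x \<Longrightarrow> (\<And>u v. E u v \<Longrightarrow> \<bar>f u - f v\<bar> \<le> 1) \<Longrightarrow>
    (\<And>u v. E u v \<Longrightarrow> \<bar>g u - g v\<bar> \<le> 1) \<Longrightarrow> \<bar>line_int f g x xs\<bar> \<le> int C * (int (length xs) + 1)"
begin

text \<open>Summing the estimates for three sides gives \<open>gap * L \<le> 3 * C * L\<close> plus
  a constant, where \<open>L\<close> is the total length; the surplus of 1 is what bounds
  \<open>L\<close>.\<close>

definition "gap = 3 * C + 1"

definition "far S S' \<longleftrightarrow> (\<forall>u\<in>S. \<forall>v\<in>S'. gap \<le> dist_E u v)"

text \<open>Integrating \<open>min k d(\<cdot>,S) d(a,\<cdot>)\<close> around the loop sees only the part of the loop away from the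
  side \<open>S\<close>, where it amounts to \<open>k\<close> times the length of \<open>S\<close>.\<close>
lemma side_length_bound:
  assumes S: "walk E a ss b" "length ss = dist_E a b" "a \<in> V"
    and s1: "walk E b s1 c" "length s1 \<le> 2 * gap" and t1: "walk E c t1 d"
    and s2: "walk E d s2 e" "length s2 \<le> 2 * gap" and t2: "walk E e t2 h"
    and s3: "walk E h s3 a" "length s3 \<le> 2 * gap"
    and fr: "far (insert c (set t1)) (insert a (set ss))" "far (insert e (set t2)) (insert a (set ss))"
  shows "gap * length ss \<le> C * (length ss + length t1 + length t2 + 6 * gap + 1) + 6 * gap * gap"
proof -
  define SS where "SS = insert a (set ss)"
  have SV: "SS \<subseteq> V" "finite SS" "SS \<noteq> {}" unfolding SS_def using walk_in_V S by auto
  \<comment> \<open>The truncation makes \<open>f\<close> constant equal to \<open>gap\<close> on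
    the two far sides, so that \<open>f dg\<close> telescopes there, while \<open>f\<close> vanishes
    on the side \<open>SS\<close>.\<close>
  define f where "f = (\<lambda>v. min (int gap) (int (Min (dist_E v ` SS))))"
  define g where "g = (\<lambda>v. int (dist_E a v))"
  have fle: "Min (dist_E u ` SS) \<le> Min (dist_E v ` SS) + 1" if "E u v" for u v
  proof -
    have "Min (dist_E v ` SS) \<in> dist_E v ` SS" using SV by (intro Min_in) auto
    then obtain s where s: "s \<in> SS" "Min (dist_E v ` SS) = dist_E v s" by blast
    have "Min (dist_E u ` SS) \<le> dist_E u s" using SV s by (intro Min_le) auto
    also have "\<dots> \<le> dist_E u v + dist_E v s"
      by (rule gdist_triangle) (use E_in_V[OF that] s SV in auto)
    finally show ?thesis using dist_edge[OF that] s(2) by linarith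
  qed
  have f1: "\<bar>f u - f v\<bar> \<le> 1" if "E u v" for u v
    using fle[OF that] fle[OF E_sym[OF that]] unfolding f_def by linarith
  have g1: "\<bar>g u - g v\<bar> \<le> 1" if "E u v" for u v
  proof -
    have uv: "u \<in> V" "v \<in> V" using E_in_V[OF that] by auto
    have "dist_E a u \<le> dist_E a v + dist_E v u" "dist_E a v \<le> dist_E a u + dist_E u v"
      by (rule gdist_triangle; use uv S in simp)+
    then show ?thesis using dist_edge[OF that] dist_edge[OF E_sym[OF that]] unfolding g_def by linarith
  qed
  have fb: "0 \<le> f v \<and> f v \<le> int gap" for v unfolding f_def by auto
  have f0: "f v = 0" if "v \<in> SS" for v
  proof -
    have "Min (dist_E v ` SS) \<le> dist_E v v" by (rule Min_le[OF finite_imageI[OF SV(2)] imageI[OF that]])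
    then show ?thesis unfolding f_def by simp
  qed
  have fk: "f v = int gap" if "\<forall>s\<in>SS. gap \<le> dist_E v s" for v
  proof -
    have "gap \<le> Min (dist_E v ` SS)" using that SV by (intro Min.boundedI) auto
    then show ?thesis unfolding f_def by simp
  qed
  define K where "K = int gap"
  have "line_int f g a ss = 0 * (g b - g a)" by (rule line_int_const[OF S(1)]) (use f0 SS_def in auto)
  moreover have "line_int f g c t1 = K * (g d - g c)" "line_int f g e t2 = K * (g h - g e)"
    unfolding K_def by (rule line_int_const[OF t1(1)] line_int_const[OF t2(1)];
      use fr fk in \<open>auto simp: far_def SS_def\<close>)+
  moreover have nb: "\<bar>line_int f g x s - K * (g y - g x)\<bar> \<le> K * (2 * K)" if "walk E x s y" "length s \<le> 2 * gap" for x y s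
  proof -
    have "\<bar>line_int f g x s - K * (g y - g x)\<bar> \<le> K * int (length s)"
      unfolding K_def by (rule line_int_near_const[OF fb g1 that(1)])
    also have "\<dots> \<le> K * (2 * K)" using that(2) unfolding K_def by (intro mult_left_mono) auto
    finally show ?thesis by simp
  qed
  note nb[OF s1] nb[OF s2] nb[OF s3]
  moreover have "line_int f g a (ss @ s1 @ t1 @ s2 @ t2 @ s3) =
      line_int f g a ss + line_int f g b s1 + line_int f g c t1 + line_int f g d s2 + line_int f g e t2 + line_int f g h s3"
    using S s1 t1 s2 t2 s3 by (simp add: line_int_append)
  moreover have "g a = 0" "g b = int (length ss)" unfolding g_def using S by auto
  \<comment> \<open>If \<open>f\<close> were \<open>K\<close> on the whole way from \<open>b\<close>
    back to \<open>a\<close>, the integral would be \<open>K * (g a - g b)\<close>, which is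
    \<open>- K * length ss\<close>. Each of the three connecting arcs perturbs this by at most
    \<open>2 * K * K\<close>.\<close>
  ultimately have A: "K * int (length ss) \<le> \<bar>line_int f g a (ss @ s1 @ t1 @ s2 @ t2 @ s3)\<bar> + 6 * K * K"
    by (simp add: algebra_simps)
  have "walk E a (ss @ s1 @ t1 @ s2 @ t2 @ s3) a"
    using S s1 t1 s2 t2 s3 by (auto intro!: walk_append)
  from line_int_bound[OF S(3) this f1 g1]
  have "\<bar>line_int f g a (ss @ s1 @ t1 @ s2 @ t2 @ s3)\<bar> \<le> int C * (int (length (ss @ s1 @ t1 @ s2 @ t2 @ s3)) + 1)" .
  also have "\<dots> \<le> int C * int (length ss + length t1 + length t2 + 6 * gap + 1)"
    using s1 s2 s3 by (intro mult_left_mono) auto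
  finally have "int (gap * length ss) \<le> int (C * (length ss + length t1 + length t2 + 6 * gap + 1) + 6 * gap * gap)"
    using A unfolding K_def of_nat_add of_nat_mult by simp
  then show ?thesis by (simp only: of_nat_le_iff)
qed

text \<open>A common bound for hexagons and bigons. The hexagon alone would give
  \<open>6 * gap\<close>, the length of its connecting arcs; in the bigon another
  \<open>4 * gap\<close> enters through the comparison of the two sides.\<close>

definition "side_bound = 3 * C * (10 * gap + 1) + 18 * gap * gap"

text \<open>Each side is bounded by \<open>C\<close> times the total length plus a constant, which
  says nothing about a side by itself. Only the sum of the three estimates closes up, by the choice
  of \<open>gap\<close>.\<close>

lemma hexagon_bound:
  assumes "seg a1 b1 S1" "seg a2 b2 S2" "seg a3 b3 S3"
    "dist_E b1 a2 \<le> 2 * gap" "dist_E b2 a3 \<le> 2 * gap" "dist_E b3 a1 \<le> 2 * gap"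
    "far S1 S2" "far S2 S3" "far S1 S3"
  shows "dist_E a1 b1 \<le> side_bound"
proof -
  obtain x1 where x1: "walk E a1 x1 b1" "length x1 = dist_E a1 b1" "insert a1 (set x1) = S1" using assms(1) unfolding seg_def by blast
  obtain x2 where x2: "walk E a2 x2 b2" "length x2 = dist_E a2 b2" "insert a2 (set x2) = S2" using assms(2) unfolding seg_def by blast
  obtain x3 where x3: "walk E a3 x3 b3" "length x3 = dist_E a3 b3" "insert a3 (set x3) = S3" using assms(3) unfolding seg_def by blast
  have V: "a1 \<in> V" "a2 \<in> V" "a3 \<in> V" "b1 \<in> V" "b2 \<in> V" "b3 \<in> V" "S1 \<subseteq> V" "S2 \<subseteq> V" "S3 \<subseteq> V"
    using assms(1-3) seg_in_V by blast+
  have fr: "far S2 S1" "far S3 S2" "far S3 S1"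
    using assms(7-9) V dist_sym unfolding far_def by (metis subsetD)+
  obtain s1 where s1: "walk E b1 s1 a2" "length s1 \<le> 2 * gap" using geodesic_walk V assms(4) by metis
  obtain s2 where s2: "walk E b2 s2 a3" "length s2 \<le> 2 * gap" using geodesic_walk V assms(5) by metis
  obtain s3 where s3: "walk E b3 s3 a1" "length s3 \<le> 2 * gap" using geodesic_walk V assms(6) by metis
  define L where "L = length x1 + length x2 + length x3"
  have "gap * length x1 \<le> C * (length x1 + length x2 + length x3 + 6 * gap + 1) + 6 * gap * gap"
    by (rule side_length_bound[OF x1(1,2) V(1) s1 x2(1) s2 x3(1) s3]) (use fr x1 x2 x3 in auto)
  moreover have "gap * length x2 \<le> C * (length x2 + length x3 + length x1 + 6 * gap + 1) + 6 * gap * gap"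
    by (rule side_length_bound[OF x2(1,2) V(2) s2 x3(1) s3 x1(1) s1]) (use fr assms(7-9) x1 x2 x3 in auto)
  moreover have "gap * length x3 \<le> C * (length x3 + length x1 + length x2 + 6 * gap + 1) + 6 * gap * gap"
    by (rule side_length_bound[OF x3(1,2) V(3) s3 x1(1) s1 x2(1) s2]) (use fr assms(7-9) x1 x2 x3 in auto)
  ultimately have "gap * L \<le> 3 * (C * (L + 6 * gap + 1) + 6 * gap * gap)"
    unfolding L_def by (simp add: algebra_simps)
  moreover have "gap * L = 3 * C * L + L" unfolding gap_def by simp
  ultimately have "L \<le> 3 * C * (6 * gap + 1) + 18 * gap * gap" by (simp add: algebra_simps)
  also have "\<dots> \<le> side_bound" unfolding side_bound_def by simp
  finally show ?thesis using x1(2) unfolding L_def by simp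
qed

text \<open>Here one estimate suffices, since the triangle inequality makes the opposite side at
  most \<open>4 * gap\<close> longer than the side considered.\<close>

lemma bigon_bound:
  assumes "seg a b S" "seg c d S'" "dist_E b c \<le> 2 * gap" "dist_E d a \<le> 2 * gap" "far S S'"
  shows "dist_E a b \<le> side_bound"
proof -
  obtain x where x: "walk E a x b" "length x = dist_E a b" "insert a (set x) = S" using assms(1) unfolding seg_def by blast
  obtain y where y: "walk E c y d" "length y = dist_E c d" "insert c (set y) = S'" using assms(2) unfolding seg_def by blast
  have V: "a \<in> V" "b \<in> V" "c \<in> V" "d \<in> V" "S \<subseteq> V" "S' \<subseteq> V" using assms(1,2) seg_in_V by blast+
  have fr: "far S' S" using assms(5) V dist_sym unfolding far_def by (metis subsetD)
  have "last (c # y) = d" using walk_last[OF y(1)] .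
  then have "d \<in> S'" using y(3) by (metis last_in_set list.distinct(1) list.simps(15))
  \<comment> \<open>The bigon is a degenerate hexagon whose third side is the single vertex
    \<open>d\<close>; as \<open>d\<close> lies on \<open>S'\<close>, it is far from \<open>S\<close>
    too.\<close>
  then have fr': "far (insert d (set [])) S" using fr unfolding far_def by simp
  obtain s1 where s1: "walk E b s1 c" "length s1 \<le> 2 * gap" using geodesic_walk V assms(3) by metis
  obtain s3 where s3: "walk E d s3 a" "length s3 \<le> 2 * gap" using geodesic_walk V assms(4) by metis
  have "gap * length x \<le> C * (length x + length y + length ([]::'a list) + 6 * gap + 1) + 6 * gap * gap"
    by (rule side_length_bound[OF x(1,2) V(1) s1 y(1) _ _ _ s3, of "[]" d "[]"]) (use fr fr' x y in auto)
  moreover have "dist_E c d \<le> dist_E c b + dist_E b d" "dist_E b d \<le> dist_E b a + dist_E a d"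
    by (rule gdist_triangle; use V in simp)+
  then have "length y \<le> length x + 4 * gap" using assms(3,4) x(2) y(2) dist_sym[of b c] dist_sym[of b a] dist_sym[of a d] V by simp
  then have "C * (length x + length y + length ([]::'a list) + 6 * gap + 1) \<le> C * (2 * length x + 10 * gap + 1)"
    by (intro mult_left_mono) auto
  ultimately have "gap * length x \<le> C * (2 * length x + 10 * gap + 1) + 6 * gap * gap" by linarith
  moreover have "gap * length x = 3 * C * length x + length x" unfolding gap_def by simp
  ultimately have "length x \<le> C * (10 * gap + 1) + 6 * gap * gap" by (simp add: algebra_simps)
  also have "\<dots> \<le> side_bound" unfolding side_bound_def by simp
  finally show ?thesis using x(2) by simp
qed

lemma bigon_bound_geod:
  assumes p: "geod p n" and q: "geod q n2" and s: "s0 \<le> s1" "s1 \<le> n" and ij: "i \<le> n2" "j \<le> n2"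
    and d: "dist_E (p s1) (q i) \<le> 2 * gap" "dist_E (q j) (p s0) \<le> 2 * gap"
    and fr: "far (p ` {s0..s1}) (q ` {..n2})"
  shows "s1 - s0 \<le> side_bound"
proof -
  \<comment> \<open>The order of \<open>i\<close> and \<open>j\<close> along \<open>q\<close> is
    unknown, so the piece between them may have to be run backwards.\<close>
  have "seg (q i) (q j) (q ` {min i j..max i j})"
    using geod_seg[OF q, of i j] seg_rev[OF geod_seg[OF q, of j i]] ij by (cases "i \<le> j") auto
  moreover have "far (p ` {s0..s1}) (q ` {min i j..max i j})" using fr ij unfolding far_def by auto
  ultimately have "dist_E (p s0) (p s1) \<le> side_bound" using bigon_bound[OF geod_seg[OF p s]] d by blast
  then show ?thesis using geod_dist[OF p s] by simp
qed

text \<open>From \<open>q i\<close> one moves towards the common end of \<open>q\<close> and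
  \<open>r\<close> until \<open>q\<close> first comes within \<open>gap\<close> of the part of
  \<open>r\<close> beyond \<open>j\<close>; this happens at the common end at the latest. Cutting
  there leaves a hexagon with sides on \<open>p\<close>, \<open>r\<close> and \<open>q\<close> that
  are mutually far. If it happens at once, the side on \<open>q\<close> degenerates and a bigon
  remains.\<close>

lemma opposite_sides_bound:
  assumes p: "geod p n" and q: "geod q n2" and r: "geod r n3" and z: "q n2 = r n3"
    and s: "s0 \<le> s1" "s1 \<le> n" and ij: "i \<le> n2" "j \<le> n3"
    and d: "dist_E (p s0) (q i) \<le> gap" "dist_E (p s1) (r j) \<le> gap"
    and fr: "far (p ` {s0..s1}) (q ` {..n2})" "far (p ` {s0..s1}) (r ` {..n3})"
  shows "s1 - s0 \<le> side_bound"
proof -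
  define P where "P = (\<lambda>i'. i \<le> i' \<and> i' \<le> n2 \<and> (\<exists>j'\<ge>j. j' \<le> n3 \<and> dist_E (q i') (r j') \<le> gap))"
  have Pn: "P n2" unfolding P_def using ij z by (auto intro!: exI[of _ n3])
  define i' where "i' = (LEAST i'. P i')"
  have Pi: "P i'" unfolding i'_def using Pn by (rule LeastI)
  have least: "\<not> P t" if "t < i'" for t using that unfolding i'_def by (rule not_less_Least)
  obtain j' where j': "j \<le> j'" "j' \<le> n3" "dist_E (q i') (r j') \<le> gap" and i': "i \<le> i'" "i' \<le> n2"
    using Pi unfolding P_def by blast
  have V: "p s0 \<in> V" "p s1 \<in> V" "q i \<in> V" "q i' \<in> V" "r j \<in> V" "r j' \<in> V"
    using geod_in_V p q r s ij i' j' by (meson order_trans)+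
  show ?thesis
  proof (cases "i' = i")
    case True
    have "dist_E (r j') (p s0) \<le> dist_E (r j') (q i) + dist_E (q i) (p s0)"
      by (rule gdist_triangle) (use V in auto)
    then have "dist_E (r j') (p s0) \<le> 2 * gap" using d(1) j'(3) True dist_sym[of "r j'" "q i"] dist_sym[of "q i" "p s0"] V by simp
    then show ?thesis using bigon_bound_geod[OF p r s ij(2) j'(2) _ _ fr(2)] d(2) by simp
  next
    case False
    have f23: "far (r ` {j..j'}) (q ` {i..i'})"
      unfolding far_def
    proof (intro ballI)
      fix u v assume "u \<in> r ` {j..j'}" "v \<in> q ` {i..i'}"
      then obtain b a where b: "j \<le> b" "b \<le> j'" "u = r b" and a: "i \<le> a" "a \<le> i'" "v = q a" by auto
      have low: "dist_E (q t) (r b) > gap" if "i \<le> t" "t < i'" for t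
        using least[OF that(2)] that i' b j' unfolding P_def by (meson not_le order_trans le_less)
      have uv: "u \<in> V" "v \<in> V" using a b i' j' geod_in_V q r by (meson order_trans)+
      show "gap \<le> dist_E u v"
      proof (cases "a < i'")
        case True
        then show ?thesis using low[of a] a b uv dist_sym by (metis less_imp_le)
      next
        case F: False
        \<comment> \<open>The cut vertex itself is close to \<open>r\<close> by construction, but
          its predecessor is strictly farther than \<open>gap\<close> from \<open>r b\<close>, and
          one step loses only 1.\<close>
        define t where "t = i' - 1"
        have t: "i \<le> t" "t < i'" "a = Suc t" using F a False i' unfolding t_def by auto
        have "dist_E (q t) (r b) \<le> dist_E (q t) (q a) + dist_E (q a) (r b)"
          by (rule gdist_triangle) (use t i' geod_in_V[OF q] uv a b in auto)
        moreover have "dist_E (q t) (q a) = 1" using geod_dist[OF q, of t a] t a i' by simp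
        ultimately have "gap \<le> dist_E (q a) (r b)" using low[OF t(1,2)] by linarith
        then show ?thesis using a b uv dist_sym by metis
      qed
    qed
    have "seg (p s0) (p s1) (p ` {s0..s1})" "seg (r j) (r j') (r ` {j..j'})" "seg (q i') (q i) (q ` {i..i'})"
      using geod_seg p q r s i' j' seg_rev by blast+
    moreover have "dist_E (r j') (q i') \<le> 2 * gap" "dist_E (q i) (p s0) \<le> 2 * gap"
      using j'(3) d(1) dist_sym V by (metis mult_2 trans_le_add1)+
    moreover have "far (p ` {s0..s1}) (r ` {j..j'})" "far (p ` {s0..s1}) (q ` {i..i'})"
      using fr i' j' unfolding far_def by auto
    ultimately have "dist_E (p s0) (p s1) \<le> side_bound"
      using hexagon_bound[of "p s0" "p s1" _ "r j" "r j'" _ "q i'" "q i"] f23 d(2) by simp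
    then show ?thesis using geod_dist[OF p s] by simp
  qed
qed

text \<open>If \<open>p t\<close> is far from both other sides, the maximal stretch of
  \<open>p\<close> around it that stays far is one side of a bigon or a hexagon. Its length is then
  at most \<open>side_bound\<close>, and its ends are within \<open>gap\<close> of the other
  sides.\<close>

lemma triangles_slim: "slim (side_bound + gap)"
  unfolding slim_def
proof (intro allI impI)
  fix p n q n2 r n3 t
  assume p: "geod p n" and q: "geod q n2" and r: "geod r n3"
    and x: "p 0 = q 0" and y: "p n = r 0" and z: "q n2 = r n3" and t: "t \<le> n"
  define nq where "nq = (\<lambda>s. \<exists>i\<le>n2. dist_E (p s) (q i) \<le> gap)"
  define nr where "nr = (\<lambda>s. \<exists>i\<le>n3. dist_E (p s) (r i) \<le> gap)"
  define near where "near = (\<lambda>s. nq s \<or> nr s)"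
  show "(\<exists>i\<le>n2. dist_E (p t) (q i) \<le> side_bound + gap) \<or> (\<exists>i\<le>n3. dist_E (p t) (r i) \<le> side_bound + gap)"
  proof (cases "near t")
    case True
    then show ?thesis unfolding near_def nq_def nr_def by (meson le_add2 order_trans)
  next
    case False
    have n0: "near 0" "near n" unfolding near_def nq_def nr_def using x y by (auto intro!: exI[of _ 0])
    have tn: "0 < t" "t < n" using False n0 t by (metis gr0I, metis le_neq_implies_less)
    define A where "A = {s. s < t \<and> near s}"
    have A: "finite A" "0 \<in> A" unfolding A_def using n0 tn by auto
    define s0 where "s0 = Max A"
    have s0: "s0 < t" "near s0" using Max_in[of A] A unfolding s0_def A_def by blast+
    have s0': "\<not> near s" if "s0 < s" "s \<le> t" for s
    proof (cases "s = t")
      case neq: False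
      have "s \<in> A \<Longrightarrow> s \<le> s0" unfolding s0_def using A(1) by simp
      then show ?thesis using that neq unfolding A_def by auto
    qed (use False in simp)
    define s1 where "s1 = (LEAST s. t < s \<and> near s)"
    have s1: "t < s1" "near s1" using LeastI[of "\<lambda>s. t < s \<and> near s" n] tn n0 unfolding s1_def by auto
    have s1n: "s1 \<le> n" unfolding s1_def using tn n0 by (intro Least_le) auto
    have s1': "\<not> near s" if "t \<le> s" "s < s1" for s
      using not_less_Least[of s "\<lambda>s. t < s \<and> near s"] that False unfolding s1_def[symmetric] by (cases "s = t") auto
    have bad: "\<not> near s" if "s0 < s" "s < s1" for s
      using s0' s1' that by (cases "s \<le> t") auto
    \<comment> \<open>The ends of the stretch are near vertices, yet the weak inequality of
      \<open>far\<close> survives there: every interior neighbour is at distance greater than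
      \<open>gap\<close>.\<close>
    have far1: "far (p ` {s0..s1}) W" if W: "W \<subseteq> V" "\<And>s w. s0 < s \<Longrightarrow> s < s1 \<Longrightarrow> w \<in> W \<Longrightarrow> dist_E (p s) w > gap" for W
      unfolding far_def
    proof (intro ballI)
      fix u w assume u: "u \<in> p ` {s0..s1}" and w: "w \<in> W"
      then obtain s where s: "s0 \<le> s" "s \<le> s1" "u = p s" by auto
      obtain s' where s': "s0 < s'" "s' < s1" "s' = s \<or> s' = Suc s \<or> s = Suc s'"
      proof -
        consider "s = s0" | "s = s1" | "s0 < s \<and> s < s1" using s by linarith
        then show ?thesis
          by cases (use that[of "Suc s"] that[of "s - 1"] that[of s] s0(1) s1(1) in auto)
      qed
      have "dist_E (p s') w \<le> dist_E (p s') (p s) + dist_E (p s) w"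
        by (rule gdist_triangle) (use geod_in_V[OF p] s s' s1n w W(1) in auto)
      moreover have "dist_E (p s') (p s) \<le> 1"
        using s'(3) geod_dist[OF p, of s' s] geod_dist_rev[OF p, of s s'] s s' s1n by auto
      ultimately show "gap \<le> dist_E u w" using W(2)[OF s'(1,2) w] unfolding s(3) by linarith
    qed
    have bq: "gap < dist_E (p s) (q i)" if "s0 < s" "s < s1" "i \<le> n2" for s i
      using bad[OF that(1,2)] that(3) unfolding near_def nq_def by (meson not_le)
    have br: "gap < dist_E (p s) (r i)" if "s0 < s" "s < s1" "i \<le> n3" for s i
      using bad[OF that(1,2)] that(3) unfolding near_def nr_def by (meson not_le)
    have fq: "far (p ` {s0..s1}) (q ` {..n2})"
      by (rule far1) (use geod_in_V[OF q] bq in auto)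
    have fr: "far (p ` {s0..s1}) (r ` {..n3})"
      by (rule far1) (use geod_in_V[OF r] br in auto)
    have pV: "p s0 \<in> V" "p s1 \<in> V" "p t \<in> V" using geod_in_V[OF p] s0 s1 s1n t by auto
    have s01: "s0 \<le> s1" using s0 s1 by simp
    \<comment> \<open>If both ends are near the same side, that side and \<open>p\<close> bound a
      bigon; otherwise the two sides meet at the third vertex and
      \<open>opposite_sides_bound\<close> applies, in either order.\<close>
    have "s1 - s0 \<le> side_bound"
    proof -
      consider "nq s0" "nq s1" | "nq s0" "nr s1" | "nr s0" "nq s1" | "nr s0" "nr s1"
        using s0(2) s1(2) unfolding near_def by blast
      then show ?thesis
      proof cases
        case 1
        then obtain i j where ij: "i \<le> n2" "j \<le> n2" "dist_E (p s0) (q i) \<le> gap" "dist_E (p s1) (q j) \<le> gap"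
          unfolding nq_def by blast
        have "dist_E (q i) (p s0) \<le> gap" using ij dist_sym pV geod_in_V[OF q] by metis
        then show ?thesis using bigon_bound_geod[OF p q s01 s1n ij(2,1) _ _ fq] ij by simp
      next
        case 2
        then show ?thesis unfolding nq_def nr_def
          using opposite_sides_bound[OF p q r z s01 s1n _ _ _ _ fq fr] by blast
      next
        case 3
        then show ?thesis unfolding nq_def nr_def
          using opposite_sides_bound[OF p r q z[symmetric] s01 s1n _ _ _ _ fr fq] by blast
      next
        case 4
        then obtain i j where ij: "i \<le> n3" "j \<le> n3" "dist_E (p s0) (r i) \<le> gap" "dist_E (p s1) (r j) \<le> gap"
          unfolding nr_def by blast
        have "dist_E (r i) (p s0) \<le> gap" using ij dist_sym pV geod_in_V[OF r] by metis
        then show ?thesis using bigon_bound_geod[OF p r s01 s1n ij(2,1) _ _ fr] ij by simp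
      qed
    qed
    then have st: "dist_E (p t) (p s0) \<le> side_bound" using geod_dist_rev[OF p, of s0 t] s0 s1 t by simp
    have cl: "dist_E (p t) w \<le> side_bound + gap" if "w \<in> V" "dist_E (p s0) w \<le> gap" for w
      using gdist_triangle[OF pV(3,1) that(1)] st that(2) by linarith
    from s0(2) show ?thesis unfolding near_def nq_def nr_def using cl geod_in_V[OF q] geod_in_V[OF r] by blast
  qed
qed

lemma hyperbolic: "gromov_hyperbolic_graph V E"
  by (rule slim_hyperbolic[OF triangles_slim])

end

section \<open>Rational chains and fillings in hyperbolic graphs\<close>


definition basis :: "'a \<Rightarrow> 'a \<Rightarrow> rat" where
  "basis a = (\<lambda>b. if b = a then 1 else 0)"

lemma permmodD: "x \<in> permmod \<Omega> \<Longrightarrow> finite (supp x)" "x \<in> permmod \<Omega> \<Longrightarrow> supp x \<subseteq> \<Omega>"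
  unfolding permmod_def by auto

lemma permmodI: "finite A \<Longrightarrow> supp x \<subseteq> A \<Longrightarrow> supp x \<subseteq> \<Omega> \<Longrightarrow> x \<in> permmod \<Omega>"
  unfolding permmod_def using finite_subset by auto

lemma not_in_supp: "a \<notin> supp x \<Longrightarrow> x a = 0"
  unfolding supp_def by simp

lemma permmod_outside: "x \<in> permmod \<Omega> \<Longrightarrow> a \<notin> \<Omega> \<Longrightarrow> x a = 0"
  unfolding permmod_def supp_def by auto

lemma supp_basis: "supp (basis a) = {a}"
  unfolding supp_def basis_def by auto

lemma basis_permmod: "a \<in> \<Omega> \<Longrightarrow> basis a \<in> permmod \<Omega>"
  by (simp add: permmod_def supp_basis)

lemma zero_permmod: "(\<lambda>_. 0) \<in> permmod \<Omega>"
  unfolding permmod_def supp_def by simp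

lemma add_permmod:
  assumes "x \<in> permmod \<Omega>" "y \<in> permmod \<Omega>" shows "(\<lambda>a. x a + y a) \<in> permmod \<Omega>"
proof -
  have s: "supp (\<lambda>a. x a + y a) \<subseteq> supp x \<union> supp y" unfolding supp_def by auto
  show ?thesis by (rule permmodI[OF _ s]) (use s assms permmodD in blast)+
qed

lemma smult_permmod:
  assumes "x \<in> permmod \<Omega>" shows "(\<lambda>a. c * x a) \<in> permmod \<Omega>"
proof -
  have s: "supp (\<lambda>a. c * x a) \<subseteq> supp x" unfolding supp_def by auto
  show ?thesis by (rule permmodI[OF _ s]) (use s assms permmodD in blast)+
qed

lemma diff_permmod:
  assumes "x \<in> permmod \<Omega>" "y \<in> permmod \<Omega>" shows "(\<lambda>a. x a - y a) \<in> permmod \<Omega>"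
  using add_permmod[OF assms(1) smult_permmod[OF assms(2), of "-1"]] by simp

lemma aug_eq_sum: "finite A \<Longrightarrow> supp x \<subseteq> A \<Longrightarrow> aug F x = (\<Sum>a\<in>A. x a * F a)"
  unfolding aug_def by (rule sum.mono_neutral_left) (auto simp: supp_def)

lemma norm1_eq_sum: "finite A \<Longrightarrow> supp x \<subseteq> A \<Longrightarrow> norm1 x = (\<Sum>a\<in>A. \<bar>x a\<bar>)"
  unfolding norm1_def by (rule sum.mono_neutral_left) (auto simp: supp_def)

text \<open>\<open>aug F x\<close> pairs the chain \<open>x\<close> with an arbitrary function
  \<open>F\<close>. Each coordinate of \<open>lin f x\<close> is such a pairing, so linearity has to
  be proved for \<open>aug\<close> only.\<close>

lemma lin_eq_aug: "lin f x b = aug (\<lambda>a. f a b) x"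
  unfolding lin_def aug_def ..

lemma aug_add:
  assumes "x \<in> permmod \<Omega>" "y \<in> permmod \<Omega>" shows "aug F (\<lambda>a. x a + y a) = aug F x + aug F y"
proof -
  have A: "finite (supp x \<union> supp y)" using assms permmodD(1) by blast
  have "supp (\<lambda>a. x a + y a) \<subseteq> supp x \<union> supp y" unfolding supp_def by auto
  then show ?thesis by (simp add: aug_eq_sum[OF A] distrib_right sum.distrib)
qed

lemma aug_smult:
  assumes "x \<in> permmod \<Omega>" shows "aug F (\<lambda>a. c * x a) = c * aug F x"
proof -
  have A: "finite (supp x)" using assms permmodD(1) by blast
  have "supp (\<lambda>a. c * x a) \<subseteq> supp x" unfolding supp_def by auto
  then show ?thesis by (simp add: aug_eq_sum[OF A] sum_distrib_left mult.assoc)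
qed

lemma aug_diff:
  assumes "x \<in> permmod \<Omega>" "y \<in> permmod \<Omega>" shows "aug F (\<lambda>a. x a - y a) = aug F x - aug F y"
  using aug_add[OF assms(1) smult_permmod[OF assms(2), of "-1"], of F] aug_smult[OF assms(2), of F "-1"] by simp

lemma aug_basis [simp]: "aug F (basis a) = F a"
  unfolding aug_def supp_basis by (simp add: basis_def)

lemma aug_zero [simp]: "aug F (\<lambda>_. 0) = 0"
  unfolding aug_def by simp

lemma lin_add:
  assumes "x \<in> permmod \<Omega>" "y \<in> permmod \<Omega>"
  shows "lin f (\<lambda>a. x a + y a) = (\<lambda>b. lin f x b + lin f y b)"
  unfolding lin_eq_aug using aug_add[OF assms] by blast

lemma lin_smult:
  assumes "x \<in> permmod \<Omega>" shows "lin f (\<lambda>a. c * x a) = (\<lambda>b. c * lin f x b)"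
  unfolding lin_eq_aug using aug_smult[OF assms] by blast

lemma lin_diff:
  assumes "x \<in> permmod \<Omega>" "y \<in> permmod \<Omega>"
  shows "lin f (\<lambda>a. x a - y a) = (\<lambda>b. lin f x b - lin f y b)"
  unfolding lin_eq_aug using aug_diff[OF assms] by blast

lemma lin_basis [simp]: "lin f (basis a) = f a"
  unfolding lin_eq_aug by simp

lemma lin_zero [simp]: "lin f (\<lambda>_. 0) = (\<lambda>_. 0)"
  unfolding lin_eq_aug by simp

lemma norm1_nonneg: "0 \<le> norm1 x"
  unfolding norm1_def by (intro sum_nonneg) auto

lemma norm1_add:
  assumes "x \<in> permmod \<Omega>" "y \<in> permmod \<Omega>" shows "norm1 (\<lambda>a. x a + y a) \<le> norm1 x + norm1 y"
proof -
  have A: "finite (supp x \<union> supp y)" using assms permmodD(1) by blast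
  have "supp (\<lambda>a. x a + y a) \<subseteq> supp x \<union> supp y" unfolding supp_def by auto
  then show ?thesis
    by (simp add: norm1_eq_sum[OF A] sum.distrib[symmetric] sum_mono abs_triangle_ineq)
qed

lemma norm1_smult:
  assumes "x \<in> permmod \<Omega>" shows "norm1 (\<lambda>a. c * x a) = \<bar>c\<bar> * norm1 x"
proof -
  have A: "finite (supp x)" using assms permmodD(1) by blast
  have "supp (\<lambda>a. c * x a) \<subseteq> supp x" unfolding supp_def by auto
  then show ?thesis by (simp add: norm1_eq_sum[OF A] sum_distrib_left abs_mult)
qed

lemma norm1_basis [simp]: "norm1 (basis a) = 1"
  unfolding norm1_def supp_basis by (simp add: basis_def)

lemma norm1_zero [simp]: "norm1 (\<lambda>_. 0) = 0"
  unfolding norm1_def by simp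

text \<open>The duality between the l1-norm and the supremum norm; through it a bound on the norm of
  a filling becomes a bound on the value of a cochain.\<close>

lemma abs_aug_le:
  assumes "\<And>a. a \<in> supp x \<Longrightarrow> \<bar>F a\<bar> \<le> B" shows "\<bar>aug F x\<bar> \<le> B * norm1 x"
proof -
  have "\<bar>aug F x\<bar> \<le> (\<Sum>a\<in>supp x. \<bar>x a * F a\<bar>)" unfolding aug_def by (rule sum_abs)
  also have "\<dots> \<le> (\<Sum>a\<in>supp x. \<bar>x a\<bar> * B)"
    unfolding abs_mult using assms by (intro sum_mono mult_left_mono) auto
  finally show ?thesis unfolding norm1_def by (simp add: sum_distrib_left mult.commute)
qed

lemma lin_permmod:
  assumes "x \<in> permmod \<Omega>" "\<And>a. a \<in> \<Omega> \<Longrightarrow> f a \<in> permmod \<Omega>'"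
  shows "lin f x \<in> permmod \<Omega>'"
proof -
  have s: "supp (lin f x) \<subseteq> (\<Union>a\<in>supp x. supp (f a))"
  proof
    fix b assume "b \<in> supp (lin f x)"
    then have "(\<Sum>a\<in>supp x. x a * f a b) \<noteq> 0" unfolding supp_def lin_def by simp
    then obtain a where "a \<in> supp x" "x a * f a b \<noteq> 0" by (metis (no_types, lifting) sum.neutral)
    then show "b \<in> (\<Union>a\<in>supp x. supp (f a))" unfolding supp_def by auto
  qed
  have "finite (\<Union>a\<in>supp x. supp (f a))" "(\<Union>a\<in>supp x. supp (f a)) \<subseteq> \<Omega>'"
    using permmodD[OF assms(1)] permmodD[OF assms(2)] by auto
  then show ?thesis using s by (intro permmodI[OF _ s]) auto
qed

text \<open>Transposition: pairing \<open>F\<close> with the image of \<open>x\<close> amounts to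
  pairing the pulled back function with \<open>x\<close>. It serves as Stokes' formula
  below.\<close>

lemma aug_lin:
  assumes "x \<in> permmod \<Omega>" "\<And>a. a \<in> \<Omega> \<Longrightarrow> f a \<in> permmod \<Omega>'"
  shows "aug F (lin f x) = aug (\<lambda>a. aug F (f a)) x"
proof -
  define B where "B = (\<Union>a\<in>supp x. supp (f a)) \<union> supp (lin f x)"
  have B: "finite B" unfolding B_def using permmodD[OF assms(1)] permmodD(1)[OF assms(2)] permmodD(1)[OF lin_permmod[OF assms]] by auto
  have "aug F (lin f x) = (\<Sum>b\<in>B. lin f x b * F b)" by (rule aug_eq_sum[OF B]) (auto simp: B_def)
  also have "\<dots> = (\<Sum>b\<in>B. \<Sum>a\<in>supp x. x a * f a b * F b)" unfolding lin_def sum_distrib_right ..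
  also have "\<dots> = (\<Sum>a\<in>supp x. \<Sum>b\<in>B. x a * f a b * F b)" by (rule sum.swap)
  also have "\<dots> = (\<Sum>a\<in>supp x. x a * aug F (f a))"
  proof (rule sum.cong[OF refl])
    fix a assume "a \<in> supp x"
    then have "aug F (f a) = (\<Sum>b\<in>B. f a b * F b)" by (intro aug_eq_sum[OF B]) (auto simp: B_def)
    then show "(\<Sum>b\<in>B. x a * f a b * F b) = x a * aug F (f a)" by (simp add: sum_distrib_left mult.assoc)
  qed
  finally show ?thesis unfolding aug_def[of _ x] .
qed

lemma permmod_eq_0_or_supp: "x = (\<lambda>_. 0) \<or> supp x \<noteq> {}"
  unfolding supp_def by auto

text \<open>An oriented edge is the two-element list of its ends. Vertices, edges and closed walks
  are thus all lists of vertices, on which the group acts in one uniform way.\<close>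

fun edge_chain :: "'v list \<Rightarrow> 'v list \<Rightarrow> rat" where
  "edge_chain (x # y # r) = (\<lambda>e. basis [x, y] e + edge_chain (y # r) e)"
| "edge_chain _ = (\<lambda>_. 0)"

definition edge_bd :: "'v list \<Rightarrow> 'v list \<Rightarrow> rat" where
  "edge_bd e = (\<lambda>v. basis [last e] v - basis [hd e] v)"

lemma edge_chain_append:
  "walk E x xs y \<Longrightarrow> edge_chain (x # xs @ ys) = (\<lambda>e. edge_chain (x # xs) e + edge_chain (y # ys) e)"
  by (induction xs arbitrary: x) auto

lemma walk_split:
  assumes "walk E x xs y" "i \<le> length xs"
  shows "walk E x (take i xs) ((x # xs) ! i)" "walk E ((x # xs) ! i) (drop i xs) y"
proof -
  have l: "last (x # take i xs) = (x # xs) ! i"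
    using assms(2) by (cases i) (auto simp: take_Suc_conv_app_nth)
  have "walk E x (take i xs @ drop i xs) y" using assms(1) by simp
  then show "walk E x (take i xs) ((x # xs) ! i)" "walk E ((x # xs) ! i) (drop i xs) y"
    unfolding walk_append_iff l by auto
qed

section \<open>Chains of walks and their fillings by short loops\<close>

context conn_graph
begin

definition edges :: "'v list set" where
  "edges = {[a, b] | a b. E a b}"

definition loops :: "nat \<Rightarrow> 'v list set" where
  "loops N = {x # xs | x xs. x \<in> V \<and> walk E x xs x \<and> length xs \<le> N}"

definition verts :: "'v list set" where
  "verts = {[v] | v. v \<in> V}"

lemma edge_chain_permmod: "walk E x xs y \<Longrightarrow> edge_chain (x # xs) \<in> permmod edges"
  by (induction xs arbitrary: x) (auto intro!: zero_permmod add_permmod basis_permmod simp: edges_def)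

lemma edge_bd_permmod: "e \<in> edges \<Longrightarrow> edge_bd e \<in> permmod verts"
  unfolding edges_def edge_bd_def verts_def using E_in_V by (auto intro!: diff_permmod basis_permmod)

lemma loops_edge_chain: "w \<in> loops N \<Longrightarrow> edge_chain w \<in> permmod edges"
  unfolding loops_def using edge_chain_permmod by auto

lemma lin_edge_bd_walk:
  "walk E x xs y \<Longrightarrow> lin edge_bd (edge_chain (x # xs)) = (\<lambda>v. basis [y] v - basis [x] v)"
proof (induction xs arbitrary: x)
  case Nil
  then show ?case by simp
next
  case (Cons z xs)
  have w: "walk E z xs y" "E x z" using Cons.prems by auto
  have "basis [x, z] \<in> permmod edges" using w unfolding edges_def by (auto intro!: basis_permmod)
  then show ?case using lin_add[OF _ edge_chain_permmod[OF w(1)], of "basis [x, z]" edge_bd] Cons.IH[OF w(1)]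
    by (simp add: edge_bd_def[of "[x, z]"])
qed

definition fillable :: "nat \<Rightarrow> ('v list \<Rightarrow> rat) \<Rightarrow> rat \<Rightarrow> bool" where
  "fillable N z A \<longleftrightarrow> (\<exists>Y\<in>permmod (loops N). lin edge_chain Y = z \<and> norm1 Y \<le> A)"

lemma fillable_zero: "fillable N (\<lambda>_. 0) 0"
  unfolding fillable_def by (intro bexI[OF _ zero_permmod]) auto

lemma fillable_mono: "fillable N z A \<Longrightarrow> A \<le> B \<Longrightarrow> fillable N z B"
  unfolding fillable_def by force

lemma fillable_add:
  assumes "fillable N z A" "fillable N z' A'" shows "fillable N (\<lambda>e. z e + z' e) (A + A')"
proof -
  obtain Y Y' where Y: "Y \<in> permmod (loops N)" "lin edge_chain Y = z" "norm1 Y \<le> A"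
    and Y': "Y' \<in> permmod (loops N)" "lin edge_chain Y' = z'" "norm1 Y' \<le> A'"
    using assms unfolding fillable_def by blast
  show ?thesis
    unfolding fillable_def
    by (intro bexI[OF _ add_permmod[OF Y(1) Y'(1)]]) (use Y Y' lin_add[OF Y(1) Y'(1)] norm1_add[OF Y(1) Y'(1)] in force)
qed

lemma fillable_smult:
  assumes "fillable N z A" shows "fillable N (\<lambda>e. c * z e) (\<bar>c\<bar> * A)"
proof -
  obtain Y where Y: "Y \<in> permmod (loops N)" "lin edge_chain Y = z" "norm1 Y \<le> A"
    using assms unfolding fillable_def by blast
  show ?thesis
    unfolding fillable_def
    by (intro bexI[OF _ smult_permmod[OF Y(1), of c]])
      (use Y lin_smult[OF Y(1)] norm1_smult[OF Y(1)] in \<open>auto intro: mult_left_mono\<close>)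
qed

lemma fillable_loop: "w \<in> loops N \<Longrightarrow> fillable N (edge_chain w) 1"
  unfolding fillable_def by (intro bexI[OF _ basis_permmod]) auto

definition shortcuts :: "nat \<Rightarrow> bool" where
  "shortcuts m \<longleftrightarrow> 1 \<le> m \<and> (\<forall>p n. 2 * m \<le> n \<longrightarrow> (\<forall>i\<le>n. p i \<in> V) \<longrightarrow>
     (\<forall>i<n. dist_E (p i) (p (Suc i)) \<le> 1) \<longrightarrow> p 0 = p n \<longrightarrow>
     (\<exists>i. i + 2 * m \<le> n \<and> dist_E (p i) (p (i + 2 * m)) < 2 * m))"

lemma hyperbolic_shortcuts:
  assumes "gromov_hyperbolic_graph V E" shows "\<exists>m. shortcuts m"
proof -
  obtain \<delta> :: real where hyp: "\<And>w x y z. w \<in> V \<Longrightarrow> x \<in> V \<Longrightarrow> y \<in> V \<Longrightarrow> z \<in> V \<Longrightarrow>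
      gromov_product E w x z \<ge> min (gromov_product E w x y) (gromov_product E w y z) - \<delta>"
    using assms unfolding gromov_hyperbolic_graph_def by blast
  obtain m0 :: nat where "2 * \<delta> < real m0" using reals_Archimedean2 by blast
  then have m: "2 * \<delta> < real (Suc m0)" by simp
  show ?thesis
    unfolding shortcuts_def using closed_walk_shortcut[OF hyp m] by (intro exI[of _ "Suc m0"]) auto
qed

text \<open>A non-geodesic stretch \<open>s\<close> of length \<open>2 * m\<close> is replaced by a
  geodesic \<open>t\<close>, which removes at least one edge at the price of two loops of norm 1.
  This gives the slope 2; the 1 accounts for the final walk of length at most \<open>4 * m\<close>,
  which is a loop itself.\<close>

lemma closed_walk_fillable:
  assumes m: "shortcuts m"
  shows "x \<in> V \<Longrightarrow> walk E x xs x \<Longrightarrow> fillable (4 * m) (edge_chain (x # xs)) (2 * of_nat (length xs) + 1)"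
proof (induction "length xs" arbitrary: xs rule: less_induct)
  case less
  show ?case
  proof (cases "length xs \<le> 4 * m")
    case True
    then have "x # xs \<in> loops (4 * m)" using less.prems unfolding loops_def by auto
    then show ?thesis by (rule fillable_mono[OF fillable_loop]) simp
  next
    case False
    define p where "p = (\<lambda>i. (x # xs) ! i)"
    define n where "n = length xs"
    have gw: "gwalk E (x # xs)" "last (x # xs) = x" using less.prems unfolding walk_iff_gwalk by auto
    have pV: "\<forall>i\<le>n. p i \<in> V"
    proof (intro allI impI)
      fix i assume "i \<le> n"
      then have "p i \<in> set (x # xs)" unfolding p_def n_def by (intro nth_mem) simp
      then show "p i \<in> V" using walk_in_V[OF less.prems(2,1)] less.prems(1) by auto
    qed
    have st: "\<forall>i<n. dist_E (p i) (p (Suc i)) \<le> 1"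
      using gw(1) dist_edge unfolding gwalk_def p_def n_def by (metis Suc_less_eq length_Cons)
    have cl: "p 0 = p n" unfolding p_def n_def using gw(2) by (simp add: last_conv_nth split: if_splits)
    obtain i where i: "i + 2 * m \<le> n" "dist_E (p i) (p (i + 2 * m)) < 2 * m"
    proof -
      have "2 * m \<le> n" using False unfolding n_def by simp
      then have "\<exists>i. i + 2 * m \<le> n \<and> dist_E (p i) (p (i + 2 * m)) < 2 * m"
        using m pV st cl unfolding shortcuts_def by blast
      then show ?thesis using that by blast
    qed
    define q r where "q = p i" and "r = p (i + 2 * m)"
    define a s b where "a = take i xs" and "s = take (2 * m) (drop i xs)" and "b = drop (i + 2 * m) xs"
    have a: "walk E x a q" "walk E q (drop i xs) x"
      using walk_split[OF less.prems(2), of i] i unfolding a_def q_def p_def n_def by auto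
    have nth: "(q # drop i xs) ! (2 * m) = r"
      unfolding q_def r_def p_def using i m unfolding n_def shortcuts_def by (cases m) (auto simp: nth_Cons')
    have s: "walk E q s r" "walk E r b x"
      using walk_split[OF a(2), of "2 * m"] nth i unfolding s_def b_def n_def by (auto simp: add.commute)
    have xs: "xs = a @ s @ b" unfolding a_def s_def b_def by (metis append_take_drop_id drop_drop add.commute)
    have ls: "length s = 2 * m" unfolding s_def using i n_def by simp
    have V: "q \<in> V" "r \<in> V" using pV i unfolding q_def r_def by auto
    obtain t where t: "walk E q t r" "length t < 2 * m" using geodesic_walk[OF V] i(2) q_def r_def by metis
    obtain t' where t': "walk E r t' q" "length t' = length t" using walk_rev[OF E_sym t(1)] by blast
    have w': "walk E x (a @ t @ b) x" using a t s by (auto intro!: walk_append)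
    have le: "length (a @ t @ b) < length xs" unfolding xs using ls t(2) by simp
    have f1: "fillable (4 * m) (edge_chain (x # a @ t @ b)) (2 * of_nat (length (a @ t @ b)) + 1)"
      using less.hyps[OF le less.prems(1) w'] .
    have f2: "fillable (4 * m) (edge_chain (q # s @ t')) 1"
      by (rule fillable_loop) (use V s t' t ls in \<open>auto simp: loops_def intro!: walk_append\<close>)
    have f3: "fillable (4 * m) (\<lambda>e. (-1) * edge_chain (q # t @ t') e) (\<bar>-1\<bar> * 1)"
      by (rule fillable_smult[OF fillable_loop]) (use V s t' t ls in \<open>auto simp: loops_def intro!: walk_append\<close>)
    \<comment> \<open>Opposite edges are independent, so the difference of the chains of
      \<open>s\<close> and \<open>t\<close> need not be the chain of a closed walk. Appending the
      same return path \<open>t'\<close> to both turns it into a difference of two loops, each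
      shorter than \<open>4 * m\<close>.\<close>
    have "edge_chain (x # xs) = (\<lambda>e. edge_chain (x # a @ t @ b) e + edge_chain (q # s @ t') e + (-1) * edge_chain (q # t @ t') e)"
      unfolding xs edge_chain_append[OF a(1)] edge_chain_append[OF s(1)] edge_chain_append[OF t(1)] by (simp add: fun_eq_iff)
    moreover have "fillable (4 * m) (\<lambda>e. edge_chain (x # a @ t @ b) e + edge_chain (q # s @ t') e + (-1) * edge_chain (q # t @ t') e)
        (2 * of_nat (length (a @ t @ b)) + 1 + 1 + \<bar>-1\<bar> * 1)"
      using fillable_add[OF fillable_add[OF f1 f2] f3] .
    moreover have "(2 * of_nat (length (a @ t @ b)) + 1 + 1 + \<bar>-1\<bar> * 1 :: rat) \<le> 2 * of_nat (length xs) + 1"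
    proof -
      have "rat_of_nat (length (a @ t @ b) + 1) \<le> rat_of_nat (length xs)" using le by (simp only: of_nat_le_iff)
      then show ?thesis by simp
    qed
    ultimately show ?thesis using fillable_mono by metis
  qed
qed

lemma edge_chain_map_upt:
  assumes "i \<le> j" "\<And>t. i \<le> t \<Longrightarrow> t < j \<Longrightarrow> E (p t) (p (Suc t))"
  shows "edge_chain (p i # map p [Suc i..<Suc j]) = (\<lambda>e. \<Sum>t\<in>{i..<j}. basis [p t, p (Suc t)] e)"
  using assms
proof (induction rule: dec_induct)
  case base
  then show ?case by simp
next
  case (step n)
  have w: "walk E (p i) (map p [Suc i..<Suc n]) (p n)" by (rule walk_map_upt) (use step in auto)
  have "map p [Suc i..<Suc (Suc n)] = map p [Suc i..<Suc n] @ [p (Suc n)]" using step(1) by simp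
  then show ?case
    using edge_chain_append[OF w, of "[p (Suc n)]"] step by (simp del: upt_Suc)
qed

text \<open>Conservation of flow: a vertex entered with positive weight is also left with positive
  weight. Following such edges, the finite support forces a repeated vertex, and the first
  repetition closes a circuit without repeated edges.\<close>

lemma nonneg_cycle_contains_circuit:
  assumes z: "z \<in> permmod edges" "lin edge_bd z = (\<lambda>_. 0)" "\<And>e. 0 \<le> z e" "z \<noteq> (\<lambda>_. 0)"
  shows "\<exists>x xs F. x \<in> V \<and> walk E x xs x \<and> F \<subseteq> supp z \<and> F \<noteq> {} \<and> card F = length xs \<and>
    edge_chain (x # xs) = (\<lambda>e. if e \<in> F then 1 else 0)"
proof -
  have fin: "finite (supp z)" using z(1) permmodD by blast
  have pos: "z e > 0 \<longleftrightarrow> e \<in> supp z" for e unfolding supp_def using z(3)[of e] by auto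
  have sE: "E a b" if "z [a, b] > 0" for a b
    using that z(1) permmodD(2) unfolding pos edges_def by blast
  have out: "\<exists>c. z [a, c] > 0" if "z [b, a] > 0" for a b
  proof (rule ccontr)
    assume no: "\<nexists>c. z [a, c] > 0"
    \<comment> \<open>Without an outgoing edge every term of the boundary at \<open>a\<close> is
      nonnegative, and the entering edge \<open>[b, a]\<close> contributes a positive one.\<close>
    have "0 < (\<Sum>e\<in>supp z. z e * edge_bd e [a])"
    proof (rule sum_pos2[OF fin])
      show "[b, a] \<in> supp z" using that pos by simp
      have "b \<noteq> a" using no that by auto
      then show "0 < z [b, a] * edge_bd [b, a] [a]" using that unfolding edge_bd_def basis_def by simp
      fix e assume e: "e \<in> supp z"
      then obtain c d where cd: "e = [c, d]" using z(1) permmodD(2) unfolding edges_def by blast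
      have "c \<noteq> a" using no e cd pos by blast
      then show "0 \<le> z e * edge_bd e [a]" using z(3)[of e] unfolding cd edge_bd_def basis_def by simp
    qed
    then have "lin edge_bd z [a] \<noteq> 0" unfolding lin_def by simp
    then show False using z(2) by simp
  qed
  obtain e0 where "e0 \<in> supp z" using z(4) permmod_eq_0_or_supp by blast
  then obtain c0 a0 where e0: "z [c0, a0] > 0" using z(1) permmodD(2) pos unfolding edges_def by blast
  define nxt where "nxt = (\<lambda>a. SOME b. z [a, b] > 0)"
  define p where "p = (\<lambda>i. (nxt ^^ i) a0)"
  have nxt: "z [a, nxt a] > 0" if "z [b, a] > 0" for a b
    unfolding nxt_def using out[OF that] by (rule someI_ex)
  have zp: "z [p i, p (Suc i)] > 0" for i
  proof (induction i)
    case 0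
    show ?case unfolding p_def using nxt[OF e0] by simp
  next
    case (Suc i)
    then show ?case using nxt[OF Suc] unfolding p_def by simp
  qed
  have "p ` UNIV \<subseteq> hd ` supp z"
  proof
    fix v assume "v \<in> p ` UNIV"
    then obtain i where "v = p i" by blast
    then have "[p i, p (Suc i)] \<in> supp z" "v = hd [p i, p (Suc i)]" using zp[of i] pos by auto
    then show "v \<in> hd ` supp z" by blast
  qed
  then have "finite (p ` UNIV)" using fin finite_subset by blast
  then have "\<not> inj p" using finite_imageD infinite_UNIV_nat by blast
  then obtain u v where "p u = p v" "u \<noteq> v" unfolding inj_def by blast
  then have ex: "\<exists>j. \<exists>i<j. p i = p j" by (metis nat_neq_iff)
  \<comment> \<open>Minimality of \<open>j\<close> makes \<open>p\<close> injective below
    \<open>j\<close>. The edges from \<open>i\<close> to \<open>j\<close> then have distinct tails,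
    so each occurs once in the chain.\<close>
  define j where "j = (LEAST j. \<exists>i<j. p i = p j)"
  obtain i where i: "i < j" "p i = p j" using LeastI_ex[OF ex] unfolding j_def by blast
  have inj: "inj_on p {..<j}"
  proof (rule inj_onI, rule ccontr)
    fix a b assume ab: "a \<in> {..<j}" "b \<in> {..<j}" "p a = p b" "a \<noteq> b"
    have "\<exists>i<max a b. p i = p (max a b)"
    proof (cases "a < b")
      case True
      then show ?thesis using ab by (intro exI[of _ a]) auto
    next
      case False
      then show ?thesis using ab by (intro exI[of _ b]) auto
    qed
    then have "j \<le> max a b" unfolding j_def by (rule Least_le)
    then show False using ab by auto
  qed
  define F where "F = (\<lambda>t. [p t, p (Suc t)]) ` {i..<j}"
  have injF: "inj_on (\<lambda>t. [p t, p (Suc t)]) {i..<j}"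
    using inj by (auto simp: inj_on_def)
  have st: "E (p t) (p (Suc t))" for t using sE[OF zp] .
  have ch: "edge_chain (p i # map p [Suc i..<Suc j]) = (\<lambda>e. if e \<in> F then 1 else 0)"
  proof
    fix e
    have "edge_chain (p i # map p [Suc i..<Suc j]) e = (\<Sum>t\<in>{i..<j}. basis [p t, p (Suc t)] e)"
      using edge_chain_map_upt[of i j p] i(1) st by simp
    also have "\<dots> = (\<Sum>d\<in>F. basis d e)" unfolding F_def using injF by (simp add: sum.reindex)
    also have "\<dots> = (if e \<in> F then 1 else 0)" unfolding basis_def F_def by (simp add: sum.delta')
    finally show "edge_chain (p i # map p [Suc i..<Suc j]) e = (if e \<in> F then 1 else 0)" .
  qed
  show ?thesis
  proof (intro exI conjI)
    show "p i \<in> V" using st E_in_V by blast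
    show "walk E (p i) (map p [Suc i..<Suc j]) (p i)" using walk_map_upt[of i j E p] i st by simp
    show "F \<subseteq> supp z" unfolding F_def using zp pos by auto
    show "F \<noteq> {}" unfolding F_def using i by simp
    show "card F = length (map p [Suc i..<Suc j])" unfolding F_def using card_image[OF injF] by (simp del: upt_Suc)
  qed (rule ch)
qed

text \<open>Negative coefficients are first moved to the reversed edges by multiples of backtracking
  loops; a nonnegative cycle then loses one circuit at a time. The measure counts negative
  coefficients in addition to the support, since the first operation need not shrink the support.
  The norm is charged to the potential \<open>\<Phi>\<close>.\<close>

lemma cycle_fillable:
  assumes m: "shortcuts m" and irr: "\<And>x. \<not> E x x"
    and z: "z \<in> permmod edges" "lin edge_bd z = (\<lambda>_. 0)"
  shows "fillable (4 * m) z (4 * norm1 z)"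
proof -
  \<comment> \<open>The weights pay for both operations. A unit of negative coefficient costs 1 for
    the backtrack and up to 3 for the reversed edge, hence 4. A circuit of \<open>n\<close> edges
    removed with weight \<open>s\<close> costs \<open>s * (2 * n + 1)\<close>, which is at most
    \<open>3 * s * n\<close> because \<open>n \<ge> 1\<close>.\<close>
  define h :: "rat \<Rightarrow> rat" where "h = (\<lambda>t. if t < 0 then - 4 * t else 3 * t)"
  define \<Phi> where "\<Phi> = (\<lambda>z :: 'v list \<Rightarrow> rat. \<Sum>e\<in>supp z. h (z e))"
  have \<Phi>_sum: "\<Phi> z = (\<Sum>e\<in>A. h (z e))" if "finite A" "supp z \<subseteq> A" for z A
    unfolding \<Phi>_def using that by (intro sum.mono_neutral_left) (auto simp: supp_def h_def)
  define neg where "neg = (\<lambda>z :: 'v list \<Rightarrow> rat. {e. z e < 0})"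
  have neg: "neg z \<subseteq> supp z" for z unfolding neg_def supp_def by auto
  have "fillable (4 * m) z (\<Phi> z)" using z
  proof (induction "card (supp z) + card (neg z)" arbitrary: z rule: less_induct)
    case less
    have fin: "finite (supp z)" using less.prems permmodD by blast
    then have finneg: "finite (neg z)" using neg finite_subset by blast
    consider "z = (\<lambda>_. 0)" | "neg z \<noteq> {}" | "z \<noteq> (\<lambda>_. 0)" "neg z = {}" by blast
    then show ?case
    proof cases
      case 1
      then show ?thesis using fillable_zero unfolding \<Phi>_def supp_def by simp
    next
      case 2
      then obtain e where e: "z e < 0" unfolding neg_def by blast
      then have "e \<in> supp z" unfolding supp_def by simp
      then obtain a b where ab: "e = [a, b]" "E a b" using less.prems(1) permmodD(2) unfolding edges_def by blast
      define e' where "e' = [b, a]"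
      define s where "s = - z e"
      have ne: "e \<noteq> e'" using ab irr unfolding e'_def by auto
      have s: "s > 0" using e s_def by simp
      define c where "c = edge_chain [a, b, a]"
      have c: "c = (\<lambda>d. basis e d + basis e' d)" unfolding c_def ab e'_def by simp
      have wk: "walk E a [b, a] a" using ab E_sym by simp
      have cc: "c \<in> permmod edges" "lin edge_bd c = (\<lambda>_. 0)"
        unfolding c_def using edge_chain_permmod[OF wk] lin_edge_bd_walk[OF wk] by auto
      define z' where "z' = (\<lambda>d. z d + s * c d)"
      have z': "z' \<in> permmod edges" "lin edge_bd z' = (\<lambda>_. 0)"
      proof -
        show "z' \<in> permmod edges" unfolding z'_def by (rule add_permmod[OF less.prems(1) smult_permmod[OF cc(1)]])
        show "lin edge_bd z' = (\<lambda>_. 0)"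
          unfolding z'_def lin_add[OF less.prems(1) smult_permmod[OF cc(1)]] lin_smult[OF cc(1)] less.prems(2) cc(2) by simp
      qed
      have z'v: "z' d = (if d = e then 0 else if d = e' then z e' + s else z d)" for d
        unfolding z'_def c basis_def using ne s_def by auto
      have sup: "supp z' \<subseteq> insert e' (supp z - {e})" unfolding supp_def z'v by auto
      have "card (supp z') \<le> card (insert e' (supp z - {e}))" by (rule card_mono) (use fin sup in auto)
      also have "\<dots> \<le> Suc (card (supp z - {e}))" by (rule card_insert_le_m1) auto
      also have "\<dots> = card (supp z)" using fin \<open>e \<in> supp z\<close> by (rule card_Suc_Diff1)
      finally have c1: "card (supp z') \<le> card (supp z)" .
      have "neg z' \<subseteq> neg z - {e}" unfolding neg_def z'v using s by (auto split: if_splits)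
      moreover have "e \<in> neg z" using e unfolding neg_def by simp
      ultimately have "neg z' \<subset> neg z" by blast
      then have "card (neg z') < card (neg z)" using finneg psubset_card_mono by blast
      then have IH: "fillable (4 * m) z' (\<Phi> z')" using less.hyps z' c1 by simp
      have "[a, b, a] \<in> loops (4 * m)" using ab wk E_in_V[OF ab(2)] m unfolding loops_def shortcuts_def by auto
      then have fc: "fillable (4 * m) (\<lambda>d. (-s) * c d) (\<bar>-s\<bar> * 1)" unfolding c_def by (intro fillable_smult fillable_loop)
      have "(\<lambda>d. z' d + (-s) * c d) = z" unfolding z'_def by auto
      with fillable_add[OF IH fc] have "fillable (4 * m) z (\<Phi> z' + s)" using s by simp
      moreover have "\<Phi> z' + s \<le> \<Phi> z"
      proof -
        define A where "A = insert e (insert e' (supp z))"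
        have A: "finite A" "supp z \<subseteq> A" "supp z' \<subseteq> A" "e \<in> A" "e' \<in> A" using fin sup unfolding A_def by auto
        have "\<Phi> z' = (\<Sum>d\<in>A. h (z' d))" using \<Phi>_sum A by blast
        also have "\<dots> \<le> (\<Sum>d\<in>A. h (z d) + ((if e = d then - 4 * s else 0) + (if e' = d then 3 * s else 0)))"
        proof (rule sum_mono)
          fix d assume "d \<in> A"
          show "h (z' d) \<le> h (z d) + ((if e = d then - 4 * s else 0) + (if e' = d then 3 * s else 0))"
            unfolding z'v h_def using ne s s_def e by auto
        qed
        also have "\<dots> = \<Phi> z - s" using A by (simp add: sum.distrib \<Phi>_sum[of A z])
        finally show ?thesis by simp
      qed
      ultimately show ?thesis by (rule fillable_mono)
    next
      case 3
      have nn: "0 \<le> z e" for e using 3(2) unfolding neg_def by (metis (mono_tags) empty_Collect_eq not_less)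
      obtain x xs F where F: "x \<in> V" "walk E x xs x" "F \<subseteq> supp z" "F \<noteq> {}" "card F = length xs"
        and ch: "edge_chain (x # xs) = (\<lambda>e. if e \<in> F then 1 else 0)"
        using nonneg_cycle_contains_circuit[OF less.prems nn 3(1)] by metis
      have finF: "finite F" using F fin finite_subset by blast
      \<comment> \<open>The largest multiple of the circuit that keeps all coefficients nonnegative;
        it empties at least one edge and so shrinks the support.\<close>
      define s where "s = Min (z ` F)"
      have "s \<in> z ` F" unfolding s_def using finF F(4) by (intro Min_in) auto
      then obtain e where e: "e \<in> F" "z e = s" by auto
      have s: "s > 0" using e F(3) nn[of e] unfolding supp_def by auto
      have sle: "s \<le> z d" if "d \<in> F" for d unfolding s_def using finF that by (intro Min_le) auto
      define c where "c = edge_chain (x # xs)"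
      have cc: "c \<in> permmod edges" "lin edge_bd c = (\<lambda>_. 0)"
        unfolding c_def using edge_chain_permmod[OF F(2)] lin_edge_bd_walk[OF F(2)] by auto
      define z' where "z' = (\<lambda>d. z d - s * c d)"
      have z': "z' \<in> permmod edges" "lin edge_bd z' = (\<lambda>_. 0)"
      proof -
        show "z' \<in> permmod edges" unfolding z'_def by (rule diff_permmod[OF less.prems(1) smult_permmod[OF cc(1)]])
        show "lin edge_bd z' = (\<lambda>_. 0)"
          unfolding z'_def lin_diff[OF less.prems(1) smult_permmod[OF cc(1)]] lin_smult[OF cc(1)] less.prems(2) cc(2) by simp
      qed
      have z'v: "z' d = (if d \<in> F then z d - s else z d)" for d
        unfolding z'_def c_def ch by auto
      have nn': "0 \<le> z' d" for d unfolding z'v using nn sle by auto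
      have sup: "supp z' \<subseteq> supp z" unfolding supp_def z'v using F(3) unfolding supp_def by auto
      moreover have "e \<in> supp z" "e \<notin> supp z'" using e F(3) unfolding supp_def z'v by auto
      ultimately have "supp z' \<subset> supp z" by blast
      then have "card (supp z') < card (supp z)" using fin psubset_card_mono by blast
      moreover have "neg z' = {}" unfolding neg_def using nn' by (simp add: not_less)
      ultimately have IH: "fillable (4 * m) z' (\<Phi> z')" using less.hyps z' by simp
      have fc: "fillable (4 * m) (\<lambda>d. s * c d) (\<bar>s\<bar> * (2 * of_nat (length xs) + 1))"
        unfolding c_def by (intro fillable_smult closed_walk_fillable m F)
      have "(\<lambda>d. z' d + s * c d) = z" unfolding z'_def by auto
      with fillable_add[OF IH fc] have "fillable (4 * m) z (\<Phi> z' + s * (2 * of_nat (length xs) + 1))" using s by simp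
      moreover have "\<Phi> z' + s * (2 * of_nat (length xs) + 1) \<le> \<Phi> z"
      proof -
        have "\<Phi> z' = (\<Sum>d\<in>supp z. h (z' d))" using \<Phi>_sum fin sup by blast
        also have "\<dots> = (\<Sum>d\<in>supp z. h (z d) - (if d \<in> F then 3 * s else 0))"
        proof (rule sum.cong[OF refl])
          fix d
          show "h (z' d) = h (z d) - (if d \<in> F then 3 * s else 0)"
            using nn[of d] nn'[of d] unfolding h_def z'v by (auto simp: algebra_simps)
        qed
        also have "\<dots> = \<Phi> z - (\<Sum>d\<in>supp z. if d \<in> F then 3 * s else 0)" unfolding \<Phi>_def by (simp add: sum_subtractf)
        also have "(\<Sum>d\<in>supp z. if d \<in> F then 3 * s else 0) = (\<Sum>d\<in>F. 3 * s)"
          using F(3) fin by (simp add: sum.inter_restrict[symmetric] Int_absorb1)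
        also have "\<dots> = 3 * s * of_nat (length xs)" using F(5) by simp
        finally have "\<Phi> z' = \<Phi> z - 3 * s * of_nat (length xs)" .
        moreover have "1 \<le> length xs" using F(4,5) finF by (metis card_0_eq less_one not_le)
        then have "s * 1 \<le> s * of_nat (length xs)" using s by (intro mult_left_mono) auto
        ultimately show ?thesis by (simp add: algebra_simps)
      qed
      ultimately show ?thesis by (rule fillable_mono)
    qed
  qed
  moreover have "\<Phi> z \<le> 4 * norm1 z"
    unfolding \<Phi>_def norm1_def sum_distrib_left by (rule sum_mono) (auto simp: h_def)
  ultimately show ?thesis by (rule fillable_mono)
qed

text \<open>For the converse every vertex is joined to a base vertex \<open>v0\<close> by a walk.
  The boundary of the resulting chain is \<open>x\<close> minus its augmentation times
  \<open>v0\<close>.\<close>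

lemma aug_zero_boundary:
  assumes "x \<in> permmod verts"
  shows "aug (\<lambda>_. 1) x = 0 \<longleftrightarrow> (\<exists>y\<in>permmod edges. lin edge_bd y = x)"
proof
  assume "\<exists>y\<in>permmod edges. lin edge_bd y = x"
  then obtain y where y: "y \<in> permmod edges" "lin edge_bd y = x" by blast
  have z: "aug (\<lambda>_. 1) (edge_bd e) = 0" if "e \<in> edges" for e
  proof -
    have "basis [last e] \<in> permmod verts" "basis [hd e] \<in> permmod verts"
      using that E_in_V unfolding edges_def verts_def by (auto intro!: basis_permmod)
    then show ?thesis unfolding edge_bd_def by (simp add: aug_diff)
  qed
  have "aug (\<lambda>_. 1) x = aug (\<lambda>e. aug (\<lambda>_. 1) (edge_bd e)) y"
    unfolding y(2)[symmetric] by (rule aug_lin[OF y(1) edge_bd_permmod])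
  also have "\<dots> = 0" unfolding aug_def[of _ y] using z permmodD(2)[OF y(1)] by (intro sum.neutral) auto
  finally show "aug (\<lambda>_. 1) x = 0" .
next
  assume a0: "aug (\<lambda>_. 1) x = 0"
  show "\<exists>y\<in>permmod edges. lin edge_bd y = x"
  proof (cases "x = (\<lambda>_. 0)")
    case True
    then show ?thesis by (intro bexI[OF _ zero_permmod]) simp
  next
    case False
    then obtain w0 where "w0 \<in> supp x" using permmod_eq_0_or_supp by blast
    then obtain v0 where v0: "v0 \<in> V" using permmodD(2)[OF assms] unfolding verts_def by blast
    define P where "P = (\<lambda>l. SOME xs. walk E v0 xs (hd l))"
    have P: "walk E v0 (P l) (hd l)" if "l \<in> verts" for l
    proof -
      have "hd l \<in> V" using that unfolding verts_def by auto
      then show ?thesis unfolding P_def by (rule someI_ex[OF connected[OF v0]])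
    qed
    define f where "f = (\<lambda>l. edge_chain (v0 # P l))"
    have f: "f l \<in> permmod edges" if "l \<in> verts" for l unfolding f_def using edge_chain_permmod[OF P[OF that]] .
    have fb: "lin edge_bd (f l) = (\<lambda>v. basis l v - basis [v0] v)" if "l \<in> verts" for l
      
    proof -
      have "[hd l] = l" using that unfolding verts_def by auto
      then show ?thesis unfolding f_def using lin_edge_bd_walk[OF P[OF that]] by simp
    qed
    have "lin edge_bd (lin f x) v = x v" for v
    proof -
      have "lin edge_bd (lin f x) v = aug (\<lambda>l. lin edge_bd (f l) v) x"
        unfolding lin_eq_aug[of edge_bd] by (rule aug_lin[OF assms f])
      also have "\<dots> = aug (\<lambda>l. basis l v - basis [v0] v) x"
        unfolding aug_def using fb permmodD(2)[OF assms] by (intro sum.cong) auto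
      also have "\<dots> = (\<Sum>l\<in>supp x. x l * basis l v) - aug (\<lambda>_. 1) x * basis [v0] v"
        unfolding aug_def by (simp add: right_diff_distrib sum_subtractf sum_distrib_right)
      also have "(\<Sum>l\<in>supp x. x l * basis l v) = (\<Sum>l\<in>supp x. if v = l then x l else 0)"
        unfolding basis_def by (intro sum.cong) auto
      also have "\<dots> = x v" using permmodD(1)[OF assms] not_in_supp[of v x] by simp
      finally show ?thesis using a0 by simp
    qed
    then show ?thesis by (intro bexI[OF _ lin_permmod[OF assms f]] ext)
  qed
qed

lemma lin_edge_bd_loops:
  assumes "y \<in> permmod (loops N)" shows "lin edge_bd (lin edge_chain y) = (\<lambda>_. 0)"
proof
  fix v
  have "lin edge_bd (lin edge_chain y) v = aug (\<lambda>l. lin edge_bd (edge_chain l) v) y"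
    unfolding lin_eq_aug[of edge_bd] by (rule aug_lin[OF assms loops_edge_chain])
  also have "\<dots> = 0"
  proof -
    have "lin edge_bd (edge_chain l) = (\<lambda>_. 0)" if "l \<in> loops N" for l
      using that lin_edge_bd_walk unfolding loops_def by fastforce
    then show ?thesis unfolding aug_def using permmodD(2)[OF assms] by (intro sum.neutral) auto
  qed
  finally show "lin edge_bd (lin edge_chain y) v = 0" .
qed

end

section \<open>Compact open subgroups and permutation sets\<close>


lemma (in conn_graph) finite_walks:
  assumes "\<And>x. x \<in> V \<Longrightarrow> finite {y. E x y}"
  shows "x \<in> V \<Longrightarrow> finite {xs. (\<exists>y. walk E x xs y) \<and> length xs \<le> n}"
proof (induction n arbitrary: x)
  case 0
  have "{xs. (\<exists>y. walk E x xs y) \<and> length xs \<le> 0} \<subseteq> {[]}" by auto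
  then show ?case using finite_subset by blast
next
  case (Suc n)
  have "{xs. (\<exists>y. walk E x xs y) \<and> length xs \<le> Suc n} \<subseteq>
      insert [] (\<Union>y\<in>{y. E x y}. (#) y ` {xs. (\<exists>z. walk E y xs z) \<and> length xs \<le> n})"
  proof
    fix xs assume "xs \<in> {xs. (\<exists>y. walk E x xs y) \<and> length xs \<le> Suc n}"
    then show "xs \<in> insert [] (\<Union>y\<in>{y. E x y}. (#) y ` {xs. (\<exists>z. walk E y xs z) \<and> length xs \<le> n})"
    proof (cases xs)
      case (Cons a ys)
      then have "E x a" "\<exists>z. walk E a ys z" "length ys \<le> n"
        using \<open>xs \<in> {xs. (\<exists>y. walk E x xs y) \<and> length xs \<le> Suc n}\<close> by auto
      then show ?thesis unfolding Cons by blast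
    qed simp
  qed
  moreover have "finite (\<Union>y\<in>{y. E x y}. (#) y ` {xs. (\<exists>z. walk E y xs z) \<and> length xs \<le> n})"
    using assms[OF Suc.prems] Suc.IH E_in_V by (intro finite_UN_I finite_imageI) auto
  ultimately show ?case by (meson finite_insert finite_subset)
qed

section \<open>Cosets and stabilizers of compact open subgroups\<close>

locale tdlc = group G for G :: "('g, 'b) monoid_scheme" (structure) +
  fixes T :: "'g topology"
  assumes tdlc: "tdlc_group G T"
begin

lemma topspace_eq: "topspace T = carrier G"
  using tdlc unfolding tdlc_group_def by (elim conjE)

lemma Hausdorff: "Hausdorff_space T"
  using tdlc unfolding tdlc_group_def by (elim conjE)

lemma open_sub: "openin T A \<Longrightarrow> A \<subseteq> carrier G"
  using openin_subset topspace_eq by metis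

lemma compact_sub: "compactin T A \<Longrightarrow> A \<subseteq> carrier G"
  using compactin_subset_topspace topspace_eq by metis

lemma cont_mult:
  assumes "continuous_map T T f" "continuous_map T T h"
  shows "continuous_map T T (\<lambda>x. f x \<otimes> h x)"
proof -
  have "continuous_map (prod_topology T T) T (\<lambda>(x, y). x \<otimes> y)"
    using tdlc unfolding tdlc_group_def by (elim conjE)
  moreover have "continuous_map T (prod_topology T T) (\<lambda>x. (f x, h x))"
    using assms by (simp add: continuous_map_pairedI)
  ultimately have "continuous_map T T ((\<lambda>(x, y). x \<otimes> y) \<circ> (\<lambda>x. (f x, h x)))"
    by (rule continuous_map_compose[rotated])
  then show ?thesis by (simp add: o_def)
qed

lemma cont_const: "g \<in> carrier G \<Longrightarrow> continuous_map T T (\<lambda>x. g)"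
  using topspace_eq by simp

lemma cont_id: "continuous_map T T (\<lambda>x. x)"
  by simp

lemma lcoset_image: "g <#\<^bsub>G\<^esub> A = (\<lambda>x. g \<otimes> x) ` A"
  unfolding l_coset_def by auto

lemma mem_lcoset:
  assumes "g \<in> carrier G" "A \<subseteq> carrier G"
  shows "x \<in> g <#\<^bsub>G\<^esub> A \<longleftrightarrow> x \<in> carrier G \<and> inv g \<otimes> x \<in> A"
proof
  assume "x \<in> g <#\<^bsub>G\<^esub> A"
  then obtain a where "a \<in> A" "x = g \<otimes> a" unfolding lcoset_image by blast
  then show "x \<in> carrier G \<and> inv g \<otimes> x \<in> A" using assms by (auto simp: m_assoc[symmetric] subset_iff)
next
  assume a: "x \<in> carrier G \<and> inv g \<otimes> x \<in> A"
  then have "g \<otimes> (inv g \<otimes> x) = x" using assms by (simp add: m_assoc[symmetric])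
  then show "x \<in> g <#\<^bsub>G\<^esub> A" unfolding lcoset_image using a by (metis imageI)
qed

lemma compact_lcoset: "g \<in> carrier G \<Longrightarrow> compactin T A \<Longrightarrow> compactin T (g <#\<^bsub>G\<^esub> A)"
  unfolding lcoset_image by (rule image_compactin[OF _ cont_mult[OF cont_const cont_id]])

lemma open_lcoset:
  assumes "g \<in> carrier G" "openin T A" shows "openin T (g <#\<^bsub>G\<^esub> A)"
proof -
  have "openin T {x \<in> topspace T. inv g \<otimes> x \<in> A}"
    by (rule openin_continuous_map_preimage[OF cont_mult[OF cont_const cont_id] assms(2)]) (use assms in simp)
  moreover have "{x \<in> topspace T. inv g \<otimes> x \<in> A} = g <#\<^bsub>G\<^esub> A"
    using mem_lcoset[OF assms(1) open_sub[OF assms(2)]] topspace_eq by auto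
  ultimately show ?thesis by simp
qed

lemma lcoset_sub: "g \<in> carrier G \<Longrightarrow> A \<subseteq> carrier G \<Longrightarrow> g <#\<^bsub>G\<^esub> A \<subseteq> carrier G"
  using mem_lcoset by blast

lemma lcoset_inv_cancel: "g \<in> carrier G \<Longrightarrow> A \<subseteq> carrier G \<Longrightarrow> inv g <#\<^bsub>G\<^esub> (g <#\<^bsub>G\<^esub> A) = A"
  by (simp add: lcos_m_assoc lcos_mult_one)

lemma lcoset_inj: "g \<in> carrier G \<Longrightarrow> A \<subseteq> carrier G \<Longrightarrow> B \<subseteq> carrier G \<Longrightarrow> g <#\<^bsub>G\<^esub> A = g <#\<^bsub>G\<^esub> B \<Longrightarrow> A = B"
  using lcoset_inv_cancel by metis

lemma lcoset_eq_iff: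
  assumes "subgroup U G" "a \<in> carrier G" "b \<in> carrier G"
  shows "a <#\<^bsub>G\<^esub> U = b <#\<^bsub>G\<^esub> U \<longleftrightarrow> inv a \<otimes> b \<in> U"
proof -
  have U: "U \<subseteq> carrier G" using assms(1) subgroup.subset by blast
  have "b \<in> b <#\<^bsub>G\<^esub> U" unfolding mem_lcoset[OF assms(3) U] using assms subgroup.one_closed by (simp add: l_inv)
  moreover have "b \<in> a <#\<^bsub>G\<^esub> U \<Longrightarrow> a <#\<^bsub>G\<^esub> U = b <#\<^bsub>G\<^esub> U" using l_repr_independence[OF _ assms(2,1)] .
  ultimately show ?thesis using mem_lcoset[OF assms(2) U] assms(3) by metis
qed

abbreviation "cosg \<equiv> compact_open_subgroup G T"

lemma cosgD: assumes "cosg U" shows "subgroup U G" "openin T U" "compactin T U" "U \<subseteq> carrier G" "\<one> \<in> U"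
  using assms unfolding compact_open_subgroup_def by (auto dest: subgroup.subset subgroup.one_closed)

lemma self_mem_lcoset: "subgroup U G \<Longrightarrow> g \<in> carrier G \<Longrightarrow> g \<in> g <#\<^bsub>G\<^esub> U"
  using mem_lcoset subgroup.subset subgroup.one_closed by (metis l_inv)

lemma lcosI: "g \<in> carrier G \<Longrightarrow> g <#\<^bsub>G\<^esub> U \<in> lcos G U"
  unfolding lcos_def by blast

lemma lcosE: assumes "c \<in> lcos G U" obtains g where "g \<in> carrier G" "c = g <#\<^bsub>G\<^esub> U"
  using assms unfolding lcos_def by blast

lemma lcos_sub: "cosg U \<Longrightarrow> c \<in> lcos G U \<Longrightarrow> c \<subseteq> carrier G"
  using lcosE lcoset_sub cosgD(4) by metis

lemma lcos_mem_eq: assumes "cosg U" "c \<in> lcos G U" "g \<in> c" shows "c = g <#\<^bsub>G\<^esub> U" "g \<in> carrier G"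
proof -
  obtain a where a: "a \<in> carrier G" "c = a <#\<^bsub>G\<^esub> U" using assms(2) by (rule lcosE)
  show "c = g <#\<^bsub>G\<^esub> U" using l_repr_independence[OF _ a(1) cosgD(1)[OF assms(1)]] assms(3) a by blast
  show "g \<in> carrier G" using lcos_sub[OF assms(1,2)] assms(3) by blast
qed

lemma lcos_trans: assumes "cosg U" "c \<in> lcos G U" "g \<in> carrier G" shows "g <#\<^bsub>G\<^esub> c \<in> lcos G U"
  using assms lcosE lcos_m_assoc cosgD(4) lcosI m_closed by metis

lemma one_lcoset: "cosg U \<Longrightarrow> \<one> <#\<^bsub>G\<^esub> U = U"
  using cosgD(4) lcos_mult_one by blast

lemma U_in_lcos: "cosg U \<Longrightarrow> U \<in> lcos G U"
  using lcosI[OF one_closed] one_lcoset by metis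

text \<open>The cosets of \<open>U\<close> are open and pairwise disjoint, so a finite subcover of
  \<open>K\<close> must already contain every coset that meets \<open>K\<close>.\<close>

lemma compact_finite_cosets:
  assumes "compactin T K" "cosg U" shows "finite ((\<lambda>k. k <#\<^bsub>G\<^esub> U) ` K)"
proof -
  note U = cosgD[OF assms(2)]
  have K: "K \<subseteq> carrier G" using compact_sub[OF assms(1)] .
  have op: "openin T A" if "A \<in> (\<lambda>k. k <#\<^bsub>G\<^esub> U) ` K" for A
    using that open_lcoset[OF _ U(2)] K by auto
  have cov: "K \<subseteq> \<Union>((\<lambda>k. k <#\<^bsub>G\<^esub> U) ` K)" using self_mem_lcoset[OF U(1)] K by auto
  obtain F where F: "finite F" "F \<subseteq> (\<lambda>k. k <#\<^bsub>G\<^esub> U) ` K" "K \<subseteq> \<Union>F"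
    using compactinD[OF assms(1), of "(\<lambda>k. k <#\<^bsub>G\<^esub> U) ` K"] op cov by blast
  have "(\<lambda>k. k <#\<^bsub>G\<^esub> U) ` K \<subseteq> F"
  proof
    fix A assume "A \<in> (\<lambda>k. k <#\<^bsub>G\<^esub> U) ` K"
    then obtain k where k: "k \<in> K" "A = k <#\<^bsub>G\<^esub> U" by blast
    then obtain B where B: "B \<in> F" "k \<in> B" using F(3) by blast
    then have "B \<in> lcos G U" using F(2) K lcosI by blast
    then show "A \<in> F" using lcos_mem_eq(1)[OF assms(2) _ B(2)] B(1) k(2) by metis
  qed
  then show ?thesis using F(1) finite_subset by blast
qed

lemma cosg_inter: assumes "cosg U" "cosg W" shows "cosg (U \<inter> W)"
proof -
  have "closedin T W" using compactin_imp_closedin[OF Hausdorff cosgD(3)[OF assms(2)]] .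
  then have "compactin T (U \<inter> W)" using cosgD(3)[OF assms(1)] compact_Int_closedin by blast
  then show ?thesis
    unfolding compact_open_subgroup_def
    using subgroups_Inter_pair[OF cosgD(1)[OF assms(1)] cosgD(1)[OF assms(2)]] cosgD(2) assms openin_Int by blast
qed

text \<open>The stabilizer is the conjugate of \<open>U\<close> by \<open>a\<close>: it is open as a
  preimage of \<open>U\<close> and compact as an image of \<open>U\<close>.\<close>

lemma cosg_stab:
  assumes "cosg U" "a \<in> carrier G" shows "cosg {g \<in> carrier G. g <#\<^bsub>G\<^esub> (a <#\<^bsub>G\<^esub> U) = a <#\<^bsub>G\<^esub> U}"
proof -
  note U = cosgD[OF assms(1)]
  define S where "S = {g \<in> carrier G. g <#\<^bsub>G\<^esub> (a <#\<^bsub>G\<^esub> U) = a <#\<^bsub>G\<^esub> U}"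
  have S: "g \<in> S \<longleftrightarrow> inv a \<otimes> g \<otimes> a \<in> U" if g: "g \<in> carrier G" for g
  proof -
    have "g <#\<^bsub>G\<^esub> (a <#\<^bsub>G\<^esub> U) = a <#\<^bsub>G\<^esub> U \<longleftrightarrow> a <#\<^bsub>G\<^esub> U = (g \<otimes> a) <#\<^bsub>G\<^esub> U" using g assms U by (auto simp: lcos_m_assoc)
    also have "\<dots> \<longleftrightarrow> inv a \<otimes> (g \<otimes> a) \<in> U" using g assms U by (intro lcoset_eq_iff) auto
    finally show ?thesis unfolding S_def using g assms by (simp add: m_assoc)
  qed
  have Sc: "S \<subseteq> carrier G" unfolding S_def by blast
  have "openin T {x \<in> topspace T. inv a \<otimes> x \<otimes> a \<in> U}"
    by (rule openin_continuous_map_preimage[OF _ U(2)])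
      (use assms in \<open>auto intro!: cont_mult cont_const cont_id\<close>)
  moreover have "{x \<in> topspace T. inv a \<otimes> x \<otimes> a \<in> U} = S" using S Sc topspace_eq by auto
  ultimately have op: "openin T S" by simp
  have "compactin T ((\<lambda>x. a \<otimes> x \<otimes> inv a) ` U)"
    by (rule image_compactin[OF U(3)]) (use assms in \<open>auto intro!: cont_mult cont_const cont_id\<close>)
  moreover have "(\<lambda>x. a \<otimes> x \<otimes> inv a) ` U = S"
  proof (intro Set.set_eqI iffI)
    fix g assume "g \<in> (\<lambda>x. a \<otimes> x \<otimes> inv a) ` U"
    then obtain u where u: "u \<in> U" "g = a \<otimes> u \<otimes> inv a" by blast
    then have uc: "u \<in> carrier G" using U by blast
    have "inv a \<otimes> g \<otimes> a = (inv a \<otimes> a) \<otimes> u \<otimes> (inv a \<otimes> a)"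
      unfolding u(2) using uc assms(2) by (simp only: m_assoc m_closed inv_closed)
    also have "\<dots> = u" using uc assms(2) by simp
    finally show "g \<in> S" using S[of g] u uc assms(2) by simp
  next
    fix g assume g: "g \<in> S"
    then have gc: "g \<in> carrier G" using Sc by blast
    have "a \<otimes> (inv a \<otimes> g \<otimes> a) \<otimes> inv a = (a \<otimes> inv a) \<otimes> g \<otimes> (a \<otimes> inv a)"
      using gc assms(2) by (simp only: m_assoc m_closed inv_closed)
    also have "\<dots> = g" using gc assms(2) by simp
    finally show "g \<in> (\<lambda>x. a \<otimes> x \<otimes> inv a) ` U" using S[OF gc] g by (metis imageI)
  qed
  ultimately have co: "compactin T S" by simp
  have "subgroup S G"
  proof (rule subgroupI[OF Sc])
    have "a <#\<^bsub>G\<^esub> U \<subseteq> carrier G" using lcoset_sub assms U by blast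
    then have "\<one> \<in> S" unfolding S_def by (simp add: lcos_mult_one)
    then show "S \<noteq> {}" by blast
    fix g assume g: "g \<in> S"
    then have gc: "g \<in> carrier G" and ge: "g <#\<^bsub>G\<^esub> (a <#\<^bsub>G\<^esub> U) = a <#\<^bsub>G\<^esub> U" unfolding S_def by auto
    have "inv g <#\<^bsub>G\<^esub> (a <#\<^bsub>G\<^esub> U) = inv g <#\<^bsub>G\<^esub> (g <#\<^bsub>G\<^esub> (a <#\<^bsub>G\<^esub> U))" using ge by simp
    then show "inv g \<in> S" unfolding S_def using gc lcoset_inv_cancel lcoset_sub assms U by simp
    fix h assume "h \<in> S"
    then have hc: "h \<in> carrier G" and he: "h <#\<^bsub>G\<^esub> (a <#\<^bsub>G\<^esub> U) = a <#\<^bsub>G\<^esub> U" unfolding S_def by auto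
    have "(g \<otimes> h) <#\<^bsub>G\<^esub> (a <#\<^bsub>G\<^esub> U) = g <#\<^bsub>G\<^esub> (h <#\<^bsub>G\<^esub> (a <#\<^bsub>G\<^esub> U))" using gc hc lcoset_sub assms U by (simp add: lcos_m_assoc m_assoc)
    then show "g \<otimes> h \<in> S" unfolding S_def using gc hc ge he by simp
  qed
  then show ?thesis using op co unfolding compact_open_subgroup_def S_def by blast
qed

abbreviation tr :: "'g \<Rightarrow> 'g set list \<Rightarrow> 'g set list" where
  "tr g l \<equiv> map (\<lambda>c. g <#\<^bsub>G\<^esub> c) l"

lemma cosg_stab_list:
  assumes "cosg U" "l \<noteq> []" "set l \<subseteq> lcos G U"
  shows "cosg {g \<in> carrier G. tr g l = l}"
  using assms(2,3)
proof (induction l rule: list_nonempty_induct)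
  case (single c)
  then obtain a where a: "a \<in> carrier G" "c = a <#\<^bsub>G\<^esub> U" using lcosE by auto
  show ?case using cosg_stab[OF assms(1) a(1)] a(2) by simp
next
  case (cons c l)
  then obtain a where a: "a \<in> carrier G" "c = a <#\<^bsub>G\<^esub> U" using lcosE by auto
  have "{g \<in> carrier G. tr g (c # l) = c # l} =
      {g \<in> carrier G. g <#\<^bsub>G\<^esub> (a <#\<^bsub>G\<^esub> U) = a <#\<^bsub>G\<^esub> U} \<inter> {g \<in> carrier G. tr g l = l}" using a(2) by auto
  then show ?case using cosg_inter[OF cosg_stab[OF assms(1) a(1)]] cons by simp
qed

lemma tr_tr:
  assumes "cosg U" "set l \<subseteq> lcos G U" "g \<in> carrier G" "h \<in> carrier G"
  shows "tr g (tr h l) = tr (g \<otimes> h) l"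
  using assms lcos_sub[OF assms(1)] by (auto simp: lcos_m_assoc subset_iff)

lemma tr_one:
  assumes "cosg U" "set l \<subseteq> lcos G U" shows "tr \<one> l = l"
  using assms lcos_sub[OF assms(1)] by (intro map_idI) (auto simp: lcos_mult_one subset_iff)

lemma tr_inv_tr:
  assumes "cosg U" "set l \<subseteq> lcos G U" "g \<in> carrier G" shows "tr (inv g) (tr g l) = l"
  using tr_tr[OF assms(1,2) inv_closed[OF assms(3)] assms(3)] tr_one[OF assms(1,2)] l_inv[OF assms(3)] by (simp only:)

lemma tr_inj:
  assumes "cosg U" "set l \<subseteq> lcos G U" "set l' \<subseteq> lcos G U" "g \<in> carrier G"
  shows "tr g l = tr g l' \<longleftrightarrow> l = l'"
  using tr_inv_tr assms by metis

lemma act_lcoset: "cosg U \<Longrightarrow> g \<in> carrier G \<Longrightarrow> h \<in> carrier G \<Longrightarrow> act G g (j, h <#\<^bsub>G\<^esub> U) = (j, (g \<otimes> h) <#\<^bsub>G\<^esub> U)"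
  unfolding act_def using cosgD(4) by (simp add: lcos_m_assoc)

text \<open>\<open>Omega\<close> admits only disjoint unions of coset spaces, so each orbit of lists
  is replaced by \<open>G\<close> modulo the stabilizer of a chosen representative
  \<open>r j\<close>. Every orbit contains a list with head \<open>U\<close>, which is why
  \<open>fin\<close> leaves finitely many orbits. The stabilizers are finite intersections of vertex
  stabilizers, hence compact open.\<close>

lemma realize_proper_set:
  assumes U: "cosg U" and P: "\<And>l. l \<in> P \<Longrightarrow> l \<noteq> [] \<and> set l \<subseteq> lcos G U"
    and inv: "\<And>g l. g \<in> carrier G \<Longrightarrow> l \<in> P \<Longrightarrow> tr g l \<in> P"
    and fin: "finite {l \<in> P. hd l = U}"
  shows "\<exists>m W \<beta>. proper_orbits G T m W \<and> bij_betw \<beta> (Omega G m W) P \<and>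
    (\<forall>g\<in>carrier G. \<forall>\<omega>\<in>Omega G m W. \<beta> (act G g \<omega>) = tr g (\<beta> \<omega>))"
proof -
  define orb where "orb = (\<lambda>l. (\<lambda>g. tr g l) ` carrier G)"
  have sl: "set l \<subseteq> lcos G U" if "l \<in> P" for l using P[OF that] ..
  have orb_self: "l \<in> orb l" if "l \<in> P" for l
    unfolding orb_def using tr_one[OF U, of l] P[OF that] by (metis imageI one_closed)
  have orb_tr: "orb (tr g l) = orb l" if l: "l \<in> P" and g: "g \<in> carrier G" for g l
  proof (intro Set.set_eqI iffI)
    fix x assume "x \<in> orb (tr g l)"
    then obtain h where h: "h \<in> carrier G" "x = tr h (tr g l)" unfolding orb_def by blast
    then have "x = tr (h \<otimes> g) l" using tr_tr[OF U sl[OF l] h(1) g] by (simp only:)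
    then show "x \<in> orb l" unfolding orb_def using h g by blast
  next
    fix x assume "x \<in> orb l"
    then obtain h where h: "h \<in> carrier G" "x = tr h l" unfolding orb_def by blast
    have "tr (h \<otimes> inv g) (tr g l) = tr (h \<otimes> inv g \<otimes> g) l" using h g by (intro tr_tr[OF U sl[OF l]]) auto
    also have "h \<otimes> inv g \<otimes> g = h" using h g by (simp add: m_assoc)
    finally show "x \<in> orb (tr g l)" unfolding orb_def using h g by (metis imageI inv_closed m_closed)
  qed
  define Os where "Os = orb ` {l \<in> P. hd l = U}"
  define rep where "rep = (\<lambda>C. SOME l. l \<in> P \<and> orb l = C)"
  have rep: "rep C \<in> P" "orb (rep C) = C" if "C \<in> Os" for C
  proof -
    have "\<exists>l. l \<in> P \<and> orb l = C" using that unfolding Os_def by blast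
    then have "rep C \<in> P \<and> orb (rep C) = C" unfolding rep_def by (rule someI_ex)
    then show "rep C \<in> P" "orb (rep C) = C" by auto
  qed
  have "finite (rep ` Os)" unfolding Os_def using fin by simp
  then obtain r where r: "bij_betw r {0..<card (rep ` Os)} (rep ` Os)" using ex_bij_betw_nat_finite by blast
  define m where "m = card (rep ` Os)"
  have r: "bij_betw r {..<m} (rep ` Os)" using r unfolding m_def by (simp add: atLeast0LessThan)
  have r_im: "r ` {..<m} = rep ` Os" and r_on: "inj_on r {..<m}" using r by (auto simp: bij_betw_def)
  have r_rep: "\<exists>C\<in>Os. r j = rep C" if "j < m" for j
  proof -
    have "r j \<in> rep ` Os" unfolding r_im[symmetric] using that by simp
    then show ?thesis by blast
  qed
  have rP: "r j \<in> P" if "j < m" for j using r_rep[OF that] rep(1) by metis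
  have r_inj: "j = j'" if "j < m" "j' < m" "orb (r j) = orb (r j')" for j j'
  proof -
    obtain C C' where C: "C \<in> Os" "r j = rep C" "C' \<in> Os" "r j' = rep C'" using r_rep[OF \<open>j < m\<close>] r_rep[OF \<open>j' < m\<close>] by blast
    then have "r j = r j'" using that(3) rep(2) by metis
    then show ?thesis using inj_onD[OF r_on] that(1,2) by simp
  qed
  have r_surj: "\<exists>j<m. orb (r j) = orb l" if l: "l \<in> P" for l
  proof -
    have "hd l \<in> lcos G U" using P[OF l] by (metis hd_in_set subsetD)
    then obtain a where a: "a \<in> carrier G" "hd l = a <#\<^bsub>G\<^esub> U" by (rule lcosE)
    have "hd (tr (inv a) l) = U" using P[OF l] a lcoset_inv_cancel[OF a(1) cosgD(4)[OF U]] by (simp add: hd_map)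
    then have "orb (tr (inv a) l) \<in> Os" unfolding Os_def using inv[OF inv_closed[OF a(1)] l] by blast
    then have "orb l \<in> Os" using orb_tr[OF l inv_closed[OF a(1)]] by simp
    moreover from this obtain j where "j < m" "r j = rep (orb l)" using r_im by (metis imageE imageI lessThan_iff)
    ultimately show ?thesis using rep(2) by metis
  qed
  define W where "W = (\<lambda>j. {g \<in> carrier G. tr g (r j) = r j})"
  have W: "cosg (W j)" if "j < m" for j unfolding W_def using cosg_stab_list[OF U] P[OF rP[OF that]] by blast
  \<comment> \<open>Any element of the coset may be used, because \<open>W j\<close> fixes
    \<open>r j\<close>.\<close>
  define \<beta> where "\<beta> = (\<lambda>(j, c). tr (SOME h. h \<in> c) (r j))"
  have \<beta>: "\<beta> (j, h <#\<^bsub>G\<^esub> W j) = tr h (r j)" if j: "j < m" and h: "h \<in> carrier G" for j h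
  proof -
    define h' where "h' = (SOME h'. h' \<in> h <#\<^bsub>G\<^esub> W j)"
    have "h' \<in> h <#\<^bsub>G\<^esub> W j" unfolding h'_def using self_mem_lcoset[OF cosgD(1)[OF W[OF j]] h] by (rule someI)
    then obtain u where u: "u \<in> W j" "h' = h \<otimes> u" unfolding lcoset_image by blast
    have "tr h' (r j) = tr h (tr u (r j))" unfolding u(2) using u(1) by (intro tr_tr[OF U sl[OF rP[OF j]] h, symmetric]) (simp add: W_def)
    also have "\<dots> = tr h (r j)" using u(1) unfolding W_def by simp
    finally show ?thesis unfolding \<beta>_def h'_def by simp
  qed
  have eq: "\<forall>g\<in>carrier G. \<forall>\<omega>\<in>Omega G m W. \<beta> (act G g \<omega>) = tr g (\<beta> \<omega>)"
  proof (intro ballI)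
    fix g \<omega> assume g: "g \<in> carrier G" and "\<omega> \<in> Omega G m W"
    then obtain j h where j: "j < m" "h \<in> carrier G" "\<omega> = (j, h <#\<^bsub>G\<^esub> W j)" unfolding Omega_def lcos_def by blast
    show "\<beta> (act G g \<omega>) = tr g (\<beta> \<omega>)"
      unfolding j(3) act_lcoset[OF W[OF j(1)] g j(2)] \<beta>[OF j(1,2)] \<beta>[OF j(1) m_closed[OF g j(2)]]
      by (rule tr_tr[OF U sl[OF rP[OF j(1)]] g j(2), symmetric])
  qed
  have "bij_betw \<beta> (Omega G m W) P"
  proof (rule bij_betw_imageI)
    show "inj_on \<beta> (Omega G m W)"
    proof (rule inj_onI)
      fix \<omega> \<omega>' assume "\<omega> \<in> Omega G m W" "\<omega>' \<in> Omega G m W" and e: "\<beta> \<omega> = \<beta> \<omega>'"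
      then obtain j h j' h' where j: "j < m" "h \<in> carrier G" "\<omega> = (j, h <#\<^bsub>G\<^esub> W j)"
        and j': "j' < m" "h' \<in> carrier G" "\<omega>' = (j', h' <#\<^bsub>G\<^esub> W j')" unfolding Omega_def lcos_def by blast
      have e': "tr h (r j) = tr h' (r j')" using e \<beta> j j' by simp
      have "orb (r j) = orb (r j')" using orb_tr[OF rP[OF j(1)] j(2)] orb_tr[OF rP[OF j'(1)] j'(2)] e' by simp
      then have jj: "j = j'" using r_inj j j' by blast
      note slj = sl[OF rP[OF j(1)]]
      have "tr (inv h \<otimes> h') (r j) = tr (inv h) (tr h' (r j))" by (rule tr_tr[OF U slj inv_closed[OF j(2)] j'(2), symmetric])
      also have "\<dots> = r j" using e'[symmetric] jj tr_inv_tr[OF U slj j(2)] by (simp only:)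
      finally have "inv h \<otimes> h' \<in> W j" unfolding W_def using j j' by simp
      then show "\<omega> = \<omega>'" using lcoset_eq_iff[OF cosgD(1)[OF W[OF j(1)]] j(2) j'(2)] j(3) j'(3) jj by simp
    qed
    show "\<beta> ` Omega G m W = P"
    proof (intro Set.set_eqI iffI)
      fix l assume "l \<in> \<beta> ` Omega G m W"
      then obtain j h where j: "j < m" "h \<in> carrier G" "l = \<beta> (j, h <#\<^bsub>G\<^esub> W j)" unfolding Omega_def lcos_def by blast
      then show "l \<in> P" using \<beta>[OF j(1,2)] inv[OF j(2) rP[OF j(1)]] by simp
    next
      fix l assume l: "l \<in> P"
      obtain j where j: "j < m" "orb (r j) = orb l" using r_surj[OF l] by blast
      have "l \<in> orb (r j)" unfolding j(2) using orb_self[OF l] .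
      then obtain g where g: "g \<in> carrier G" "l = tr g (r j)" unfolding orb_def by blast
      then have "l = \<beta> (j, g <#\<^bsub>G\<^esub> W j)" using \<beta>[OF j(1) g(1)] by simp
      moreover have "(j, g <#\<^bsub>G\<^esub> W j) \<in> Omega G m W" unfolding Omega_def using j g lcosI by blast
      ultimately show "l \<in> \<beta> ` Omega G m W" by blast
    qed
  qed
  moreover have "proper_orbits G T m W" unfolding proper_orbits_def using W by blast
  ultimately show ?thesis using eq by blast
qed

end

locale cayley_abels = tdlc +
  fixes U E
  assumes CA: "cayley_abels_graph G T U E"
begin

lemma U: "cosg U"
  and E_lcos: "E x y \<Longrightarrow> x \<in> lcos G U \<and> y \<in> lcos G U"
  and E_symm: "E x y \<Longrightarrow> E y x"
  and E_irrefl: "\<not> E x x"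
  and E_trans: "g \<in> carrier G \<Longrightarrow> E x y \<Longrightarrow> E (g <#\<^bsub>G\<^esub> x) (g <#\<^bsub>G\<^esub> y)"
  and locally_finite: "x \<in> lcos G U \<Longrightarrow> finite {y. E x y}"
  and ex_gwalk: "x \<in> lcos G U \<Longrightarrow> y \<in> lcos G U \<Longrightarrow> \<exists>xs. gwalk E xs \<and> hd xs = x \<and> last xs = y"
  using CA unfolding cayley_abels_graph_def by simp_all

sublocale conn_graph "lcos G U" E
proof
  show "E x y \<Longrightarrow> x \<in> lcos G U \<and> y \<in> lcos G U" for x y by (rule E_lcos)
  show "E x y \<Longrightarrow> E y x" for x y by (rule E_symm)
  fix x y assume "x \<in> lcos G U" "y \<in> lcos G U"
  then obtain xs where xs: "gwalk E xs" "hd xs = x" "last xs = y" using ex_gwalk by meson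
  moreover from this obtain ys where "xs = x # ys" unfolding gwalk_def by (cases xs) auto
  ultimately have "walk E x ys y" unfolding walk_iff_gwalk by simp
  then show "\<exists>xs. walk E x xs y" ..
qed

lemma walk_tr: "g \<in> carrier G \<Longrightarrow> walk E x xs y \<Longrightarrow> walk E (g <#\<^bsub>G\<^esub> x) (tr g xs) (g <#\<^bsub>G\<^esub> y)"
  by (induction xs arbitrary: x) (auto intro: E_trans)

lemma gdist_trans:
  assumes g: "g \<in> carrier G" and x: "x \<in> lcos G U" and y: "y \<in> lcos G U"
  shows "dist_E (g <#\<^bsub>G\<^esub> x) (g <#\<^bsub>G\<^esub> y) = dist_E x y"
proof -
  have le: "dist_E (g <#\<^bsub>G\<^esub> x) (g <#\<^bsub>G\<^esub> y) \<le> dist_E x y"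
    if g: "g \<in> carrier G" and x: "x \<in> lcos G U" and y: "y \<in> lcos G U" for g x y
  proof -
    obtain xs where "walk E x xs y" "length xs = dist_E x y" using geodesic_walk x y by metis
    then show ?thesis using gdist_le_walk[OF walk_tr[OF g]] by fastforce
  qed
  have "dist_E x y = dist_E (inv g <#\<^bsub>G\<^esub> (g <#\<^bsub>G\<^esub> x)) (inv g <#\<^bsub>G\<^esub> (g <#\<^bsub>G\<^esub> y))"
    using lcoset_inv_cancel[OF g] lcos_sub[OF U] x y by simp
  also have "\<dots> \<le> dist_E (g <#\<^bsub>G\<^esub> x) (g <#\<^bsub>G\<^esub> y)" using le lcos_trans[OF U] g x y by simp
  finally show ?thesis using le[OF g x y] by simp
qed

text \<open>This serves vertices, edges and short loops alike: by local finiteness only finitely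
  many walks of bounded length start at \<open>U\<close>.\<close>

lemma realize_walk_set:
  assumes P: "P \<subseteq> {x # xs | x xs. x \<in> lcos G U \<and> (\<exists>y. walk E x xs y) \<and> length xs \<le> N}"
    and inv: "\<And>g l. g \<in> carrier G \<Longrightarrow> l \<in> P \<Longrightarrow> tr g l \<in> P"
  shows "\<exists>m W \<beta>. proper_orbits G T m W \<and> bij_betw \<beta> (Omega G m W) P \<and>
    (\<forall>g\<in>carrier G. \<forall>\<omega>\<in>Omega G m W. \<beta> (act G g \<omega>) = tr g (\<beta> \<omega>))"
proof (rule realize_proper_set[OF U _ inv])
  show "l \<noteq> [] \<and> set l \<subseteq> lcos G U" if "l \<in> P" for l
  proof -
    obtain x xs y where "l = x # xs" "x \<in> lcos G U" "walk E x xs y" using P \<open>l \<in> P\<close> by blast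
    then show ?thesis using walk_in_V by auto
  qed
  have "{l \<in> P. hd l = U} \<subseteq> (#) U ` {xs. (\<exists>y. walk E U xs y) \<and> length xs \<le> N}"
  proof
    fix l assume l: "l \<in> {l \<in> P. hd l = U}"
    then obtain x xs y where "l = x # xs" "walk E x xs y" "length xs \<le> N" using P by blast
    then show "l \<in> (#) U ` {xs. (\<exists>y. walk E U xs y) \<and> length xs \<le> N}" using l by auto
  qed
  moreover have "finite {xs. (\<exists>y. walk E U xs y) \<and> length xs \<le> N}"
    by (rule finite_walks[OF locally_finite U_in_lcos[OF U]])
  ultimately show "finite {l \<in> P. hd l = U}" by (meson finite_imageI finite_subset)
qed

end

section \<open>Presentation and resolution of a hyperbolic group\<close>


definition winv :: "(bool \<times> 'g) list \<Rightarrow> (bool \<times> 'g) list" where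
  "winv w = map (\<lambda>(b, x). (\<not> b, x)) (rev w)"

lemma word_over_simps [simp]:
  "word_over K []" "word_over K (l # w) \<longleftrightarrow> snd l \<in> K \<and> word_over K w"
  "word_over K (u @ w) \<longleftrightarrow> word_over K u \<and> word_over K w"
  unfolding word_over_def by auto

lemma word_over_winv: "word_over K (winv w) \<longleftrightarrow> word_over K w"
  unfolding word_over_def winv_def by force

lemma length_winv: "length (winv w) = length w"
  unfolding winv_def by simp

lemma winv_Cons: "winv (l # w) = winv w @ [(\<not> fst l, snd l)]"
  unfolding winv_def by (simp add: case_prod_beta)

context group
begin

lemma weval_closed: "word_over (carrier G) w \<Longrightarrow> weval G w \<in> carrier G"
  by (induction w) auto

lemma weval_append:
  "word_over (carrier G) u \<Longrightarrow> word_over (carrier G) w \<Longrightarrow> weval G (u @ w) = weval G u \<otimes> weval G w"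
  by (induction u) (auto simp: m_assoc weval_closed)

lemma weval_winv: "word_over (carrier G) w \<Longrightarrow> weval G (winv w) = inv (weval G w)"
proof (induction w)
  case Nil
  then show ?case by (simp add: winv_def)
next
  case (Cons l w)
  obtain b x where l: "l = (b, x)" by (cases l)
  have x: "x \<in> carrier G" "word_over (carrier G) w" using Cons.prems l by auto
  have "weval G (winv (l # w)) = weval G (winv w) \<otimes> weval G [(\<not> b, x)]"
    unfolding winv_Cons using x l by (subst weval_append) (auto simp: word_over_winv)
  then show ?case using Cons.IH x l by (auto simp: inv_mult_group weval_closed)
qed

end

lemma word_over_mono: "word_over K w \<Longrightarrow> K \<subseteq> K' \<Longrightarrow> word_over K' w"
  unfolding word_over_def by blast

lemma relator_insert:
  assumes "r \<in> short_relators G K n"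
  shows "symclp (relator_step G K n) (a @ b) (a @ r @ b)" "symclp (relator_step G K n) (a @ r @ b) (a @ b)"
  using assms unfolding symclp_def relator_step_def by blast+

section \<open>A compact generating set and relators of bounded length\<close>

context cayley_abels
begin

text \<open>The elements that move the base vertex \<open>U\<close> by at most one step. They form a
  finite union of cosets, whence compactness.\<close>

definition gens :: "'a set" where
  "gens = \<Union>(insert U {y. E U y})"

lemma mem_gens: "g \<in> gens \<longleftrightarrow> g \<in> carrier G \<and> (g <#\<^bsub>G\<^esub> U = U \<or> E U (g <#\<^bsub>G\<^esub> U))"
proof
  assume "g \<in> gens"
  then obtain y where y: "g \<in> y" "y = U \<or> E U y" unfolding gens_def by blast
  then have "y \<in> lcos G U" using E_lcos U_in_lcos[OF U] by blast
  then show "g \<in> carrier G \<and> (g <#\<^bsub>G\<^esub> U = U \<or> E U (g <#\<^bsub>G\<^esub> U))" using lcos_mem_eq[OF U _ y(1)] y(2) by metis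
next
  assume "g \<in> carrier G \<and> (g <#\<^bsub>G\<^esub> U = U \<or> E U (g <#\<^bsub>G\<^esub> U))"
  moreover from this have "g \<in> g <#\<^bsub>G\<^esub> U" using self_mem_lcoset[OF cosgD(1)[OF U]] by blast
  ultimately show "g \<in> gens" unfolding gens_def by auto
qed

lemma gens_carrier: "gens \<subseteq> carrier G"
  using mem_gens by blast

lemma compact_gens: "compactin T gens"
  unfolding gens_def
proof (rule compactin_Union)
  show "finite (insert U {y. E U y})" using locally_finite[OF U_in_lcos[OF U]] by simp
  fix y assume "y \<in> insert U {y. E U y}"
  then have "y \<in> lcos G U" using E_lcos U_in_lcos[OF U] by blast
  then obtain g where "g \<in> carrier G" "y = g <#\<^bsub>G\<^esub> U" by (rule lcosE)
  then show "compactin T y" using compact_lcoset cosgD(3)[OF U] by blast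
qed

text \<open>The letters are quotients of successive coset representatives. The \<open>max 1\<close>
  reflects that vertices are cosets: along an empty walk \<open>inv g \<otimes> h\<close> can still
  be any element of \<open>U\<close> and takes one letter. On longer walks the last letter absorbs
  this ambiguity.\<close>

lemma walk_word:
  assumes "walk E (g <#\<^bsub>G\<^esub> U) xs (h <#\<^bsub>G\<^esub> U)" "g \<in> carrier G" "h \<in> carrier G"
  shows "\<exists>w. word_over gens w \<and> length w \<le> max 1 (length xs) \<and> weval G w = inv g \<otimes> h"
  using assms(1,2)
proof (induction xs arbitrary: g)
  case Nil
  then have "inv g \<otimes> h \<in> U" using lcoset_eq_iff[OF cosgD(1)[OF U]] assms(3) by simp
  then have "inv g \<otimes> h \<in> gens" unfolding gens_def by blast
  then show ?case using Nil assms(3) by (intro exI[of _ "[(True, inv g \<otimes> h)]"]) auto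
next
  case (Cons y ys)
  have Ey: "E (g <#\<^bsub>G\<^esub> U) y" and wy: "walk E y ys (h <#\<^bsub>G\<^esub> U)" using Cons.prems by auto
  have letter: "inv g \<otimes> k \<in> gens" if "k \<in> carrier G" "y = k <#\<^bsub>G\<^esub> U" for k
  proof -
    have "E (inv g <#\<^bsub>G\<^esub> (g <#\<^bsub>G\<^esub> U)) (inv g <#\<^bsub>G\<^esub> y)" using E_trans[OF _ Ey] Cons.prems(2) by simp
    then have "E U ((inv g \<otimes> k) <#\<^bsub>G\<^esub> U)"
      using that Cons.prems(2) lcoset_inv_cancel[OF _ cosgD(4)[OF U]] lcos_m_assoc[OF cosgD(4)[OF U]] by simp
    then show ?thesis unfolding mem_gens using that Cons.prems(2) by simp
  qed
  show ?case
  proof (cases ys)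
    case Nil
    then have "inv g \<otimes> h \<in> gens" using letter[OF assms(3)] wy by simp
    then show ?thesis using Cons.prems(2) assms(3) by (intro exI[of _ "[(True, inv g \<otimes> h)]"]) auto
  next
    case (Cons y' ys')
    have "y \<in> lcos G U" using E_lcos Ey by blast
    \<comment> \<open>Any representative of the intermediate vertex will do, since \<open>k\<close>
      cancels in the product of the letters.\<close>
    then obtain k where k: "k \<in> carrier G" "y = k <#\<^bsub>G\<^esub> U" by (rule lcosE)
    obtain w where w: "word_over gens w" "length w \<le> max 1 (length ys)" "weval G w = inv k \<otimes> h"
      using Cons.IH[of k] wy k by auto
    have "weval G ((True, inv g \<otimes> k) # w) = inv g \<otimes> (k \<otimes> inv k) \<otimes> h"
      unfolding weval.simps w(3) if_True using k assms(3) \<open>g \<in> carrier G\<close>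
      by (simp only: m_assoc m_closed inv_closed)
    also have "\<dots> = inv g \<otimes> h" using k assms(3) \<open>g \<in> carrier G\<close> by simp
    finally have "weval G ((True, inv g \<otimes> k) # w) = inv g \<otimes> h" .
    moreover have "length ((True, inv g \<otimes> k) # w) \<le> max 1 (length (y # ys))" using w(2) Cons by simp
    moreover have "word_over gens ((True, inv g \<otimes> k) # w)" using w(1) letter[OF k] by simp
    ultimately show ?thesis by blast
  qed
qed

lemma weval_generate: "word_over gens w \<Longrightarrow> weval G w \<in> generate G gens"
proof (induction w)
  case Nil
  then show ?case by (simp add: generate.one)
next
  case (Cons l w)
  obtain b x where l: "l = (b, x)" by (cases l)
  have "(if b then x else inv x) \<in> generate G gens" using Cons.prems l by (auto intro: generate.intros)
  then show ?case using Cons l generate.eng by auto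
qed

lemma gens_generate: "generate G gens = carrier G"
proof
  show "generate G gens \<subseteq> carrier G" using generate_incl[OF gens_carrier] .
  show "carrier G \<subseteq> generate G gens"
  proof
    fix g assume g: "g \<in> carrier G"
    obtain xs where "walk E (\<one> <#\<^bsub>G\<^esub> U) xs (g <#\<^bsub>G\<^esub> U)" using connected lcosI g one_closed by meson
    from walk_word[OF this one_closed g] obtain w where "word_over gens w" "weval G w = inv \<one> \<otimes> g" by blast
    then show "g \<in> generate G gens" using weval_generate g by (metis inv_one l_one)
  qed
qed

lemma gens_step:
  assumes "g \<in> carrier G" "k \<in> gens" and c: "c = k \<or> c = inv k"
  shows "dist_E (g <#\<^bsub>G\<^esub> U) ((g \<otimes> c) <#\<^bsub>G\<^esub> U) \<le> 1"
proof -
  have k: "k \<in> carrier G" using assms gens_carrier by blast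
  have cc: "c \<in> carrier G" using c k by auto
  have kd: "dist_E U (k <#\<^bsub>G\<^esub> U) \<le> 1" using assms(2) dist_edge unfolding mem_gens by auto
  have Uc: "U \<subseteq> carrier G" using cosgD(4)[OF U] .
  have "dist_E U (c <#\<^bsub>G\<^esub> U) \<le> 1"
    using c
  proof
    assume "c = inv k"
    then have "dist_E U (c <#\<^bsub>G\<^esub> U) = dist_E (inv k <#\<^bsub>G\<^esub> (k <#\<^bsub>G\<^esub> U)) (inv k <#\<^bsub>G\<^esub> U)"
      using lcoset_inv_cancel[OF k Uc] by simp
    also have "\<dots> = dist_E (k <#\<^bsub>G\<^esub> U) U" using gdist_trans inv_closed[OF k] lcosI[OF k] U_in_lcos[OF U] by blast
    also have "\<dots> = dist_E U (k <#\<^bsub>G\<^esub> U)" using dist_sym lcosI[OF k] U_in_lcos[OF U] by blast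
    finally show ?thesis using kd by simp
  qed (use kd in simp)
  moreover have "dist_E (g <#\<^bsub>G\<^esub> U) (g <#\<^bsub>G\<^esub> (c <#\<^bsub>G\<^esub> U)) = dist_E U (c <#\<^bsub>G\<^esub> U)"
    using gdist_trans assms(1) lcosI[OF cc] U_in_lcos[OF U] by blast
  ultimately show ?thesis using lcos_m_assoc[OF Uc assms(1) cc] by simp
qed

text \<open>The prefixes of \<open>w\<close> trace a closed lazy walk, so some stretch
  \<open>s\<close> of \<open>2 * m\<close> letters joins vertices at smaller distance. It is
  exchanged for a shorter word \<open>t\<close> of the same value by inserting
  \<open>winv t @ t\<close> and deleting \<open>s @ winv t\<close>, both of length at most
  \<open>4 * m\<close>.\<close>

lemma relator_reduction:
  assumes m: "shortcuts m"
  shows "word_over gens w \<Longrightarrow> weval G w = \<one> \<Longrightarrow> (symclp (relator_step G gens (4 * m)))\<^sup>*\<^sup>* w []"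
proof (induction "length w" arbitrary: w rule: less_induct)
  case less
  have m1: "1 \<le> m" using m unfolding shortcuts_def by blast
  have co: "word_over (carrier G) u" if "word_over gens u" for u using word_over_mono[OF that gens_carrier] .
  show ?case
  proof (cases "length w \<le> 4 * m")
    case True
    then have "w \<in> short_relators G gens (4 * m)" using less.prems unfolding short_relators_def by simp
    then show ?thesis using relator_insert(2)[of w G gens "4 * m" "[]" "[]"] by auto
  next
    case False
    define n where "n = length w"
    define q where "q = (\<lambda>i. weval G (take i w))"
    define p where "p = (\<lambda>i. q i <#\<^bsub>G\<^esub> U)"
    have ow: "word_over gens (take i w)" "word_over gens (drop i w)" for i
      using less.prems(1) append_take_drop_id[of i w] by (metis word_over_simps(3))+
    have qc: "q i \<in> carrier G" for i unfolding q_def using weval_closed[OF co[OF ow(1)]] .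
    have pV: "\<forall>i\<le>n. p i \<in> lcos G U" unfolding p_def using lcosI[OF qc] by blast
    have st: "\<forall>i<n. dist_E (p i) (p (Suc i)) \<le> 1"
    proof (intro allI impI)
      fix i assume i: "i < n"
      obtain b x where bx: "w ! i = (b, x)" by (cases "w ! i")
      have x: "x \<in> gens" using less.prems(1) i bx nth_mem[of i w] unfolding word_over_def n_def by force
      then have xc: "x \<in> carrier G" using gens_carrier by blast
      have "q (Suc i) = weval G (take i w @ [(b, x)])" unfolding q_def using i bx n_def by (simp add: take_Suc_conv_app_nth)
      also have "\<dots> = q i \<otimes> (if b then x else inv x)"
        unfolding q_def using weval_append[OF co[OF ow(1)], of "[(b, x)]"] xc by simp
      finally show "dist_E (p i) (p (Suc i)) \<le> 1"
        unfolding p_def using gens_step[OF qc x, of "if b then x else inv x"] by simp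
    qed
    have cl: "p 0 = p n" unfolding p_def q_def n_def using less.prems(2) by simp
    have "2 * m \<le> n" using False n_def by simp
    then obtain i where i: "i + 2 * m \<le> n" "dist_E (p i) (p (i + 2 * m)) < 2 * m"
      using m pV st cl unfolding shortcuts_def by meson
    define a s b where "a = take i w" and "s = take (2 * m) (drop i w)" and "b = drop (i + 2 * m) w"
    have w: "w = a @ s @ b" unfolding a_def s_def b_def by (metis append_take_drop_id drop_drop add.commute)
    have o: "word_over gens a" "word_over gens s" "word_over gens b" using less.prems(1) unfolding w by auto
    have ls: "length s = 2 * m" unfolding s_def using i n_def by simp
    have "take (i + 2 * m) w = a @ s" unfolding a_def s_def by (simp add: take_add)
    then have qs: "q (i + 2 * m) = q i \<otimes> weval G s" unfolding q_def using weval_append[OF co co] o a_def by metis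
    obtain xs where xs: "walk E (p i) xs (p (i + 2 * m))" "length xs = dist_E (p i) (p (i + 2 * m))"
      using geodesic_walk pV i by (metis add_leE)
    from walk_word[OF xs(1)[unfolded p_def] qc qc] obtain t where
      t: "word_over gens t" "length t \<le> max 1 (length xs)" "weval G t = inv (q i) \<otimes> q (i + 2 * m)" by blast
    have sc: "weval G s \<in> carrier G" using weval_closed[OF co[OF o(2)]] .
    have ts: "weval G t = weval G s" using t(3) qs qc[of i] sc by (simp add: m_assoc[symmetric])
    \<comment> \<open>The lower bound 1 on the length of \<open>t\<close> does no harm, as
      \<open>1 \<le> m\<close>.\<close>
    have lt: "length t < 2 * m" using t(2) xs(2) i(2) m1 by linarith
    have r1: "winv t @ t \<in> short_relators G gens (4 * m)"
      unfolding short_relators_def using t(1) lt co[OF t(1)] weval_append[of "winv t" t] weval_winv[of t] weval_closed[of t]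
      by (simp add: word_over_winv length_winv)
    have r2: "s @ winv t \<in> short_relators G gens (4 * m)"
      unfolding short_relators_def using t(1) o(2) lt ls co[OF t(1)] co[OF o(2)] weval_append[of s "winv t"] weval_winv[of t] ts sc
      by (simp add: word_over_winv length_winv)
    have "symclp (relator_step G gens (4 * m)) ((a @ s) @ b) ((a @ s) @ (winv t @ t) @ b)"
      by (rule relator_insert(1)[OF r1])
    moreover have "symclp (relator_step G gens (4 * m)) (a @ (s @ winv t) @ (t @ b)) (a @ (t @ b))"
      by (rule relator_insert(2)[OF r2])
    ultimately have two: "(symclp (relator_step G gens (4 * m)))\<^sup>*\<^sup>* w (a @ t @ b)"
      unfolding w by (auto intro: converse_rtranclp_into_rtranclp)
    have "weval G (a @ t @ b) = weval G w"
      unfolding w using weval_append[OF co co] o t(1) ts by simp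
    then have "(symclp (relator_step G gens (4 * m)))\<^sup>*\<^sup>* (a @ t @ b) []"
      using less.hyps[of "a @ t @ b"] less.prems(2) o t(1) lt ls unfolding w by simp
    then show ?thesis using two by simp
  qed
qed

lemma shortcuts_compactly_presented: "shortcuts m \<Longrightarrow> compactly_presented G T"
  unfolding compactly_presented_def
  using gens_carrier compact_gens gens_generate relator_reduction by blast

end

text \<open>Reindexing along \<open>\<beta>\<close>, extended by zero. For a bijection onto
  \<open>P\<close> it identifies chains on the concrete set \<open>P\<close> of walks with chains on
  its model as a union of coset spaces, preserving norms and pairings.\<close>

definition pull :: "'a set \<Rightarrow> ('a \<Rightarrow> 'c) \<Rightarrow> ('c \<Rightarrow> rat) \<Rightarrow> 'a \<Rightarrow> rat" where
  "pull \<Omega> \<beta> x = (\<lambda>\<omega>. if \<omega> \<in> \<Omega> then x (\<beta> \<omega>) else 0)"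

lemma pull_bij_supp:
  assumes "bij_betw \<beta> \<Omega> P" "x \<in> permmod P" shows "bij_betw \<beta> (supp (pull \<Omega> \<beta> x)) (supp x)"
proof -
  have b: "inj_on \<beta> \<Omega>" "\<beta> ` \<Omega> = P" using assms(1) by (auto simp: bij_betw_def)
  have s: "supp (pull \<Omega> \<beta> x) = {\<omega> \<in> \<Omega>. \<beta> \<omega> \<in> supp x}" unfolding supp_def pull_def by auto
  have "inj_on \<beta> (supp (pull \<Omega> \<beta> x))" using b(1) unfolding s inj_on_def by blast
  moreover have "\<beta> ` supp (pull \<Omega> \<beta> x) = supp x" unfolding s using b(2) permmodD(2)[OF assms(2)] by blast
  ultimately show ?thesis by (simp add: bij_betw_def)
qed

lemma pull_permmod:
  assumes "bij_betw \<beta> \<Omega> P" "x \<in> permmod P" shows "pull \<Omega> \<beta> x \<in> permmod \<Omega>"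
proof -
  have "finite (supp (pull \<Omega> \<beta> x))" using bij_betw_finite[OF pull_bij_supp[OF assms]] permmodD(1)[OF assms(2)] by simp
  moreover have "supp (pull \<Omega> \<beta> x) \<subseteq> \<Omega>" unfolding supp_def pull_def by auto
  ultimately show ?thesis by (simp add: permmod_def)
qed

lemma aug_pull:
  assumes "bij_betw \<beta> \<Omega> P" "x \<in> permmod P" "\<And>\<omega>. \<omega> \<in> \<Omega> \<Longrightarrow> F' \<omega> = F (\<beta> \<omega>)"
  shows "aug F' (pull \<Omega> \<beta> x) = aug F x"
proof -
  have "aug F x = (\<Sum>\<omega>\<in>supp (pull \<Omega> \<beta> x). x (\<beta> \<omega>) * F (\<beta> \<omega>))"
    unfolding aug_def by (rule sum.reindex_bij_betw[OF pull_bij_supp[OF assms(1,2)], symmetric])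
  also have "\<dots> = aug F' (pull \<Omega> \<beta> x)"
    unfolding aug_def by (rule sum.cong) (auto simp: supp_def pull_def assms(3) split: if_splits)
  finally show ?thesis by simp
qed

lemma norm1_pull:
  assumes "bij_betw \<beta> \<Omega> P" "x \<in> permmod P" shows "norm1 (pull \<Omega> \<beta> x) = norm1 x"
proof -
  have "norm1 x = (\<Sum>\<omega>\<in>supp (pull \<Omega> \<beta> x). \<bar>x (\<beta> \<omega>)\<bar>)"
    unfolding norm1_def by (rule sum.reindex_bij_betw[OF pull_bij_supp[OF assms(1,2)], symmetric])
  also have "\<dots> = norm1 (pull \<Omega> \<beta> x)"
    unfolding norm1_def by (rule sum.cong) (auto simp: supp_def pull_def split: if_splits)
  finally show ?thesis by simp
qed

lemma pull_surj:
  assumes "bij_betw \<beta> \<Omega> P" "y \<in> permmod \<Omega>" shows "\<exists>x\<in>permmod P. pull \<Omega> \<beta> x = y"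
proof -
  have b: "inj_on \<beta> \<Omega>" "\<beta> ` \<Omega> = P" using assms(1) by (auto simp: bij_betw_def)
  have b': "bij_betw (inv_into \<Omega> \<beta>) P \<Omega>" using bij_betw_inv_into[OF assms(1)] .
  have e: "pull \<Omega> \<beta> (pull P (inv_into \<Omega> \<beta>) y) = y"
  proof
    fix \<omega>
    show "pull \<Omega> \<beta> (pull P (inv_into \<Omega> \<beta>) y) \<omega> = y \<omega>"
      unfolding pull_def using b permmod_outside[OF assms(2), of \<omega>] by (auto simp: inv_into_f_f)
  qed
  then show ?thesis using pull_permmod[OF b' assms(2)] by blast
qed

lemma pull_inj:
  assumes "bij_betw \<beta> \<Omega> P" "x \<in> permmod P" "x' \<in> permmod P" "pull \<Omega> \<beta> x = pull \<Omega> \<beta> x'"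
  shows "x = x'"
proof
  fix l
  have b: "\<beta> ` \<Omega> = P" using assms(1) by (auto simp: bij_betw_def)
  show "x l = x' l"
  proof (cases "l \<in> P")
    case True
    then obtain \<omega> where "\<omega> \<in> \<Omega>" "l = \<beta> \<omega>" using b by blast
    then show ?thesis using fun_cong[OF assms(4), of \<omega>] unfolding pull_def by simp
  qed (use permmod_outside assms(2,3) in metis)
qed

lemma lin_pull:
  assumes "bij_betw \<beta> \<Omega> P" "y \<in> permmod P"
  shows "lin (\<lambda>\<omega>. pull \<Omega>' \<beta>' (D (\<beta> \<omega>))) (pull \<Omega> \<beta> y) = pull \<Omega>' \<beta>' (lin D y)"
proof
  fix \<omega>'
  show "lin (\<lambda>\<omega>. pull \<Omega>' \<beta>' (D (\<beta> \<omega>))) (pull \<Omega> \<beta> y) \<omega>' = pull \<Omega>' \<beta>' (lin D y) \<omega>'"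
  proof (cases "\<omega>' \<in> \<Omega>'")
    case True
    then show ?thesis unfolding lin_eq_aug pull_def[of \<Omega>'] using aug_pull[OF assms] by simp
  next
    case False
    then show ?thesis unfolding lin_eq_aug pull_def[of \<Omega>'] by (simp add: aug_def)
  qed
qed

section \<open>The resolution by vertices, edges and short loops\<close>

context cayley_abels
begin

lemma verts_walks: "verts \<subseteq> {x # xs | x xs. x \<in> lcos G U \<and> (\<exists>y. walk E x xs y) \<and> length xs \<le> 0}"
proof
  fix l assume "l \<in> verts"
  then obtain v where "l = [v]" "v \<in> lcos G U" unfolding verts_def by blast
  moreover have "walk E v [] v" by simp
  ultimately show "l \<in> {x # xs | x xs. x \<in> lcos G U \<and> (\<exists>y. walk E x xs y) \<and> length xs \<le> 0}" by blast
qed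

lemma edges_walks: "edges \<subseteq> {x # xs | x xs. x \<in> lcos G U \<and> (\<exists>y. walk E x xs y) \<and> length xs \<le> 1}"
proof
  fix l assume "l \<in> edges"
  then obtain a b where ab: "l = [a, b]" "E a b" unfolding edges_def by blast
  then have "walk E a [b] b" "a \<in> lcos G U" "length [b] \<le> 1" using E_lcos by auto
  then show "l \<in> {x # xs | x xs. x \<in> lcos G U \<and> (\<exists>y. walk E x xs y) \<and> length xs \<le> 1}" using ab(1) by blast
qed

lemma loops_walks: "loops N \<subseteq> {x # xs | x xs. x \<in> lcos G U \<and> (\<exists>y. walk E x xs y) \<and> length xs \<le> N}"
  unfolding loops_def by blast

lemma verts_tr: "g \<in> carrier G \<Longrightarrow> l \<in> verts \<Longrightarrow> tr g l \<in> verts"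
  unfolding verts_def using lcos_trans[OF U] by auto

lemma edges_tr: "g \<in> carrier G \<Longrightarrow> l \<in> edges \<Longrightarrow> tr g l \<in> edges"
  unfolding edges_def using E_trans by auto

lemma loops_tr: "g \<in> carrier G \<Longrightarrow> l \<in> loops N \<Longrightarrow> tr g l \<in> loops N"
  unfolding loops_def using walk_tr lcos_trans[OF U] by auto

lemma verts_lcos: "l \<in> verts \<Longrightarrow> set l \<subseteq> lcos G U"
  unfolding verts_def by auto

lemma edges_lcos: "l \<in> edges \<Longrightarrow> set l \<subseteq> lcos G U"
  unfolding edges_def using E_lcos by auto

lemma loops_lcos: "l \<in> loops N \<Longrightarrow> set l \<subseteq> lcos G U"
  unfolding loops_def using walk_in_V by fastforce

lemma basis_tr:
  assumes "set l \<subseteq> lcos G U" "set l' \<subseteq> lcos G U" "g \<in> carrier G"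
  shows "basis (tr g l) (tr g l') = basis l l'"
  unfolding basis_def using tr_inj[OF U] assms by metis

lemma edge_chain_tr:
  assumes "g \<in> carrier G" "set e \<subseteq> lcos G U"
  shows "set w \<subseteq> lcos G U \<Longrightarrow> edge_chain (tr g w) (tr g e) = edge_chain w e"
proof (induction w rule: edge_chain.induct)
  case (1 x y r)
  have "basis (tr g [x, y]) (tr g e) = basis [x, y] e" by (rule basis_tr) (use 1 assms in auto)
  then show ?case using 1 by simp
qed auto

lemma edge_bd_tr:
  assumes "g \<in> carrier G" "e \<in> edges" "v \<in> verts"
  shows "edge_bd (tr g e) (tr g v) = edge_bd e v"
proof -
  obtain a b where ab: "e = [a, b]" "E a b" using assms(2) unfolding edges_def by blast
  have "basis (tr g [b]) (tr g v) = basis [b] v" "basis (tr g [a]) (tr g v) = basis [a] v"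
    by (rule basis_tr; use ab E_lcos verts_lcos[OF assms(3)] assms in auto)+
  then show ?thesis unfolding ab(1) edge_bd_def by simp
qed

text \<open>Viewed as a matrix, \<open>D\<close> is invariant under simultaneous translation of both
  indices. In the coset model this becomes the equivariance demanded by
  \<open>perm_hom\<close>.\<close>

lemma perm_hom_pull:
  assumes \<beta>: "bij_betw \<beta> (Omega G m W) P" "\<forall>g\<in>carrier G. \<forall>\<omega>\<in>Omega G m W. \<beta> (act G g \<omega>) = tr g (\<beta> \<omega>)"
    and \<beta>': "bij_betw \<beta>' (Omega G m' W') P'" "\<forall>g\<in>carrier G. \<forall>\<omega>\<in>Omega G m' W'. \<beta>' (act G g \<omega>) = tr g (\<beta>' \<omega>)"
    and W': "proper_orbits G T m' W'" and P': "\<And>l. l \<in> P' \<Longrightarrow> set l \<subseteq> lcos G U"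
    and D: "\<And>l. l \<in> P \<Longrightarrow> D l \<in> permmod P'"
    and eq: "\<And>g l l'. g \<in> carrier G \<Longrightarrow> l \<in> P \<Longrightarrow> l' \<in> P' \<Longrightarrow> D (tr g l) (tr g l') = D l l'"
  shows "perm_hom G (Omega G m W) (Omega G m' W') (\<lambda>\<omega>. pull (Omega G m' W') \<beta>' (D (\<beta> \<omega>)))"
  unfolding perm_hom_def
proof (intro ballI conjI ext)
  fix \<omega> assume \<omega>: "\<omega> \<in> Omega G m W"
  then have l: "\<beta> \<omega> \<in> P" using \<beta>(1) by (auto simp: bij_betw_def)
  show "pull (Omega G m' W') \<beta>' (D (\<beta> \<omega>)) \<in> permmod (Omega G m' W')" using pull_permmod[OF \<beta>'(1) D[OF l]] .
  fix g \<omega>' assume g: "g \<in> carrier G"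
  show "pull (Omega G m' W') \<beta>' (D (\<beta> (act G g \<omega>))) \<omega>' =
      translate G (Omega G m' W') g (pull (Omega G m' W') \<beta>' (D (\<beta> \<omega>))) \<omega>'"
  proof (cases "\<omega>' \<in> Omega G m' W'")
    case True
    obtain j c where jc: "\<omega>' = (j, c)" "j < m'" "c \<in> lcos G (W' j)" using True unfolding Omega_def by blast
    have Wj: "cosg (W' j)" using W' jc unfolding proper_orbits_def by blast
    have act: "act G (inv g) \<omega>' \<in> Omega G m' W'"
      unfolding jc(1) act_def Omega_def using jc lcos_trans[OF Wj jc(3)] g by simp
    have l': "\<beta>' \<omega>' \<in> P'" using True \<beta>'(1) by (auto simp: bij_betw_def)
    have e1: "\<beta>' (act G (inv g) \<omega>') = tr (inv g) (\<beta>' \<omega>')" using \<beta>'(2) g True by simp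
    have l'': "tr (inv g) (\<beta>' \<omega>') \<in> P'" using act \<beta>'(1) e1 by (metis bij_betw_apply)
    have "tr g (tr (inv g) (\<beta>' \<omega>')) = \<beta>' \<omega>'"
      using tr_inv_tr[OF U P'[OF l'] inv_closed[OF g]] inv_inv[OF g] by metis
    then have "D (\<beta> \<omega>) (tr (inv g) (\<beta>' \<omega>')) = D (tr g (\<beta> \<omega>)) (\<beta>' \<omega>')" using eq[OF g l l''] by metis
    then show ?thesis unfolding translate_def pull_def using True act e1 \<beta>(2) g \<omega> by simp
  qed (simp add: translate_def pull_def)
qed

lemma shortcuts_weak_linear_isoperimetric:
  assumes m: "shortcuts m" shows "weak_linear_isoperimetric G T"
proof -
  obtain m0 W0 \<beta>0 where O0: "proper_orbits G T m0 W0" and b0: "bij_betw \<beta>0 (Omega G m0 W0) verts"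
    and e0: "\<forall>g\<in>carrier G. \<forall>\<omega>\<in>Omega G m0 W0. \<beta>0 (act G g \<omega>) = tr g (\<beta>0 \<omega>)"
    using realize_walk_set[OF verts_walks verts_tr] by blast
  obtain m1 W1 \<beta>1 where O1: "proper_orbits G T m1 W1" and b1: "bij_betw \<beta>1 (Omega G m1 W1) edges"
    and e1: "\<forall>g\<in>carrier G. \<forall>\<omega>\<in>Omega G m1 W1. \<beta>1 (act G g \<omega>) = tr g (\<beta>1 \<omega>)"
    using realize_walk_set[OF edges_walks edges_tr] by blast
  obtain m2 W2 \<beta>2 where O2: "proper_orbits G T m2 W2" and b2: "bij_betw \<beta>2 (Omega G m2 W2) (loops (4 * m))"
    and e2: "\<forall>g\<in>carrier G. \<forall>\<omega>\<in>Omega G m2 W2. \<beta>2 (act G g \<omega>) = tr g (\<beta>2 \<omega>)"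
    using realize_walk_set[OF loops_walks loops_tr] by blast
  define \<Omega>0 where "\<Omega>0 = Omega G m0 W0"
  define \<Omega>1 where "\<Omega>1 = Omega G m1 W1"
  define \<Omega>2 where "\<Omega>2 = Omega G m2 W2"
  note b = b0[folded \<Omega>0_def] b1[folded \<Omega>1_def] b2[folded \<Omega>2_def]
  define d2 where "d2 = (\<lambda>\<omega>. pull \<Omega>1 \<beta>1 (edge_chain (\<beta>2 \<omega>)))"
  define d1 where "d1 = (\<lambda>\<omega>. pull \<Omega>0 \<beta>0 (edge_bd (\<beta>1 \<omega>)))"
  define e :: "nat \<times> 'a set \<Rightarrow> rat" where "e = (\<lambda>_. 1)"
  have ph2: "perm_hom G \<Omega>2 \<Omega>1 d2"
    unfolding d2_def \<Omega>1_def \<Omega>2_def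
  proof (rule perm_hom_pull[OF b2 e2 b1 e1 O1])
    show "edge_chain (tr g l) (tr g l') = edge_chain l l'"
      if "g \<in> carrier G" "l \<in> loops (4 * m)" "l' \<in> edges" for g l l'
      using edge_chain_tr[OF that(1) edges_lcos[OF that(3)] loops_lcos[OF that(2)]] .
  qed (fact edges_lcos, fact loops_edge_chain)
  have ph1: "perm_hom G \<Omega>1 \<Omega>0 d1"
    unfolding d1_def \<Omega>1_def \<Omega>0_def
    by (rule perm_hom_pull[OF b1 e1 b0 e0 O0]) (fact verts_lcos, fact edge_bd_permmod, fact edge_bd_tr)
  have lin2: "lin d2 (pull \<Omega>2 \<beta>2 y) = pull \<Omega>1 \<beta>1 (lin edge_chain y)" if "y \<in> permmod (loops (4 * m))" for y
    unfolding d2_def using lin_pull[OF b(3) that] .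
  have lin1: "lin d1 (pull \<Omega>1 \<beta>1 y) = pull \<Omega>0 \<beta>0 (lin edge_bd y)" if "y \<in> permmod edges" for y
    unfolding d1_def using lin_pull[OF b(2) that] .
  have lb: "lin edge_bd y \<in> permmod verts" if "y \<in> permmod edges" for y
    by (rule lin_permmod[OF that]) (rule edge_bd_permmod)
  have lc: "lin edge_chain y \<in> permmod edges" if "y \<in> permmod (loops (4 * m))" for y
    by (rule lin_permmod[OF that]) (rule loops_edge_chain)
  have pull0: "pull \<Omega>0 \<beta>0 (\<lambda>_. 0) = (\<lambda>_. 0)" unfolding pull_def by simp
  \<comment> \<open>This is used twice: the existence of \<open>y\<close> is the hard half of
    exactness at the edges, and the norm bound is the isoperimetric inequality with constant
    4.\<close>
  have cyc: "\<exists>y\<in>permmod \<Omega>2. lin d2 y = x \<and> norm1 y \<le> 4 * norm1 x"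
    if x: "x \<in> permmod \<Omega>1" "lin d1 x = (\<lambda>_. 0)" for x
  proof -
    obtain z where z: "z \<in> permmod edges" "pull \<Omega>1 \<beta>1 z = x" using pull_surj[OF b(2) x(1)] by blast
    have "pull \<Omega>0 \<beta>0 (lin edge_bd z) = pull \<Omega>0 \<beta>0 (\<lambda>_. 0)" using lin1[OF z(1)] z(2) x(2) pull0 by simp
    then have "lin edge_bd z = (\<lambda>_. 0)"
      using pull_inj[OF b(1) lb[OF z(1)] zero_permmod] by blast
    then obtain Y where Y: "Y \<in> permmod (loops (4 * m))" "lin edge_chain Y = z" "norm1 Y \<le> 4 * norm1 z"
      using cycle_fillable[OF m E_irrefl z(1)] unfolding fillable_def by blast
    show ?thesis
      using pull_permmod[OF b(3) Y(1)] lin2[OF Y(1)] Y(2,3) z(2) norm1_pull[OF b(3) Y(1)] norm1_pull[OF b(2) z(1)] by metis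
  qed
  have res: "resolution2 G T m0 W0 m1 W1 m2 W2 d2 d1 e"
    unfolding resolution2_def \<Omega>0_def[symmetric] \<Omega>1_def[symmetric] \<Omega>2_def[symmetric]
  proof (intro conjI O0 O1 O2 ph1 ph2 ballI)
    show "aug_hom G \<Omega>0 e" unfolding aug_hom_def e_def by simp
    have "[U] \<in> verts" unfolding verts_def using U_in_lcos[OF U] by blast
    then show "\<exists>x\<in>permmod \<Omega>0. aug e x = 1"
      using pull_permmod[OF b(1) basis_permmod] aug_pull[OF b(1) basis_permmod, of "[U]" e "\<lambda>_. 1"] unfolding e_def by auto
    fix x assume x: "x \<in> permmod \<Omega>0"
    obtain z where z: "z \<in> permmod verts" "pull \<Omega>0 \<beta>0 z = x" using pull_surj[OF b(1) x] by blast
    have "aug e x = aug (\<lambda>_. 1) z" unfolding z(2)[symmetric] by (rule aug_pull[OF b(1) z(1)]) (simp add: e_def)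
    moreover have "(\<exists>y\<in>permmod edges. lin edge_bd y = z) \<longleftrightarrow> (\<exists>y\<in>permmod \<Omega>1. lin d1 y = x)"
    proof
      assume "\<exists>y\<in>permmod edges. lin edge_bd y = z"
      then obtain y where "y \<in> permmod edges" "lin edge_bd y = z" by blast
      then show "\<exists>y\<in>permmod \<Omega>1. lin d1 y = x" using lin1 pull_permmod[OF b(2)] z(2) by metis
    next
      assume "\<exists>y\<in>permmod \<Omega>1. lin d1 y = x"
      then obtain y where y: "y \<in> permmod \<Omega>1" "lin d1 y = x" by blast
      obtain y' where y': "y' \<in> permmod edges" "pull \<Omega>1 \<beta>1 y' = y" using pull_surj[OF b(2) y(1)] by blast
      have "pull \<Omega>0 \<beta>0 (lin edge_bd y') = pull \<Omega>0 \<beta>0 z" using lin1[OF y'(1)] y' y z by simp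
      then have "lin edge_bd y' = z" using pull_inj[OF b(1) lb[OF y'(1)] z(1)] by blast
      then show "\<exists>y\<in>permmod edges. lin edge_bd y = z" using y'(1) by blast
    qed
    ultimately show "aug e x = 0 \<longleftrightarrow> (\<exists>y\<in>permmod \<Omega>1. lin d1 y = x)" using aug_zero_boundary[OF z(1)] by simp
  next
    fix x assume x: "x \<in> permmod \<Omega>1"
    show "lin d1 x = (\<lambda>_. 0) \<longleftrightarrow> (\<exists>y\<in>permmod \<Omega>2. lin d2 y = x)"
    proof
      assume "\<exists>y\<in>permmod \<Omega>2. lin d2 y = x"
      then obtain y where y: "y \<in> permmod \<Omega>2" "lin d2 y = x" by blast
      obtain y' where y': "y' \<in> permmod (loops (4 * m))" "pull \<Omega>2 \<beta>2 y' = y" using pull_surj[OF b(3) y(1)] by blast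
      have "x = pull \<Omega>1 \<beta>1 (lin edge_chain y')" using lin2[OF y'(1)] y' y by simp
      then have "lin d1 x = pull \<Omega>0 \<beta>0 (lin edge_bd (lin edge_chain y'))"
        using lin1[OF lc[OF y'(1)]] by simp
      then show "lin d1 x = (\<lambda>_. 0)" using lin_edge_bd_loops[OF y'(1)] pull0 by simp
    qed (use cyc[OF x] in blast)
  qed
  have iso: "\<forall>x\<in>permmod \<Omega>1. lin d1 x = (\<lambda>_. 0) \<longrightarrow>
      Inf ((\<lambda>y. real_of_rat (norm1 y)) ` {y \<in> permmod \<Omega>2. lin d2 y = x}) \<le> 4 * real_of_rat (norm1 x)"
  proof (intro ballI impI)
    fix x assume x: "x \<in> permmod \<Omega>1" "lin d1 x = (\<lambda>_. 0)"
    obtain y where y: "y \<in> permmod \<Omega>2" "lin d2 y = x" "norm1 y \<le> 4 * norm1 x" using cyc[OF x] by blast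
    have "Inf ((\<lambda>y. real_of_rat (norm1 y)) ` {y \<in> permmod \<Omega>2. lin d2 y = x}) \<le> real_of_rat (norm1 y)"
      by (rule cInf_lower) (use y in \<open>auto intro!: bdd_belowI[of _ 0] simp: norm1_nonneg\<close>)
    also have "\<dots> \<le> real_of_rat (4 * norm1 x)" using y(3) by (simp only: of_rat_less_eq)
    finally show "Inf ((\<lambda>y. real_of_rat (norm1 y)) ` {y \<in> permmod \<Omega>2. lin d2 y = x}) \<le> 4 * real_of_rat (norm1 x)"
      by (simp add: of_rat_mult)
  qed
  show ?thesis
    unfolding weak_linear_isoperimetric_def
    by (intro exI[of _ m0] exI[of _ W0] exI[of _ m1] exI[of _ W1] exI[of _ m2] exI[of _ W2] exI[of _ d2] exI[of _ d1]
        exI[of _ e] conjI exI[of _ "4 :: real"] res iso[unfolded \<Omega>1_def \<Omega>2_def]) simp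
qed

end

section \<open>From the isoperimetric inequality to hyperbolicity\<close>


lemma aug_diff_left: "aug (\<lambda>a. F a - c * H a) x = aug F x - c * aug H x"
  unfolding aug_def by (simp add: right_diff_distrib sum_subtractf sum_distrib_left mult.left_commute)

lemma aug_cong: "(\<And>a. a \<in> supp x \<Longrightarrow> F a = H a) \<Longrightarrow> aug F x = aug H x"
  unfolding aug_def by (rule sum.cong) auto

lemma (in conn_graph) lipschitz_dist:
  fixes f :: "'v \<Rightarrow> int"
  assumes "\<And>u v. E u v \<Longrightarrow> \<bar>f u - f v\<bar> \<le> 1" "x \<in> V" "y \<in> V"
  shows "\<bar>f x - f y\<bar> \<le> int (dist_E x y)"
proof -
  have "\<bar>f x - f y\<bar> \<le> int (length xs)" if "walk E x xs y" for xs
    using that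
  proof (induction xs arbitrary: x)
    case (Cons z xs)
    then have "E x z" "\<bar>f z - f y\<bar> \<le> int (length xs)" by auto
    then show ?case using assms(1)[of x z] by simp
  qed simp
  then show ?thesis using geodesic_walk[OF assms(2,3)] by metis
qed

section \<open>Existence of Cayley--Abels graphs, and translation of chains\<close>

context tdlc
begin

lemma compact_mult_set:
  assumes "compactin T A" "compactin T B" shows "compactin T ((\<lambda>(x, y). x \<otimes> y) ` (A \<times> B))"
proof (rule image_compactin)
  show "compactin (prod_topology T T) (A \<times> B)" using assms by (simp add: compactin_Times)
  show "continuous_map (prod_topology T T) T (\<lambda>(x, y). x \<otimes> y)"
    using tdlc unfolding tdlc_group_def by (elim conjE)
qed

text \<open>The subgroup \<open>U\<close> is prescribed because the vertices will have to be an
  orbit of a given resolution. The coset of \<open>g\<close> is joined to that of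
  \<open>g \<otimes> l\<close> for \<open>l\<close> in the symmetrized generating set
  \<open>L\<close>; generation by \<open>K\<close> gives connectedness.\<close>

lemma cayley_abels_graph_exists:
  assumes U: "cosg U" and cg: "compactly_generated G T"
  shows "\<exists>E. cayley_abels_graph G T U E"
proof -
  obtain K where K: "K \<subseteq> carrier G" "compactin T K" "generate G K = carrier G"
    using cg unfolding compactly_generated_def by blast
  define L where "L = K \<union> (\<lambda>x. inv x) ` K"
  have "continuous_map T T (\<lambda>x. inv x)" using tdlc unfolding tdlc_group_def by (elim conjE)
  then have "compactin T ((\<lambda>x. inv x) ` K)" using K(2) by (intro image_compactin)
  then have Lc: "compactin T L" unfolding L_def using K(2) by (intro compactin_Un)
  have L: "L \<subseteq> carrier G" using compact_sub[OF Lc] .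
  have Linv: "inv l \<in> L" if "l \<in> L" for l using that K(1) unfolding L_def by auto
  have Uc: "U \<subseteq> carrier G" using cosgD(4)[OF U] .
  define E where "E = (\<lambda>x y. x \<noteq> y \<and> (\<exists>g\<in>carrier G. \<exists>l\<in>L. x = g <#\<^bsub>G\<^esub> U \<and> y = (g \<otimes> l) <#\<^bsub>G\<^esub> U))"
  have EV: "\<forall>x y. E x y \<longrightarrow> x \<in> lcos G U \<and> y \<in> lcos G U"
    unfolding E_def using lcosI L by (metis m_closed subsetD)
  have Es: "\<forall>x y. E x y \<longrightarrow> E y x"
  proof (intro allI impI)
    fix x y assume "E x y"
    then obtain g l where gl: "x \<noteq> y" "g \<in> carrier G" "l \<in> L" "x = g <#\<^bsub>G\<^esub> U" "y = (g \<otimes> l) <#\<^bsub>G\<^esub> U"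
      unfolding E_def by blast
    have lc: "l \<in> carrier G" using gl(3) L by blast
    have "(g \<otimes> l) \<otimes> inv l = g" using gl(2) lc by (simp add: m_assoc)
    then show "E y x" unfolding E_def using gl lc Linv[OF gl(3)] by (metis m_closed)
  qed
  have Et: "\<forall>g\<in>carrier G. \<forall>x y. E x y \<longrightarrow> E (g <#\<^bsub>G\<^esub> x) (g <#\<^bsub>G\<^esub> y)"
  proof (intro ballI allI impI)
    fix h x y assume h: "h \<in> carrier G" and "E x y"
    then obtain g l where gl: "x \<noteq> y" "g \<in> carrier G" "l \<in> L" "x = g <#\<^bsub>G\<^esub> U" "y = (g \<otimes> l) <#\<^bsub>G\<^esub> U"
      unfolding E_def by blast
    have lc: "l \<in> carrier G" using gl(3) L by blast
    have xy: "x \<subseteq> carrier G" "y \<subseteq> carrier G" unfolding gl(4,5) using lcoset_sub Uc gl(2) lc by auto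
    have "h <#\<^bsub>G\<^esub> x \<noteq> h <#\<^bsub>G\<^esub> y" using lcoset_inj[OF h xy] gl(1) by blast
    moreover have "h <#\<^bsub>G\<^esub> x = (h \<otimes> g) <#\<^bsub>G\<^esub> U" unfolding gl(4) using h gl(2) Uc by (simp add: lcos_m_assoc)
    moreover have "h <#\<^bsub>G\<^esub> y = ((h \<otimes> g) \<otimes> l) <#\<^bsub>G\<^esub> U" unfolding gl(5) using h gl(2) lc Uc by (simp add: lcos_m_assoc m_assoc)
    ultimately show "E (h <#\<^bsub>G\<^esub> x) (h <#\<^bsub>G\<^esub> y)" unfolding E_def using h gl(2,3) m_closed by blast
  qed
  have Ef: "\<forall>x\<in>lcos G U. finite {y. E x y}"
  proof
    fix x assume "x \<in> lcos G U"
    then obtain a where a: "a \<in> carrier G" "x = a <#\<^bsub>G\<^esub> U" by (rule lcosE)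
    \<comment> \<open>An edge at \<open>x\<close> may be written with any representative
      \<open>g \<in> x\<close>, so the neighbours are sought among the cosets meeting the whole
      compact product of \<open>x\<close> and \<open>L\<close>.\<close>
    define M where "M = (\<lambda>(x, y). x \<otimes> y) ` (x \<times> L)"
    have "compactin T M" unfolding M_def a(2) using compact_mult_set compact_lcoset[OF a(1) cosgD(3)[OF U]] Lc by blast
    then have fin: "finite ((\<lambda>k. k <#\<^bsub>G\<^esub> U) ` M)" using compact_finite_cosets U by blast
    have "{y. E x y} \<subseteq> (\<lambda>k. k <#\<^bsub>G\<^esub> U) ` M"
    proof
      fix y assume "y \<in> {y. E x y}"
      then obtain g l where gl: "g \<in> carrier G" "l \<in> L" "x = g <#\<^bsub>G\<^esub> U" "y = (g \<otimes> l) <#\<^bsub>G\<^esub> U"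
        unfolding E_def by blast
      have "g \<in> x" unfolding gl(3) using self_mem_lcoset[OF cosgD(1)[OF U] gl(1)] .
      then have "g \<otimes> l \<in> M" unfolding M_def using gl(2) by force
      then show "y \<in> (\<lambda>k. k <#\<^bsub>G\<^esub> U) ` M" using gl(4) by blast
    qed
    then show "finite {y. E x y}" using fin finite_subset by blast
  qed
  have step: "\<exists>xs. walk E (h <#\<^bsub>G\<^esub> U) xs ((h \<otimes> l) <#\<^bsub>G\<^esub> U)" if "h \<in> carrier G" "l \<in> L" for h l
  proof (cases "h <#\<^bsub>G\<^esub> U = (h \<otimes> l) <#\<^bsub>G\<^esub> U")
    case True
    then show ?thesis by (intro exI[of _ "[]"]) simp
  next
    case False
    then have "E (h <#\<^bsub>G\<^esub> U) ((h \<otimes> l) <#\<^bsub>G\<^esub> U)" unfolding E_def using that by blast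
    then show ?thesis by (intro exI[of _ "[(h \<otimes> l) <#\<^bsub>G\<^esub> U]"]) simp
  qed
  have conn: "\<exists>xs. walk E (h <#\<^bsub>G\<^esub> U) xs ((h \<otimes> g) <#\<^bsub>G\<^esub> U)" if "g \<in> generate G K" "h \<in> carrier G" for g h
    using that
  proof (induction arbitrary: h rule: generate.induct)
    case one
    then show ?case by (intro exI[of _ "[]"]) simp
  next
    case (incl k)
    then show ?case using step unfolding L_def by blast
  next
    case (inv k)
    then show ?case using step unfolding L_def by blast
  next
    case (eng g1 g2)
    have c: "g1 \<in> carrier G" "g2 \<in> carrier G" using eng(1,2) K(3) by auto
    obtain xs where xs: "walk E (h <#\<^bsub>G\<^esub> U) xs ((h \<otimes> g1) <#\<^bsub>G\<^esub> U)" using eng.IH(1)[OF eng.prems] by blast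
    obtain ys where ys: "walk E ((h \<otimes> g1) <#\<^bsub>G\<^esub> U) ys ((h \<otimes> g1 \<otimes> g2) <#\<^bsub>G\<^esub> U)"
      using eng.IH(2)[of "h \<otimes> g1"] eng.prems c by auto
    have "walk E (h <#\<^bsub>G\<^esub> U) (xs @ ys) ((h \<otimes> (g1 \<otimes> g2)) <#\<^bsub>G\<^esub> U)"
      using walk_append[OF xs ys] eng.prems c by (simp add: m_assoc)
    then show ?case by blast
  qed
  have Ec: "\<forall>x\<in>lcos G U. \<forall>y\<in>lcos G U. \<exists>xs. gwalk E xs \<and> hd xs = x \<and> last xs = y"
  proof (intro ballI)
    fix x y assume "x \<in> lcos G U" "y \<in> lcos G U"
    then obtain a b where ab: "a \<in> carrier G" "x = a <#\<^bsub>G\<^esub> U" "b \<in> carrier G" "y = b <#\<^bsub>G\<^esub> U" using lcosE by metis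
    have "inv a \<otimes> b \<in> generate G K" using K(3) ab by simp
    from conn[OF this ab(1)] obtain xs where "walk E x xs ((a \<otimes> (inv a \<otimes> b)) <#\<^bsub>G\<^esub> U)" using ab(2) by blast
    moreover have "a \<otimes> (inv a \<otimes> b) = b" using ab by (simp add: m_assoc[symmetric])
    ultimately have "walk E x xs y" using ab(4) by simp
    then show "\<exists>xs. gwalk E xs \<and> hd xs = x \<and> last xs = y"
      unfolding walk_iff_gwalk by (intro exI[of _ "x # xs"]) simp
  qed
  have Ei: "\<forall>x. \<not> E x x" unfolding E_def by simp
  show ?thesis
    unfolding cayley_abels_graph_def by (intro exI[of _ E] conjI U EV Es Ei Et Ef Ec)
qed

lemma OmegaE:
  assumes "\<omega> \<in> Omega G m W" obtains i h where "i < m" "h \<in> carrier G" "\<omega> = (i, h <#\<^bsub>G\<^esub> W i)"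
  using assms unfolding Omega_def lcos_def by blast

lemma properD: "proper_orbits G T m W \<Longrightarrow> i < m \<Longrightarrow> cosg (W i)"
  unfolding proper_orbits_def by blast

lemma act_Omega:
  assumes "proper_orbits G T m W" "\<omega> \<in> Omega G m W" "g \<in> carrier G"
  shows "act G g \<omega> \<in> Omega G m W"
proof -
  obtain i h where i: "i < m" "h \<in> carrier G" "\<omega> = (i, h <#\<^bsub>G\<^esub> W i)" using assms(2) by (rule OmegaE)
  have "act G g \<omega> = (i, (g \<otimes> h) <#\<^bsub>G\<^esub> W i)" unfolding i(3) using act_lcoset[OF properD[OF assms(1) i(1)] assms(3) i(2)] .
  then show ?thesis unfolding Omega_def using i assms(3) lcosI by simp
qed

lemma act_act:
  assumes "proper_orbits G T m W" "\<omega> \<in> Omega G m W" "g \<in> carrier G" "h \<in> carrier G"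
  shows "act G g (act G h \<omega>) = act G (g \<otimes> h) \<omega>"
proof -
  obtain i k where i: "i < m" "k \<in> carrier G" "\<omega> = (i, k <#\<^bsub>G\<^esub> W i)" using assms(2) by (rule OmegaE)
  note W = properD[OF assms(1) i(1)]
  show ?thesis unfolding i(3) using assms(3,4) i(2) by (simp add: act_lcoset[OF W] m_assoc)
qed

lemma act_one:
  assumes "proper_orbits G T m W" "\<omega> \<in> Omega G m W" shows "act G \<one> \<omega> = \<omega>"
proof -
  obtain i k where i: "i < m" "k \<in> carrier G" "\<omega> = (i, k <#\<^bsub>G\<^esub> W i)" using assms(2) by (rule OmegaE)
  show ?thesis unfolding i(3) using i(2) by (simp add: act_lcoset[OF properD[OF assms(1) i(1)]])
qed

lemma act_inv_act:
  assumes "proper_orbits G T m W" "\<omega> \<in> Omega G m W" "g \<in> carrier G"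
  shows "act G (inv g) (act G g \<omega>) = \<omega>" "act G g (act G (inv g) \<omega>) = \<omega>"
  using act_act[OF assms(1,2)] act_one[OF assms(1,2)] assms(3) by simp_all

lemma translate_pull: "translate G \<Omega> g = pull \<Omega> (act G (inv g))"
  unfolding translate_def pull_def by (intro ext) simp

lemma act_bij:
  assumes "proper_orbits G T m W" "g \<in> carrier G"
  shows "bij_betw (act G g) (Omega G m W) (Omega G m W)"
  by (rule bij_betw_byWitness[of _ "act G (inv g)"])
    (use act_inv_act[OF assms(1) _ assms(2)] act_Omega[OF assms(1)] assms(2) in auto)

text \<open>\<open>perm_hom\<close> states equivariance on basis elements only. Translation is a
  reindexing by a permutation of the basis, so \<open>lin_pull\<close> extends it to all
  chains.\<close>

lemma lin_translate:
  assumes W: "proper_orbits G T m W" and f: "perm_hom G (Omega G m W) \<Omega>' f"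
    and z: "z \<in> permmod (Omega G m W)" and g: "g \<in> carrier G"
  shows "lin f (translate G (Omega G m W) g z) = translate G \<Omega>' g (lin f z)"
proof -
  let ?\<Omega> = "Omega G m W"
  have b: "bij_betw (act G (inv g)) ?\<Omega> ?\<Omega>" using act_bij[OF W inv_closed[OF g]] .
  have s: "supp (translate G ?\<Omega> g z) \<subseteq> ?\<Omega>" unfolding supp_def translate_def by auto
  have feq: "f \<omega> = pull \<Omega>' (act G (inv g)) (f (act G (inv g) \<omega>))" if w: "\<omega> \<in> ?\<Omega>" for \<omega>
  proof -
    have "f (act G g (act G (inv g) \<omega>)) = translate G \<Omega>' g (f (act G (inv g) \<omega>))"
      using f act_Omega[OF W w inv_closed[OF g]] g unfolding perm_hom_def by blast
    then show ?thesis using act_inv_act(2)[OF W w g] translate_pull by simp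
  qed
  have "lin f (translate G ?\<Omega> g z) = lin (\<lambda>\<omega>. pull \<Omega>' (act G (inv g)) (f (act G (inv g) \<omega>))) (translate G ?\<Omega> g z)"
    unfolding lin_eq_aug using s feq by (intro ext aug_cong) (metis subsetD)
  also have "\<dots> = translate G \<Omega>' g (lin f z)" unfolding translate_pull by (rule lin_pull[OF b z])
  finally show ?thesis .
qed

lemma translate_basis:
  assumes W: "proper_orbits G T m W" and \<omega>: "\<omega> \<in> Omega G m W" and g: "g \<in> carrier G"
  shows "translate G (Omega G m W) g (basis \<omega>) = basis (act G g \<omega>)"
proof
  fix \<nu>
  have "act G (inv g) \<nu> = \<omega> \<longleftrightarrow> \<nu> = act G g \<omega>" if "\<nu> \<in> Omega G m W"
    using act_inv_act[OF W that g] act_inv_act[OF W \<omega> g] by auto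
  then show "translate G (Omega G m W) g (basis \<omega>) \<nu> = basis (act G g \<omega>) \<nu>"
    unfolding translate_def basis_def using act_Omega[OF W \<omega> g] by auto
qed

end

section \<open>Positions of basis elements in the graph\<close>

context cayley_abels
begin

text \<open>A choice of nearby vertex for every basis element of a proper permutation module; it need not
  be equivariant.\<close>
definition near_vertex :: "nat \<times> 'a set \<Rightarrow> 'a set" where
  "near_vertex \<omega> = (SOME h. h \<in> snd \<omega>) <#\<^bsub>G\<^esub> U"

lemma near_vertexE:
  assumes "proper_orbits G T m W" "\<omega> \<in> Omega G m W"
  obtains k where "k \<in> carrier G" "k \<in> snd \<omega>" "near_vertex \<omega> = k <#\<^bsub>G\<^esub> U" "\<omega> = act G k (fst \<omega>, W (fst \<omega>))" "fst \<omega> < m"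
proof -
  obtain i h where i: "i < m" "h \<in> carrier G" "\<omega> = (i, h <#\<^bsub>G\<^esub> W i)" using assms(2) by (rule OmegaE)
  note Wi = properD[OF assms(1) i(1)]
  define k where "k = (SOME h. h \<in> snd \<omega>)"
  have "h \<in> snd \<omega>" using i self_mem_lcoset[OF cosgD(1)[OF Wi]] by simp
  then have k: "k \<in> snd \<omega>" unfolding k_def by (rule someI)
  have kc: "k \<in> carrier G" "h <#\<^bsub>G\<^esub> W i = k <#\<^bsub>G\<^esub> W i" using lcos_mem_eq[OF Wi lcosI[OF i(2)]] k i(3) by auto
  show ?thesis
  proof (rule that[of k])
    show "k \<in> carrier G" "k \<in> snd \<omega>" by (fact kc(1), fact k)
    show "near_vertex \<omega> = k <#\<^bsub>G\<^esub> U" unfolding near_vertex_def k_def ..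
    show "\<omega> = act G k (fst \<omega>, W (fst \<omega>))" unfolding i(3) act_def using kc(2) by simp
    show "fst \<omega> < m" using i by simp
  qed
qed

lemma near_vertex_lcos: "proper_orbits G T m W \<Longrightarrow> \<omega> \<in> Omega G m W \<Longrightarrow> near_vertex \<omega> \<in> lcos G U"
  using near_vertexE lcosI by metis

text \<open>On an orbit with stabilizer \<open>U\<close> the choice is forced, so functions on
  vertices are recovered exactly there, without a bounded error.\<close>

lemma near_vertex_id: "x \<in> lcos G U \<Longrightarrow> near_vertex (j, x) = x"
proof -
  assume x: "x \<in> lcos G U"
  then obtain g where g: "g \<in> carrier G" "x = g <#\<^bsub>G\<^esub> U" by (rule lcosE)
  then have "g \<in> x" using self_mem_lcoset[OF cosgD(1)[OF U]] by simp
  then have "(SOME h. h \<in> x) \<in> x" by (rule someI)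
  then show ?thesis unfolding near_vertex_def using lcos_mem_eq(1)[OF U x] by simp
qed

lemma compact_bounded:
  assumes "compactin T A" shows "\<exists>D. \<forall>r\<in>A. dist_E U (r <#\<^bsub>G\<^esub> U) \<le> D"
proof -
  have fin: "finite (dist_E U ` (\<lambda>k. k <#\<^bsub>G\<^esub> U) ` A)" using compact_finite_cosets[OF assms U] by simp
  show ?thesis using Max_ge[OF fin] by blast
qed

text \<open>The cosets in the support of \<open>z\<close> have compact union. Every element of a
  coset in the translated support is \<open>g\<close> times an element of this union, so the bound
  holds whichever representative \<open>near_vertex\<close> picks.\<close>

lemma translate_near:
  assumes W: "proper_orbits G T m W" and z: "z \<in> permmod (Omega G m W)"
  shows "\<exists>D. \<forall>g\<in>carrier G. \<forall>\<omega>\<in>supp (translate G (Omega G m W) g z). dist_E (g <#\<^bsub>G\<^esub> U) (near_vertex \<omega>) \<le> D"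
proof -
  have "compactin T (\<Union>(snd ` supp z))"
  proof (rule compactin_Union)
    show "finite (snd ` supp z)" using permmodD(1)[OF z] by simp
    fix c assume "c \<in> snd ` supp z"
    then obtain \<omega> where w: "\<omega> \<in> Omega G m W" "c = snd \<omega>" using permmodD(2)[OF z] by blast
    obtain i h where "i < m" "h \<in> carrier G" "\<omega> = (i, h <#\<^bsub>G\<^esub> W i)" using w(1) by (rule OmegaE)
    then show "compactin T c" using w(2) compact_lcoset cosgD(3) properD[OF W] by simp
  qed
  then obtain D where D: "dist_E U (r <#\<^bsub>G\<^esub> U) \<le> D" if "r \<in> \<Union>(snd ` supp z)" for r
    using compact_bounded by blast
  show ?thesis
  proof (intro exI[of _ D] ballI)
    fix g \<omega> assume g: "g \<in> carrier G" and w: "\<omega> \<in> supp (translate G (Omega G m W) g z)"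
    have wO: "\<omega> \<in> Omega G m W" and wz: "act G (inv g) \<omega> \<in> supp z"
      using w unfolding supp_def translate_def by (auto split: if_splits)
    obtain k where k: "k \<in> carrier G" "k \<in> snd \<omega>" "near_vertex \<omega> = k <#\<^bsub>G\<^esub> U" using near_vertexE[OF W wO] by metis
    have "inv g \<otimes> k \<in> snd (act G (inv g) \<omega>)" unfolding act_def lcoset_image using k(2) by simp
    then have "dist_E U ((inv g \<otimes> k) <#\<^bsub>G\<^esub> U) \<le> D" using D wz by blast
    moreover have "dist_E (g <#\<^bsub>G\<^esub> U) (g <#\<^bsub>G\<^esub> ((inv g \<otimes> k) <#\<^bsub>G\<^esub> U)) = dist_E U ((inv g \<otimes> k) <#\<^bsub>G\<^esub> U)"
      using gdist_trans[OF g U_in_lcos[OF U] lcosI] g k(1) by simp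
    moreover have "g <#\<^bsub>G\<^esub> ((inv g \<otimes> k) <#\<^bsub>G\<^esub> U) = (g \<otimes> (inv g \<otimes> k)) <#\<^bsub>G\<^esub> U"
      using lcos_m_assoc[OF cosgD(4)[OF U]] g k(1) by simp
    moreover have "g \<otimes> (inv g \<otimes> k) = k" using g k(1) by (simp add: m_assoc[symmetric])
    ultimately show "dist_E (g <#\<^bsub>G\<^esub> U) (near_vertex \<omega>) \<le> D" using k(3) by simp
  qed
qed

text \<open>Up to translation there is one basis element for each of the \<open>m\<close> orbits.
  The norm is invariant under translation, and \<open>near_vertex \<omega>\<close> is the translate
  of \<open>U\<close> by an element that carries the base element of the orbit to
  \<open>\<omega>\<close>.\<close>

lemma perm_hom_bounded:
  assumes W: "proper_orbits G T m W" and W': "proper_orbits G T m' W'"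
    and f: "perm_hom G (Omega G m W) (Omega G m' W') f"
  shows "\<exists>D N. 0 \<le> N \<and> (\<forall>\<omega>\<in>Omega G m W. norm1 (f \<omega>) \<le> N \<and>
    (\<forall>\<nu>\<in>supp (f \<omega>). dist_E (near_vertex \<omega>) (near_vertex \<nu>) \<le> D))"
proof -
  have base: "(i, W i) \<in> Omega G m W" if "i < m" for i
    unfolding Omega_def using that U_in_lcos[OF properD[OF W that]] by simp
  have fb: "f (i, W i) \<in> permmod (Omega G m' W')" if "i < m" for i
    using f base[OF that] unfolding perm_hom_def by blast
  have "\<forall>i. \<exists>D. i < m \<longrightarrow> (\<forall>g\<in>carrier G. \<forall>\<omega>\<in>supp (translate G (Omega G m' W') g (f (i, W i))).
      dist_E (g <#\<^bsub>G\<^esub> U) (near_vertex \<omega>) \<le> D)"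
    using translate_near[OF W' fb] by blast
  then obtain D where D: "\<And>i g \<omega>. i < m \<Longrightarrow> g \<in> carrier G \<Longrightarrow> \<omega> \<in> supp (translate G (Omega G m' W') g (f (i, W i))) \<Longrightarrow>
      dist_E (g <#\<^bsub>G\<^esub> U) (near_vertex \<omega>) \<le> D i" by metis
  define N where "N = (\<Sum>i<m. norm1 (f (i, W i)))"
  have N0: "0 \<le> N" unfolding N_def by (intro sum_nonneg norm1_nonneg)
  have "norm1 (f \<omega>) \<le> N \<and> (\<forall>\<nu>\<in>supp (f \<omega>). dist_E (near_vertex \<omega>) (near_vertex \<nu>) \<le> (\<Sum>i<m. D i))"
    if w: "\<omega> \<in> Omega G m W" for \<omega>
  proof -
    obtain k i where k: "k \<in> carrier G" "near_vertex \<omega> = k <#\<^bsub>G\<^esub> U" "\<omega> = act G k (i, W i)" "i < m"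
      using near_vertexE[OF W w] by metis
    have fw: "f \<omega> = translate G (Omega G m' W') k (f (i, W i))"
      unfolding k(3) using f base[OF k(4)] k(1) unfolding perm_hom_def by blast
    have "norm1 (f \<omega>) = norm1 (f (i, W i))"
      unfolding fw translate_pull by (rule norm1_pull[OF act_bij[OF W' inv_closed[OF k(1)]] fb[OF k(4)]])
    also have "\<dots> \<le> N" unfolding N_def by (rule member_le_sum) (use k(4) norm1_nonneg in auto)
    finally have "norm1 (f \<omega>) \<le> N" .
    moreover have "dist_E (near_vertex \<omega>) (near_vertex \<nu>) \<le> (\<Sum>i<m. D i)" if "\<nu> \<in> supp (f \<omega>)" for \<nu>
    proof -
      have "dist_E (near_vertex \<omega>) (near_vertex \<nu>) \<le> D i" using D[OF k(4,1)] that fw k(2) by simp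
      also have "\<dots> \<le> (\<Sum>i<m. D i)" by (rule member_le_sum) (use k(4) in auto)
      finally show ?thesis .
    qed
    ultimately show ?thesis by blast
  qed
  then show ?thesis using N0 by blast
qed

end

text \<open>The choice \<open>U0 j = U\<close> makes each vertex \<open>x\<close> a basis element
  \<open>(j, x)\<close> of \<Omega>0. The nonzero value of \<open>e\<close> there is needed to
  normalise pairings with vertices.\<close>

locale resolved = cayley_abels +
  fixes m0 U0 m1 U1 m2 U2 d2 d1 e j
  assumes res: "resolution2 G T m0 U0 m1 U1 m2 U2 d2 d1 e"
    and j: "j < m0" "U0 j = U" "e (j, U) \<noteq> 0"
begin

abbreviation "\<Omega>0 \<equiv> Omega G m0 U0"
abbreviation "\<Omega>1 \<equiv> Omega G m1 U1"
abbreviation "\<Omega>2 \<equiv> Omega G m2 U2"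

lemma W0: "proper_orbits G T m0 U0" and W1: "proper_orbits G T m1 U1" and W2: "proper_orbits G T m2 U2"
  and h2: "perm_hom G \<Omega>2 \<Omega>1 d2" and h1: "perm_hom G \<Omega>1 \<Omega>0 d1" and ah: "aug_hom G \<Omega>0 e"
  and ex0: "\<forall>x\<in>permmod \<Omega>0. aug e x = 0 \<longleftrightarrow> (\<exists>y\<in>permmod \<Omega>1. lin d1 y = x)"
  and ex1: "\<forall>x\<in>permmod \<Omega>1. lin d1 x = (\<lambda>_. 0) \<longleftrightarrow> (\<exists>y\<in>permmod \<Omega>2. lin d2 y = x)"
  using res unfolding resolution2_def by - (elim conjE, assumption)+

lemma d1_permmod: "\<omega> \<in> \<Omega>1 \<Longrightarrow> d1 \<omega> \<in> permmod \<Omega>0" and d2_permmod: "\<omega> \<in> \<Omega>2 \<Longrightarrow> d2 \<omega> \<in> permmod \<Omega>1"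
  using h1 h2 unfolding perm_hom_def by blast+

lemma aug_d1: assumes "\<omega> \<in> \<Omega>1" shows "aug e (d1 \<omega>) = 0"
  using ex0 d1_permmod[OF assms] basis_permmod[OF assms] lin_basis by metis

lemma lin_d1_d2: assumes "\<omega> \<in> \<Omega>2" shows "lin d1 (d2 \<omega>) = (\<lambda>_. 0)"
  using ex1 d2_permmod[OF assms] basis_permmod[OF assms] lin_basis by metis

lemma j_Omega: "x \<in> lcos G U \<Longrightarrow> (j, x) \<in> \<Omega>0"
  unfolding Omega_def using j by simp

lemma e_j: assumes "x \<in> lcos G U" shows "e (j, x) = e (j, U)"
proof -
  obtain g where g: "g \<in> carrier G" "x = g <#\<^bsub>G\<^esub> U" using assms by (rule lcosE)
  have "e (act G g (j, U)) = e (j, U)" using ah j_Omega[OF U_in_lcos[OF U]] g(1) unfolding aug_hom_def by blast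
  then show ?thesis unfolding act_def g(2) by simp
qed

lemma e_bounded: "\<exists>B\<ge>0. \<forall>v\<in>\<Omega>0. \<bar>e v\<bar> \<le> B"
proof (intro exI[of _ "\<Sum>i<m0. \<bar>e (i, U0 i)\<bar>"] conjI ballI)
  show "0 \<le> (\<Sum>i<m0. \<bar>e (i, U0 i)\<bar>)" by (intro sum_nonneg) auto
  fix v assume v: "v \<in> \<Omega>0"
  obtain k i where k: "k \<in> carrier G" "v = act G k (i, U0 i)" "i < m0" using near_vertexE[OF W0 v] by metis
  have "(i, U0 i) \<in> \<Omega>0" unfolding Omega_def using k(3) U_in_lcos[OF properD[OF W0 k(3)]] by simp
  then have "e v = e (i, U0 i)" using ah k unfolding aug_hom_def by blast
  then show "\<bar>e v\<bar> \<le> (\<Sum>i<m0. \<bar>e (i, U0 i)\<bar>)" using member_le_sum[of i "{..<m0}" "\<lambda>i. \<bar>e (i, U0 i)\<bar>"] k(3) by simp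
qed

text \<open>The augmentation is constant on the orbit, so this difference of vertices lies in its
  kernel. The factor is chosen so that pairing with \<open>e\<close> times \<open>g\<close> gives
  exactly \<open>g y - g x\<close>.\<close>

definition "vdiff x y = (\<lambda>v. (1 / e (j, U)) * (basis (j, y) v - basis (j, x) v))"

lemma vdiff_permmod: "x \<in> lcos G U \<Longrightarrow> y \<in> lcos G U \<Longrightarrow> vdiff x y \<in> permmod \<Omega>0"
  unfolding vdiff_def using j_Omega by (intro smult_permmod diff_permmod basis_permmod)

lemma translate_vdiff:
  assumes "x \<in> lcos G U" "y \<in> lcos G U" "g \<in> carrier G"
  shows "translate G \<Omega>0 g (vdiff x y) = vdiff (g <#\<^bsub>G\<^esub> x) (g <#\<^bsub>G\<^esub> y)"
proof
  fix v
  have t: "translate G \<Omega>0 g (basis (j, x)) v = basis (j, g <#\<^bsub>G\<^esub> x) v" if "x \<in> lcos G U" for x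
    using translate_basis[OF W0 j_Omega[OF that] assms(3)] unfolding act_def by simp
  show "translate G \<Omega>0 g (vdiff x y) v = vdiff (g <#\<^bsub>G\<^esub> x) (g <#\<^bsub>G\<^esub> y) v"
    using t[OF assms(1)] t[OF assms(2)] unfolding translate_def vdiff_def by (auto split: if_splits)
qed

text \<open>Exactness supplies fillings for the finitely many edges at \<open>U\<close>, which are
  then moved by chosen coset representatives \<open>rt x\<close>. The stabilizer of a vertex need
  not preserve these fillings, so only uniform bounds are claimed, not equivariance.\<close>

lemma edge_filling:
  "\<exists>\<phi> D N. 0 \<le> N \<and> (\<forall>x y. E x y \<longrightarrow> \<phi> x y \<in> permmod \<Omega>1 \<and> lin d1 (\<phi> x y) = vdiff x y \<and>
     norm1 (\<phi> x y) \<le> N \<and> (\<forall>\<omega>\<in>supp (\<phi> x y). dist_E x (near_vertex \<omega>) \<le> D))"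
proof -
  define Nb where "Nb = {y. E U y}"
  have fin: "finite Nb" unfolding Nb_def using locally_finite[OF U_in_lcos[OF U]] .
  have "\<exists>c\<in>permmod \<Omega>1. lin d1 c = vdiff U y" if "y \<in> Nb" for y
  proof -
    have y: "y \<in> lcos G U" "U \<in> lcos G U" using that E_lcos unfolding Nb_def by blast+
    have b: "basis (j, y) \<in> permmod \<Omega>0" "basis (j, U) \<in> permmod \<Omega>0" using basis_permmod[OF j_Omega] y by auto
    have "aug e (vdiff U y) = (1 / e (j, U)) * (e (j, y) - e (j, U))"
      unfolding vdiff_def aug_smult[OF diff_permmod[OF b]] aug_diff[OF b] aug_basis ..
    also have "\<dots> = 0" using e_j[OF y(1)] by simp
    finally show ?thesis using ex0 vdiff_permmod[OF y(2,1)] by blast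
  qed
  then obtain c where c: "\<And>y. y \<in> Nb \<Longrightarrow> c y \<in> permmod \<Omega>1" "\<And>y. y \<in> Nb \<Longrightarrow> lin d1 (c y) = vdiff U y" by metis
  have "\<forall>y. \<exists>D. y \<in> Nb \<longrightarrow> (\<forall>g\<in>carrier G. \<forall>\<omega>\<in>supp (translate G \<Omega>1 g (c y)). dist_E (g <#\<^bsub>G\<^esub> U) (near_vertex \<omega>) \<le> D)"
    using translate_near[OF W1 c(1)] by blast
  then obtain D where D: "\<And>y g \<omega>. y \<in> Nb \<Longrightarrow> g \<in> carrier G \<Longrightarrow> \<omega> \<in> supp (translate G \<Omega>1 g (c y)) \<Longrightarrow>
      dist_E (g <#\<^bsub>G\<^esub> U) (near_vertex \<omega>) \<le> D y" by metis
  define rt where "rt = (\<lambda>x. SOME g. g \<in> carrier G \<and> x = g <#\<^bsub>G\<^esub> U)"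
  have rt: "rt x \<in> carrier G" "x = rt x <#\<^bsub>G\<^esub> U" if "x \<in> lcos G U" for x
    using someI_ex[of "\<lambda>g. g \<in> carrier G \<and> x = g <#\<^bsub>G\<^esub> U"] that unfolding rt_def lcos_def by auto
  define \<phi> where "\<phi> = (\<lambda>x y. translate G \<Omega>1 (rt x) (c (inv (rt x) <#\<^bsub>G\<^esub> y)))"
  define N where "N = (\<Sum>y\<in>Nb. norm1 (c y))"
  have main: "\<phi> x y \<in> permmod \<Omega>1 \<and> lin d1 (\<phi> x y) = vdiff x y \<and>
     norm1 (\<phi> x y) \<le> N \<and> (\<forall>\<omega>\<in>supp (\<phi> x y). dist_E x (near_vertex \<omega>) \<le> sum D Nb)" if Exy: "E x y" for x y
  proof -
    have xy: "x \<in> lcos G U" "y \<in> lcos G U" using E_lcos[OF Exy] by auto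
    define g where "g = rt x"
    have g: "g \<in> carrier G" "x = g <#\<^bsub>G\<^esub> U" using rt[OF xy(1)] unfolding g_def by auto
    define y' where "y' = inv g <#\<^bsub>G\<^esub> y"
    have "E (inv g <#\<^bsub>G\<^esub> x) (inv g <#\<^bsub>G\<^esub> y)" using E_trans[OF inv_closed[OF g(1)] Exy] .
    then have y': "y' \<in> Nb" unfolding Nb_def y'_def g(2) using lcoset_inv_cancel[OF g(1) cosgD(4)[OF U]] by simp
    have y'l: "y' \<in> lcos G U" using y' E_lcos unfolding Nb_def by blast
    have gy: "g <#\<^bsub>G\<^esub> y' = y"
      unfolding y'_def using lcoset_inv_cancel[OF inv_closed[OF g(1)] lcos_sub[OF U xy(2)]] inv_inv[OF g(1)] by simp
    have \<phi>: "\<phi> x y = translate G \<Omega>1 g (c y')" unfolding \<phi>_def g_def y'_def ..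
    have b: "bij_betw (act G (inv g)) \<Omega>1 \<Omega>1" using act_bij[OF W1 inv_closed[OF g(1)]] .
    have "\<phi> x y \<in> permmod \<Omega>1" unfolding \<phi> translate_pull using pull_permmod[OF b c(1)[OF y']] .
    moreover have "lin d1 (\<phi> x y) = vdiff x y"
      unfolding \<phi> lin_translate[OF W1 h1 c(1)[OF y'] g(1)] c(2)[OF y'] translate_vdiff[OF U_in_lcos[OF U] y'l g(1)]
      using g(2) gy by simp
    moreover have "norm1 (\<phi> x y) \<le> N"
      unfolding \<phi> translate_pull norm1_pull[OF b c(1)[OF y']] N_def
      by (rule member_le_sum[OF y' _ fin]) (rule norm1_nonneg)
    moreover have "dist_E x (near_vertex \<omega>) \<le> sum D Nb" if "\<omega> \<in> supp (\<phi> x y)" for \<omega>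
    proof -
      have "dist_E x (near_vertex \<omega>) \<le> D y'" using D[OF y' g(1) that[unfolded \<phi>]] g(2) by simp
      also have "\<dots> \<le> sum D Nb" by (rule member_le_sum[OF y' _ fin]) simp
      finally show ?thesis .
    qed
    ultimately show ?thesis by blast
  qed
  have "0 \<le> N" unfolding N_def by (intro sum_nonneg norm1_nonneg)
  then show ?thesis using main by blast
qed

text \<open>The cochain \<open>f dg\<close> is transported to \<open>\<Omega>1\<close> as \<open>\<omega> \<mapsto> f(\<omega>) \<langle>e g, d1 \<omega>\<rangle>\<close>. It is bounded on the
  boundaries \<open>d2 \<omega>\<close>, and differs boundedly from \<open>f dg\<close> on the chains that represent edges.\<close>
lemma line_int_linear_bound:
  fixes C :: real
  assumes C: "C > 0" and iso: "\<forall>x\<in>permmod \<Omega>1. lin d1 x = (\<lambda>_. 0) \<longrightarrow>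
     Inf ((\<lambda>y. real_of_rat (norm1 y)) ` {y\<in>permmod \<Omega>2. lin d2 y = x}) \<le> C * real_of_rat (norm1 x)"
  shows "\<exists>N. isoperimetric_graph (lcos G U) E N"
proof -
  obtain D1 N1 where N1: "0 \<le> N1" and b1: "\<And>\<omega>. \<omega> \<in> \<Omega>1 \<Longrightarrow> norm1 (d1 \<omega>) \<le> N1"
    "\<And>\<omega> \<nu>. \<omega> \<in> \<Omega>1 \<Longrightarrow> \<nu> \<in> supp (d1 \<omega>) \<Longrightarrow> dist_E (near_vertex \<omega>) (near_vertex \<nu>) \<le> D1"
    using perm_hom_bounded[OF W1 W0 h1] by blast
  obtain D2 N2 where N2: "0 \<le> N2" and b2: "\<And>\<omega>. \<omega> \<in> \<Omega>2 \<Longrightarrow> norm1 (d2 \<omega>) \<le> N2"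
    "\<And>\<omega> \<nu>. \<omega> \<in> \<Omega>2 \<Longrightarrow> \<nu> \<in> supp (d2 \<omega>) \<Longrightarrow> dist_E (near_vertex \<omega>) (near_vertex \<nu>) \<le> D2"
    using perm_hom_bounded[OF W2 W1 h2] by blast
  obtain \<phi> D3 N3 where N3: "0 \<le> N3" and \<phi>: "\<And>x y. E x y \<Longrightarrow> \<phi> x y \<in> permmod \<Omega>1"
    "\<And>x y. E x y \<Longrightarrow> lin d1 (\<phi> x y) = vdiff x y" "\<And>x y. E x y \<Longrightarrow> norm1 (\<phi> x y) \<le> N3"
    "\<And>x y \<omega>. E x y \<Longrightarrow> \<omega> \<in> supp (\<phi> x y) \<Longrightarrow> dist_E x (near_vertex \<omega>) \<le> D3"
    using edge_filling by metis
  obtain eb where eb: "0 \<le> eb" "\<And>v. v \<in> \<Omega>0 \<Longrightarrow> \<bar>e v\<bar> \<le> eb" using e_bounded by blast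
  \<comment> \<open>\<open>B0\<close> bounds the pairing of \<open>e g\<close> with
    \<open>d1 \<omega>\<close>, \<open>B2\<close> the transported cochain on
    \<open>d2 \<omega>\<close>, and \<open>B3\<close> its deviation from \<open>f dg\<close> on a
    single edge.\<close>
  define B0 where "B0 = eb * of_nat D1 * N1"
  define B2 where "B2 = of_nat D2 * B0 * N2"
  define B3 where "B3 = of_nat D3 * B0 * N3"
  have B0: "0 \<le> B0" and B2: "0 \<le> B2" and B3: "0 \<le> B3" unfolding B0_def B2_def B3_def using eb N1 N2 N3 by auto
  have nV: "near_vertex \<omega> \<in> lcos G U" if "\<omega> \<in> \<Omega>0 \<or> \<omega> \<in> \<Omega>1 \<or> \<omega> \<in> \<Omega>2" for \<omega>
    using near_vertex_lcos W0 W1 W2 that by blast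
  have key: "\<bar>of_int (line_int f g x xs)\<bar> \<le> real_of_rat B3 * real (length xs) +
      real_of_rat B2 * (C * (real_of_rat N3 * real (length xs)) + 1)"
    if f: "\<And>u v. E u v \<Longrightarrow> \<bar>f u - f v\<bar> \<le> 1" and g: "\<And>u v. E u v \<Longrightarrow> \<bar>g u - g v\<bar> \<le> 1"
      and x: "x \<in> lcos G U" and xs: "walk E x xs x" for f g :: "'a set \<Rightarrow> int" and x xs
  proof -
    \<comment> \<open>\<open>Gt\<close> extends \<open>g\<close> to all of \<Omega>0 through nearby
      vertices. With the weight \<open>e\<close>, constants added to \<open>g\<close> pair to zero
      with every \<open>d1 \<omega>\<close>.\<close>
    define Gt :: "nat \<times> 'a set \<Rightarrow> rat" where "Gt = (\<lambda>v. e v * of_int (g (near_vertex v)))"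
    define Q where "Q = (\<lambda>\<omega>. aug Gt (d1 \<omega>))"
    define P where "P = (\<lambda>\<omega>. of_int (f (near_vertex \<omega>)) * Q \<omega>)"
    have lip: "\<bar>of_int (h u) - of_int (h v) :: rat\<bar> \<le> of_nat D"
      if "\<And>u v. E u v \<Longrightarrow> \<bar>h u - h v\<bar> \<le> 1" "u \<in> lcos G U" "v \<in> lcos G U" "dist_E u v \<le> D \<or> dist_E v u \<le> D"
      for h :: "'a set \<Rightarrow> int" and u v D
    proof -
      have "\<bar>h u - h v\<bar> \<le> int D" using lipschitz_dist[of h u v] that dist_sym[of u v] by force
      then have "of_int \<bar>h u - h v\<bar> \<le> (of_int (int D) :: rat)" by (simp only: of_int_le_iff)
      then show ?thesis by simp
    qed
    have Q: "\<bar>Q \<omega>\<bar> \<le> B0" if w: "\<omega> \<in> \<Omega>1" for \<omega>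
    proof -
      \<comment> \<open>As \<open>e\<close> annihilates \<open>d1 \<omega>\<close>, the value of
        \<open>g\<close> near \<open>\<omega>\<close> may be subtracted; what remains are
        differences of a Lipschitz function over distances at most \<open>D1\<close>.\<close>
      have "Q \<omega> = aug (\<lambda>v. Gt v - of_int (g (near_vertex \<omega>)) * e v) (d1 \<omega>)"
        unfolding Q_def aug_diff_left using aug_d1[OF w] by simp
      also have "\<bar>\<dots>\<bar> \<le> (eb * of_nat D1) * norm1 (d1 \<omega>)"
      proof (rule abs_aug_le)
        fix v assume v: "v \<in> supp (d1 \<omega>)"
        then have v0: "v \<in> \<Omega>0" using permmodD(2)[OF d1_permmod[OF w]] by blast
        have "\<bar>of_int (g (near_vertex v)) - of_int (g (near_vertex \<omega>)) :: rat\<bar> \<le> of_nat D1"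
          by (rule lip[OF g]) (use nV v0 w b1(2)[OF w v] in auto)
        then have "\<bar>e v\<bar> * \<bar>of_int (g (near_vertex v)) - of_int (g (near_vertex \<omega>))\<bar> \<le> eb * of_nat D1"
          using eb(2)[OF v0] eb(1) by (intro mult_mono) auto
        then show "\<bar>Gt v - of_int (g (near_vertex \<omega>)) * e v\<bar> \<le> eb * of_nat D1"
          unfolding Gt_def abs_mult[symmetric] by (simp add: algebra_simps)
      qed
      also have "\<dots> \<le> B0" unfolding B0_def using b1(1)[OF w] eb(1) by (intro mult_left_mono) auto
      finally show ?thesis .
    qed
    \<comment> \<open>On a chain supported near \<open>u\<close> the factor \<open>f\<close> may be
      frozen at \<open>f u\<close>, after which \<open>P\<close> is \<open>f u\<close> times the
      coboundary of \<open>Gt\<close>.\<close>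
    have approx: "\<bar>aug P z - of_int (f u) * aug Gt (lin d1 z)\<bar> \<le> of_nat D * B0 * norm1 z"
      if z: "z \<in> permmod \<Omega>1" and u: "u \<in> lcos G U" and nr: "\<And>\<omega>. \<omega> \<in> supp z \<Longrightarrow> dist_E u (near_vertex \<omega>) \<le> D" for z u D
    proof -
      have "aug Gt (lin d1 z) = aug Q z" unfolding Q_def by (rule aug_lin[OF z]) (rule d1_permmod)
      then have "aug P z - of_int (f u) * aug Gt (lin d1 z) = aug (\<lambda>\<omega>. P \<omega> - of_int (f u) * Q \<omega>) z"
        unfolding aug_diff_left by simp
      also have "\<bar>\<dots>\<bar> \<le> of_nat D * B0 * norm1 z"
      proof (rule abs_aug_le)
        fix \<omega> assume w: "\<omega> \<in> supp z"
        then have w1: "\<omega> \<in> \<Omega>1" using permmodD(2)[OF z] by blast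
        have "\<bar>of_int (f (near_vertex \<omega>)) - of_int (f u) :: rat\<bar> \<le> of_nat D"
          by (rule lip[OF f]) (use nV w1 u nr[OF w] in auto)
        then have "\<bar>of_int (f (near_vertex \<omega>)) - of_int (f u)\<bar> * \<bar>Q \<omega>\<bar> \<le> of_nat D * B0"
          using Q[OF w1] B0 by (intro mult_mono) auto
        then show "\<bar>P \<omega> - of_int (f u) * Q \<omega>\<bar> \<le> of_nat D * B0"
          unfolding P_def abs_mult[symmetric] by (simp add: algebra_simps)
      qed
      finally show ?thesis .
    qed
    \<comment> \<open>Freezing \<open>f\<close> at the vertex near \<open>t\<close> leaves a
      multiple of a pairing with \<open>d1\<close> of \<open>d2 t\<close>, which vanishes.\<close>
    have bd: "\<bar>aug P (d2 t)\<bar> \<le> B2" if t: "t \<in> \<Omega>2" for t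
    proof -
      have "\<bar>aug P (d2 t) - of_int (f (near_vertex t)) * aug Gt (lin d1 (d2 t))\<bar> \<le> of_nat D2 * B0 * norm1 (d2 t)"
        by (rule approx[OF d2_permmod[OF t]]) (use nV t b2(2)[OF t] in auto)
      also have "\<dots> \<le> B2" unfolding B2_def using b2(1)[OF t] B0 by (intro mult_left_mono) auto
      finally show ?thesis using lin_d1_d2[OF t] by simp
    qed
    have edge: "\<bar>aug P (\<phi> u v) - of_int (f u * (g v - g u))\<bar> \<le> B3" if uv: "E u v" for u v
    proof -
      have V: "u \<in> lcos G U" "v \<in> lcos G U" using E_lcos[OF uv] by auto
      have b: "basis (j, v) \<in> permmod \<Omega>0" "basis (j, u) \<in> permmod \<Omega>0" using basis_permmod[OF j_Omega] V by auto
      have "aug Gt (vdiff u v) = (1 / e (j, U)) * (Gt (j, v) - Gt (j, u))"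
        unfolding vdiff_def aug_smult[OF diff_permmod[OF b]] aug_diff[OF b] aug_basis ..
      also have "\<dots> = of_int (g v) - of_int (g u)"
        unfolding Gt_def using near_vertex_id V e_j[OF V(1)] e_j[OF V(2)] j(3) by (simp add: field_simps)
      finally have "of_int (f u) * aug Gt (lin d1 (\<phi> u v)) = of_int (f u * (g v - g u))" using \<phi>(2)[OF uv] by simp
      moreover have "\<bar>aug P (\<phi> u v) - of_int (f u) * aug Gt (lin d1 (\<phi> u v))\<bar> \<le> of_nat D3 * B0 * norm1 (\<phi> u v)"
        by (rule approx[OF \<phi>(1)[OF uv] V(1) \<phi>(4)[OF uv]])
      moreover have "\<dots> \<le> B3" unfolding B3_def using \<phi>(3)[OF uv] B0 by (intro mult_left_mono) auto
      ultimately show ?thesis by (metis order_trans)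
    qed
    \<comment> \<open>The walk is replaced edge by edge by a chain in \<Omega>1 with the
      corresponding boundary; norms and deviations add up linearly in the length.\<close>
    have chain: "\<exists>S\<in>permmod \<Omega>1. lin d1 S = vdiff u v \<and> norm1 S \<le> N3 * of_nat (length xs) \<and>
        \<bar>aug P S - of_int (line_int f g u xs)\<bar> \<le> B3 * of_nat (length xs)"
      if "walk E u xs v" for u v xs
      using that
    proof (induction xs arbitrary: u)
      case Nil
      then show ?case by (intro bexI[OF _ zero_permmod]) (auto simp: vdiff_def)
    next
      case (Cons w xs)
      have uw: "E u w" and "walk E w xs v" using Cons.prems by auto
      then obtain S where S: "S \<in> permmod \<Omega>1" "lin d1 S = vdiff w v" "norm1 S \<le> N3 * of_nat (length xs)"
        "\<bar>aug P S - of_int (line_int f g w xs)\<bar> \<le> B3 * of_nat (length xs)" using Cons.IH by blast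
      note a = \<phi>(1)[OF uw] S(1)
      show ?case
      proof (intro bexI[OF _ add_permmod[OF a]] conjI)
        show "lin d1 (\<lambda>a. \<phi> u w a + S a) = vdiff u v"
          unfolding lin_add[OF a] \<phi>(2)[OF uw] S(2) vdiff_def by (simp add: fun_eq_iff algebra_simps)
        show "norm1 (\<lambda>a. \<phi> u w a + S a) \<le> N3 * of_nat (length (w # xs))"
          using norm1_add[OF a] S(3) \<phi>(3)[OF uw] by (simp add: algebra_simps)
        show "\<bar>aug P (\<lambda>a. \<phi> u w a + S a) - of_int (line_int f g u (w # xs))\<bar> \<le> B3 * of_nat (length (w # xs))"
          unfolding aug_add[OF a] using edge[OF uw] S(4) by (simp add: algebra_simps)
      qed
    qed
    obtain S where S: "S \<in> permmod \<Omega>1" "lin d1 S = vdiff x x" "norm1 S \<le> N3 * of_nat (length xs)"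
      "\<bar>aug P S - of_int (line_int f g x xs)\<bar> \<le> B3 * of_nat (length xs)" using chain[OF xs] by blast
    have S0: "lin d1 S = (\<lambda>_. 0)" using S(2) unfolding vdiff_def by simp
    have ne: "{y\<in>permmod \<Omega>2. lin d2 y = S} \<noteq> {}" using ex1 S(1) S0 by blast
    \<comment> \<open>The infimum need not be attained. The slack of 1 yields an actual filling and
      becomes the constant term of the bound.\<close>
    have "Inf ((\<lambda>y. real_of_rat (norm1 y)) ` {y\<in>permmod \<Omega>2. lin d2 y = S}) < C * real_of_rat (norm1 S) + 1"
      using iso S(1) S0 by fastforce
    then obtain y where y: "y \<in> permmod \<Omega>2" "lin d2 y = S" "real_of_rat (norm1 y) < C * real_of_rat (norm1 S) + 1"
      using cInf_lessD[of "(\<lambda>y. real_of_rat (norm1 y)) ` {y\<in>permmod \<Omega>2. lin d2 y = S}"] ne by auto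
    have "aug P S = aug (\<lambda>t. aug P (d2 t)) y"
      unfolding y(2)[symmetric] by (rule aug_lin[OF y(1)]) (rule d2_permmod)
    also have "\<bar>\<dots>\<bar> \<le> B2 * norm1 y" by (rule abs_aug_le) (use bd permmodD(2)[OF y(1)] in blast)
    finally have "\<bar>of_int (line_int f g x xs)\<bar> \<le> B3 * of_nat (length xs) + B2 * norm1 y" using S(4) by linarith
    then have "real_of_rat \<bar>of_int (line_int f g x xs)\<bar> \<le> real_of_rat (B3 * of_nat (length xs) + B2 * norm1 y)"
      by (simp only: of_rat_less_eq)
    then have "\<bar>of_int (line_int f g x xs)\<bar> \<le> real_of_rat B3 * real (length xs) + real_of_rat B2 * real_of_rat (norm1 y)"
      by (simp add: of_rat_add of_rat_mult del: of_int_abs add: of_int_abs[symmetric])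
    also have "\<dots> \<le> real_of_rat B3 * real (length xs) + real_of_rat B2 * (C * (real_of_rat N3 * real (length xs)) + 1)"
    proof -
      have "real_of_rat (norm1 S) \<le> real_of_rat (N3 * of_nat (length xs))" using S(3) by (simp only: of_rat_less_eq)
      then have "C * real_of_rat (norm1 S) \<le> C * (real_of_rat N3 * real (length xs))"
        using C by (intro mult_left_mono) (auto simp: of_rat_mult)
      then have "real_of_rat (norm1 y) \<le> C * (real_of_rat N3 * real (length xs)) + 1" using y(3) by linarith
      then show ?thesis using B2 by (intro add_left_mono mult_left_mono) auto
    qed
    finally show ?thesis .
  qed
  define R where "R = real_of_rat B3 + real_of_rat B2 * C * real_of_rat N3 + real_of_rat B2"
  obtain N where N: "R \<le> real N" using real_arch_simple by blast
  show ?thesis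
  proof (intro exI[of _ N] isoperimetric_graph.intro isoperimetric_graph_axioms.intro)
    show "conn_graph (lcos G U) E" by (rule conn_graph_axioms)
    fix x xs and f g :: "'a set \<Rightarrow> int"
    assume a: "x \<in> lcos G U" "walk E x xs x" "\<And>u v. E u v \<Longrightarrow> \<bar>f u - f v\<bar> \<le> 1" "\<And>u v. E u v \<Longrightarrow> \<bar>g u - g v\<bar> \<le> 1"
    define n where "n = real (length xs)"
    have n: "0 \<le> n" unfolding n_def by simp
    have pos: "0 \<le> real_of_rat B3" "0 \<le> real_of_rat B2" "0 \<le> real_of_rat B2 * C * real_of_rat N3"
      using B2 B3 N3 C by auto
    have "\<bar>real_of_int (line_int f g x xs)\<bar> \<le> real_of_rat B3 * n + real_of_rat B2 * (C * (real_of_rat N3 * n) + 1)"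
      unfolding n_def by (rule key[OF a(3,4,1,2)])
    also have "\<dots> \<le> R * (n + 1)"
    proof -
      have "R * (n + 1) = real_of_rat B3 * n + real_of_rat B2 * (C * (real_of_rat N3 * n) + 1) +
          (real_of_rat B2 * n + real_of_rat B3 + real_of_rat B2 * C * real_of_rat N3)"
        unfolding R_def by (simp add: algebra_simps)
      moreover have "0 \<le> real_of_rat B2 * n" using pos n by simp
      ultimately show ?thesis using pos by linarith
    qed
    also have "\<dots> \<le> real N * (n + 1)" using N n by (intro mult_right_mono) auto
    finally have "real_of_int \<bar>line_int f g x xs\<bar> \<le> real_of_int (int N * (int (length xs) + 1))"
      unfolding n_def by simp
    then show "\<bar>line_int f g x xs\<bar> \<le> int N * (int (length xs) + 1)" by (simp only: of_int_le_iff)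
  qed
qed

end

lemma hyperbolic_imp_presented_isoperimetric:
  fixes G :: "('g, 'b) monoid_scheme"
  assumes "tdlc_group G T" "hyperbolic_tdlc G T"
  shows "compactly_presented G T" "weak_linear_isoperimetric G T"
proof -
  obtain U E where hyp: "cayley_abels_graph G T U E" "gromov_hyperbolic_graph (lcos G U) E"
    using assms(2) unfolding hyperbolic_tdlc_def by blast
  have "group G" using assms(1) unfolding tdlc_group_def by (elim conjE)
  then interpret cayley_abels G T U E
    using assms(1) hyp(1) by (simp add: cayley_abels_def tdlc_def cayley_abels_axioms_def tdlc_axioms_def)
  obtain m where "shortcuts m" using hyperbolic_shortcuts[OF hyp(2)] by blast
  then show "compactly_presented G T" "weak_linear_isoperimetric G T"
    using shortcuts_compactly_presented shortcuts_weak_linear_isoperimetric by blast+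
qed

lemma weak_linear_isoperimetric_imp_hyperbolic:
  fixes G :: "('g, 'b) monoid_scheme"
  assumes td: "tdlc_group G T" and cg: "compactly_generated G T" and iso: "weak_linear_isoperimetric G T"
  shows "hyperbolic_tdlc G T"
proof -
  have gr: "group G" using td unfolding tdlc_group_def by (elim conjE)
  interpret tdlc G T using gr td by (simp add: tdlc_def tdlc_axioms_def)
  obtain m0 U0 m1 U1 m2 U2 d2 d1 e and C :: real where res: "resolution2 G T m0 U0 m1 U1 m2 U2 d2 d1 e" and C: "C > 0"
    and ineq: "\<forall>x\<in>permmod (Omega G m1 U1). lin d1 x = (\<lambda>_. 0) \<longrightarrow>
       Inf ((\<lambda>y. real_of_rat (norm1 y)) ` {y\<in>permmod (Omega G m2 U2). lin d2 y = x}) \<le> C * real_of_rat (norm1 x)"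
    using iso unfolding weak_linear_isoperimetric_def by (elim exE conjE)
  have W0: "proper_orbits G T m0 U0" and ah: "aug_hom G (Omega G m0 U0) e"
    and ex: "\<exists>x\<in>permmod (Omega G m0 U0). aug e x = 1"
    using res unfolding resolution2_def by - (elim conjE, assumption)+
  obtain x where x: "x \<in> permmod (Omega G m0 U0)" "aug e x = 1" using ex by blast
  have "\<exists>v\<in>supp x. e v \<noteq> 0"
  proof (rule ccontr)
    assume "\<not> ?thesis"
    then have "aug e x = 0" unfolding aug_def by (intro sum.neutral) auto
    then show False using x(2) by simp
  qed
  then obtain v where v: "v \<in> Omega G m0 U0" "e v \<noteq> 0" using permmodD(2)[OF x(1)] by blast
  obtain j h where j: "j < m0" "h \<in> carrier G" "v = (j, h <#\<^bsub>G\<^esub> U0 j)" using v(1) by (rule OmegaE)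
  have Uj: "cosg (U0 j)" using properD[OF W0 j(1)] .
  have "(j, U0 j) \<in> Omega G m0 U0" unfolding Omega_def using j(1) U_in_lcos[OF Uj] by simp
  then have "e (act G h (j, U0 j)) = e (j, U0 j)" using ah j(2) unfolding aug_hom_def by blast
  then have ej: "e (j, U0 j) \<noteq> 0" using v(2) j(3) unfolding act_def by simp
  obtain E where CA: "cayley_abels_graph G T (U0 j) E" using cayley_abels_graph_exists[OF Uj cg] by blast
  interpret resolved G T "U0 j" E m0 U0 m1 U1 m2 U2 d2 d1 e j
    by unfold_locales (use CA res j(1) ej in auto)
  obtain N where "isoperimetric_graph (lcos G (U0 j)) E N" using line_int_linear_bound[OF C ineq] by blast
  then have "gromov_hyperbolic_graph (lcos G (U0 j)) E" by (rule isoperimetric_graph.hyperbolic)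
  then show ?thesis unfolding hyperbolic_tdlc_def using cg CA by blast
qed

theorem theorem1p4:
  fixes G :: "('g, 'b) monoid_scheme" and T :: "'g topology"
  assumes "tdlc_group G T" and "compactly_generated G T"
  shows "hyperbolic_tdlc G T \<longleftrightarrow> compactly_presented G T \<and> weak_linear_isoperimetric G T"
  using hyperbolic_imp_presented_isoperimetric[OF assms(1)] weak_linear_isoperimetric_imp_hyperbolic[OF assms] by blast

end
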